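(* There exist three vector-valued cusp forms $\Phi_0,\Phi_1,\Phi_2\in S_{1,7}(\Gamma[\sqrt{-3}])$ of weight $(1,7)$ that generate the $M$-module $\mathcal{M}_1^0=\bigoplus_k M_{1,k}(\Gamma[\sqrt{-3}])$ and that satisfy the single relation $\varphi_0\Phi_0+\varphi_1\Phi_1+\varphi_2\Phi_2=0$ (i.e. the $M$-module of relations among $\Phi_0,\Phi_1,\Phi_2$ is generated by this one relation).
   Context: Let $F=\mathbb{Q}(\sqrt{-3})\subset\mathbb{C}$, $\rho=(-1+\sqrt{-3})/2$, $O_F=\mathbb{Z}[\rho]$. Let $h(z,w)=z_1\bar w_2+z_2\bar w_1+z_3\bar w_3$, $\Gamma=\{g\in \mathrm{GL}_3(O_F): h(gz,gw)=h(z,w)\}$, and $\Gamma[\sqrt{-3}]=\{g\in\Gamma: g\equiv 1 \bmod \sqrt{-3}\}$. Let $B=\{(u,v)\in\mathbb{C}^2: 2\,\mathrm{Re}\,v+|u|^2<0\}$, where $(u,v)$ corresponds to the line $(v:1:u)$. A matrix $g=(g_{ij})$ acts by $(u,v)\mapsto\left(\frac{g_{31}v+g_{32}+g_{33}u}{j_1},\frac{g_{11}v+g_{12}+g_{13}u}{j_1}\right)$ with $j_1=j_1(g,u,v)=g_{21}v+g_{22}+g_{23}u$. With $G_{ij}$ the minor of $g_{ij}$ (determinant of the matrix with row $i$ and column $j$ deleted) put $j_2(g,u,v)=\det(g)^{-1}\begin{pmatrix}G_{32}u+G_{33}&G_{32}v+G_{31}\\ G_{12}u+G_{13}&G_{12}v+G_{11}\end{pmatrix}$.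 For $f:B\to \mathrm{Sym}^j(\mathbb{C}^2)$ put $(f|_{j,k}g)(b)=j_1(g,b)^{-k}\,\mathrm{Sym}^j(j_2(g,b)^{-1})f(g\cdot b)$. For a finite index subgroup $\Gamma'\subset\Gamma$ and a finite order character $\chi$ of $\Gamma'$, $M_{j,k}(\Gamma',\chi)$ is the space of holomorphic $f:B\to\mathrm{Sym}^j(\mathbb{C}^2)$ with $f|_{j,k}g=\chi(g)f$ for all $g\in\Gamma'$; $\chi$ is omitted if trivial. Every $f\in M_{j,k}(\Gamma[\sqrt{-3}],\det^\ell)$ has a Fourier-Jacobi expansion $f(u,v)=\sum_{n\ge0}f_n(u)w^n$, $w=e^{2\pi v/\sqrt3}$. The form $f$ is a cusp form ($f\in S_{j,k}$) if for every $\gamma\in\Gamma$ the constant term ($n=0$) in the Fourier-Jacobi expansion of $f|_{j,k}\gamma$ vanishes. $M=\bigoplus_k M_{0,k}(\Gamma[\sqrt{-3}])$ is the ring of scalar-valued modular forms. It is known that $M=\mathbb{C}[\varphi_0,\varphi_1,\varphi_2]$ is a polynomial ring with $\varphi_i\in M_{0,3}(\Gamma[\sqrt{-3}])$; here $\varphi_0,\varphi_1,\varphi_2$ denote these generators, normalized as follows. The four cusps of $\Gamma[\sqrt{-3}]$ are represented by $c_1=(1:0:0)$, $c_2=(0:1:0)$ and $c_3,c_4$ (the points $(\rho:1:\pm1)$ in some fixed order), and for $g\in\Gamma$ with $\det g=1$ inducing the permutation $\sigma$ of the four cusps, $f\mapsto f|g^{-1}$ defines an action of $S_4$. The $\varphi_i$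 all have constant term $1$ in the Fourier-Jacobi expansion, and the forms $x_1=\varphi_0+\varphi_1+\varphi_2$, $x_2=-3\varphi_0+\varphi_1+\varphi_2$, $x_3=\varphi_0-3\varphi_1+\varphi_2$, $x_4=\varphi_0+\varphi_1-3\varphi_2$ satisfy $\sigma(x_i)=\mathrm{sgn}(\sigma)x_{\sigma(i)}$. *)

theory Defs
  imports
    "HOL-Analysis.Analysis"
    "HOL-Computational_Algebra.Polynomial"
    "HOL-Combinatorics.Permutations"
    "HOL-Library.Function_Algebras"
    "HOL-Library.Poly_Mapping"
begin

section \<open>The Picard modular group\<close>

definition sqrt_m3 :: complex where
  "sqrt_m3 = \<i> * complex_of_real (sqrt 3)"

definition rho :: complex where
  "rho = (- 1 + sqrt_m3) / 2"

definition O_F :: "complex set" where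
  "O_F = {of_int a + of_int b * rho | a b. True}"

definition herm :: "complex^3 \<Rightarrow> complex^3 \<Rightarrow> complex" where
  "herm z w = z$1 * cnj (w$2) + z$2 * cnj (w$1) + z$3 * cnj (w$3)"

definition GL3_O_F :: "(complex^3^3) set" where
  "GL3_O_F = {g. (\<forall>i j. g$i$j \<in> O_F) \<and>
     (\<exists>g'. (\<forall>i j. g'$i$j \<in> O_F) \<and> g ** g' = mat 1 \<and> g' ** g = mat 1)}"

definition Gam :: "(complex^3^3) set" where
  "Gam = {g \<in> GL3_O_F. \<forall>z w. herm (g *v z) (g *v w) = herm z w}"

definition Gam_sqrt_m3 :: "(complex^3^3) set" where
  "Gam_sqrt_m3 = {g \<in> Gam. \<forall>i j. \<exists>a\<in>O_F. (g - mat 1)$i$j = sqrt_m3 * a}"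


section \<open>The ball and the factors of automorphy\<close>

text \<open>The ball is made into a type, so that functions on it form a ring under the pointwise
  operations of \<^theory>\<open>HOL-Library.Function_Algebras\<close>.\<close>

typedef picard_ball = "{(u, v). 2 * Re v + (cmod u)\<^sup>2 < 0} :: (complex \<times> complex) set"
  morphisms coords of_coords
proof
  show "(0, - 1) \<in> {(u, v). 2 * Re v + (cmod u)\<^sup>2 < 0}" by simp
qed

definition j1 :: "complex^3^3 \<Rightarrow> picard_ball \<Rightarrow> complex" where
  "j1 g b = (case coords b of (u, v) \<Rightarrow> g$2$1 * v + g$2$2 + g$2$3 * u)"

text \<open>For \<open>g \<in> Gam\<close> the pair below satisfies the inequality that defines the ball.\<close>

definition act :: "complex^3^3 \<Rightarrow> picard_ball \<Rightarrow> picard_ball" where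
  "act g b = (case coords b of (u, v) \<Rightarrow>
     of_coords ((g$3$1 * v + g$3$2 + g$3$3 * u) / j1 g b,
                (g$1$1 * v + g$1$2 + g$1$3 * u) / j1 g b))"

text \<open>\<open>skip i\<close> enumerates the two indices different from \<open>i\<close> in the order 1, 2, 3.
  (In the index type 3 one has \<open>3 = 0\<close>, so the order of that type cannot be used.)\<close>

definition skip :: "3 \<Rightarrow> 2 \<Rightarrow> 3" where
  "skip i a = (if a = 1 then (if i = 1 then 2 else 1) else (if i = 3 then 2 else 3))"

definition minor :: "complex^3^3 \<Rightarrow> 3 \<Rightarrow> 3 \<Rightarrow> complex" where
  "minor g i j = det (\<chi> a b. g $ skip i a $ skip j b)"

definition j2 :: "complex^3^3 \<Rightarrow> picard_ball \<Rightarrow> complex^2^2" where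
  "j2 g b = (case coords b of (u, v) \<Rightarrow>
     (\<chi> r c. inverse (det g) * vector
      [vector [minor g 3 2 * u + minor g 3 3, minor g 3 2 * v + minor g 3 1],
       vector [minor g 1 2 * u + minor g 1 3, minor g 1 2 * v + minor g 1 1]] $ r $ c))"


section \<open>Symmetric powers and the slash operator\<close>

text \<open>The \<open>j\<close>-th symmetric power of \<open>\<complex>\<^sup>2\<close> is modelled by the polynomials of degree at most \<open>j\<close>:
  \<open>X ^ i\<close> stands for the basis vector \<open>e1 ^ (j - i) * e2 ^ i\<close>, which a matrix \<open>A\<close> sends to
  \<open>(A e1) ^ (j - i) * (A e2) ^ i\<close>.  So \<open>j = 0\<close> gives the constants, \<open>j = 1\<close> gives \<open>\<complex>\<^sup>2\<close> via
  \<open>[:x, y:] \<mapsto> (x, y)\<close>, and the product of polynomials is the product of the symmetric algebra;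
  when one factor is constant it is scalar multiplication.\<close>

definition Sym_space :: "nat \<Rightarrow> complex poly set" where
  "Sym_space j = {p. degree p \<le> j}"

definition Sym :: "nat \<Rightarrow> complex^2^2 \<Rightarrow> complex poly \<Rightarrow> complex poly" where
  "Sym j A p = (\<Sum>i\<le>j. smult (coeff p i)
     ([:A$1$1, A$2$1:] ^ (j - i) * [:A$1$2, A$2$2:] ^ i))"

lemma Sym_1: "Sym 1 A [:x, y:] = [:A$1$1 * x + A$1$2 * y, A$2$1 * x + A$2$2 * y:]"
  by (simp add: Sym_def algebra_simps)

type_synonym ball_fun = "picard_ball \<Rightarrow> complex poly"

definition slash :: "nat \<Rightarrow> int \<Rightarrow> ball_fun \<Rightarrow> complex^3^3 \<Rightarrow> ball_fun" where
  "slash j k f g = (\<lambda>b. smult (j1 g b powi (- k)) (Sym j (matrix_inv (j2 g b)) (f (act g b))))"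


section \<open>Modular forms\<close>

text \<open>Holomorphy in two variables: each component has a complex-linear derivative at every point.\<close>

definition holomorphic_on_ball :: "ball_fun \<Rightarrow> bool" where
  "holomorphic_on_ball f \<longleftrightarrow> (\<forall>i b. \<exists>p q.
     ((\<lambda>x. coeff (f (of_coords x)) i) has_derivative (\<lambda>(s, t). p * s + q * t)) (at (coords b)))"

text \<open>Used for finite index subgroups \<open>G\<close> of \<open>Gam\<close> and finite order characters \<open>ch\<close> of \<open>G\<close>.\<close>

definition modular_forms ::
    "nat \<Rightarrow> int \<Rightarrow> (complex^3^3) set \<Rightarrow> (complex^3^3 \<Rightarrow> complex) \<Rightarrow> ball_fun set" where
  "modular_forms j k G ch = {f. holomorphic_on_ball f \<and> (\<forall>b. f b \<in> Sym_space j) \<and>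
     (\<forall>g\<in>G. slash j k f g = (\<lambda>b. smult (ch g) (f b)))}"

definition M_forms :: "nat \<Rightarrow> int \<Rightarrow> ball_fun set" where
  "M_forms j k = modular_forms j k Gam_sqrt_m3 (\<lambda>_. 1)"

text \<open>\<open>c n\<close> is the \<open>n\<close>-th Fourier-Jacobi coefficient of \<open>f\<close>.  The coefficients are unique, since
  for fixed \<open>u\<close> the variable \<open>w\<close> runs through a punctured disc around 0.\<close>

definition FJ_expansion :: "ball_fun \<Rightarrow> (nat \<Rightarrow> complex \<Rightarrow> complex poly) \<Rightarrow> bool" where
  "FJ_expansion f c \<longleftrightarrow> (\<forall>b i. case coords b of (u, v) \<Rightarrow>
     (\<lambda>n. coeff (c n u) i * exp (of_real (2 * pi) * v / of_real (sqrt 3)) ^ n) sums coeff (f b) i)"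

definition FJ_constant_term :: "ball_fun \<Rightarrow> (complex \<Rightarrow> complex poly) \<Rightarrow> bool" where
  "FJ_constant_term f a \<longleftrightarrow> (\<exists>c. FJ_expansion f c \<and> c 0 = a)"

definition S_forms :: "nat \<Rightarrow> int \<Rightarrow> ball_fun set" where
  "S_forms j k = {f \<in> M_forms j k. \<forall>\<gamma>\<in>Gam. FJ_constant_term (slash j k f \<gamma>) (\<lambda>u. 0)}"


section \<open>Graded rings and modules\<close>

text \<open>Elements of the external direct sum over all weights are finitely supported families;
  the product of \<^theory>\<open>HOL-Library.Poly_Mapping\<close> is the convolution
  \<open>(F * G)\<^sub>k = (\<Sum>i + j = k. F\<^sub>i * G\<^sub>j)\<close>.  So \<open>graded_forms 0\<close> is the ring of scalar-valued forms,
  and \<open>graded_forms j\<close> is a module over it.\<close>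

type_synonym graded = "int \<Rightarrow>\<^sub>0 ball_fun"

definition graded_forms :: "nat \<Rightarrow> graded set" where
  "graded_forms j = {F. \<forall>k. Poly_Mapping.lookup F k \<in> M_forms j k}"

abbreviation homog :: "int \<Rightarrow> ball_fun \<Rightarrow> graded" where
  "homog k f \<equiv> Poly_Mapping.single k f"

definition graded_const :: "complex \<Rightarrow> graded" where
  "graded_const c = homog 0 (\<lambda>b. [:c:])"

text \<open>A polynomial over the complex numbers in three variables is given by its finitely supported
  family of coefficients, indexed by the exponents.\<close>

definition eval3 :: "(nat \<times> nat \<times> nat \<Rightarrow>\<^sub>0 complex) \<Rightarrow> graded \<Rightarrow> graded \<Rightarrow> graded \<Rightarrow> graded" where
  "eval3 P x y z =
     (\<Sum>(l, m, n)\<in>Poly_Mapping.keys P.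
        graded_const (Poly_Mapping.lookup P (l, m, n)) * x ^ l * y ^ m * z ^ n)"

definition polynomial_ring_of_forms :: "ball_fun \<Rightarrow> ball_fun \<Rightarrow> ball_fun \<Rightarrow> bool" where
  "polynomial_ring_of_forms \<phi>0 \<phi>1 \<phi>2 \<longleftrightarrow>
     \<phi>0 \<in> M_forms 0 3 \<and> \<phi>1 \<in> M_forms 0 3 \<and> \<phi>2 \<in> M_forms 0 3 \<and>
     (\<forall>F\<in>graded_forms 0. \<exists>!P. F = eval3 P (homog 3 \<phi>0) (homog 3 \<phi>1) (homog 3 \<phi>2))"


section \<open>Cusps and the normalization of the generators\<close>

text \<open>The sign \<open>s \<in> {1, -1}\<close> fixes which of the points \<open>(\<rho> : 1 : \<plusminus>1)\<close> is the third cusp.\<close>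

definition cusp :: "complex \<Rightarrow> nat \<Rightarrow> complex^3" where
  "cusp s i = (if i = 1 then vector [1, 0, 0]
     else if i = 2 then vector [0, 1, 0]
     else if i = 3 then vector [rho, 1, s]
     else vector [rho, 1, - s])"

text \<open>\<open>g\<close> maps the \<open>Gam_sqrt_m3\<close>-orbit of the line spanned by \<open>cusp s i\<close> to that of \<open>cusp s (\<sigma> i)\<close>.\<close>

definition induces_perm :: "complex \<Rightarrow> complex^3^3 \<Rightarrow> (nat \<Rightarrow> nat) \<Rightarrow> bool" where
  "induces_perm s g \<sigma> \<longleftrightarrow> \<sigma> permutes {1..4} \<and>
     (\<forall>i\<in>{1..4}. \<exists>\<gamma>\<in>Gam_sqrt_m3. \<exists>c. c \<noteq> 0 \<and> \<gamma> *v (g *v cusp s i) = c *s cusp s (\<sigma> i))"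

definition x_form :: "ball_fun \<Rightarrow> ball_fun \<Rightarrow> ball_fun \<Rightarrow> nat \<Rightarrow> ball_fun" where
  "x_form \<phi>0 \<phi>1 \<phi>2 i = (if i = 1 then \<phi>0 + \<phi>1 + \<phi>2
     else if i = 2 then - 3 * \<phi>0 + \<phi>1 + \<phi>2
     else if i = 3 then \<phi>0 - 3 * \<phi>1 + \<phi>2
     else \<phi>0 + \<phi>1 - 3 * \<phi>2)"

definition normalized_generators ::
    "complex \<Rightarrow> ball_fun \<Rightarrow> ball_fun \<Rightarrow> ball_fun \<Rightarrow> bool" where
  "normalized_generators s \<phi>0 \<phi>1 \<phi>2 \<longleftrightarrow>
     polynomial_ring_of_forms \<phi>0 \<phi>1 \<phi>2 \<and>
     FJ_constant_term \<phi>0 (\<lambda>u. 1) \<and> FJ_constant_term \<phi>1 (\<lambda>u. 1) \<and> FJ_constant_term \<phi>2 (\<lambda>u. 1) \<and>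
     (\<forall>g\<in>Gam. \<forall>\<sigma>. det g = 1 \<and> induces_perm s g \<sigma> \<longrightarrow>
        (\<forall>i\<in>{1..4}. slash 0 3 (x_form \<phi>0 \<phi>1 \<phi>2 i) (matrix_inv g)
           = of_int (sign \<sigma>) * x_form \<phi>0 \<phi>1 \<phi>2 (\<sigma> i)))"

end

theory Submission
  imports Defs "HOL-Complex_Analysis.Complex_Analysis"
begin

text \<open>
  Since \<open>j1 * j2\<close> is the inverse transpose of the derivative of the action, the brackets
  \<open>\<phi>\<^sub>i d\<phi>\<^sub>j - \<phi>\<^sub>j d\<phi>\<^sub>i\<close> are forms of weight \<open>(1, 7)\<close>; these are the generators, and the relation is
  visible. They are cusp forms because the \<open>\<phi>\<^sub>i\<close> have constant terms independent of \<open>u\<close> and because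
  each \<open>\<gamma>\<close> in \<open>Gam\<close> acts linearly on the span of the \<open>\<phi>\<^sub>i\<close>.

  The main step is that every scalar form \<open>G\<close> with character \<open>1 / det\<close> is a multiple of the
  Jacobian \<open>J\<close> of the \<open>\<phi>\<^sub>i\<close>. Such a form vanishes to second order along the mirrors of the reflections
  of order three, which lie over the six lines \<open>x\<^sub>i = x\<^sub>j\<close>. The action of \<open>S\<^sub>4\<close> and the constant
  terms show that the \<open>\<phi>\<^sub>i\<close> span a two-dimensional space on a mirror; as \<open>J ^ 3\<close> is a polynomial
  in the \<open>\<phi>\<^sub>i\<close>, comparing orders shows that the equation of a line vanishes exactly to third order on
  its mirror. Hence a product of three such forms is divisible by the square of the product of the six
  lines. This square is a multiple of \<open>J ^ 3\<close>, and \<open>G * J * J\<close> being divisible by it, \<open>J\<close> divides \<open>G\<close>.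

  For \<open>F\<close> of weight \<open>(1, k)\<close> this gives \<open>F \<and> \<Phi>\<^sub>i = J T\<^sub>i\<close> with \<open>\<Sum> \<phi>\<^sub>i T\<^sub>i = 0\<close>, and exactness of
  the Koszul complex yields the coefficients of \<open>F\<close> with respect to the \<open>\<Phi>\<^sub>i\<close>.
\<close>

section \<open>Holomorphic functions of two complex variables\<close>

text \<open>The wedge of two vector-valued forms picks up the Jacobian \<open>det g / j1 ^ 3\<close>
  of the action; this forces the character \<open>1 / det\<close> on the scalar forms to be studied.
  They are not themselves covered by the description of the ring of forms, but \<open>det g\<close>
  is a cube root of unity on \<open>Gam_sqrt_m3\<close>, so products of three of them are
  polynomials in the generators. The third variable of these polynomials is
  \<open>f0 = p1 - p2\<close> instead of \<open>p2\<close>, so that the mirror \<open>u = 0\<close>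
  becomes the coordinate line \<open>PZ = 0\<close>. Divisibility of functions of two variables is
  thereby replaced by Taylor series in \<open>u\<close> and by arithmetic of polynomials. The order
  \<open>m\<close> of \<open>f0\<close> is a multiple of 3 by the reflection, and \<open>jac\<close>
  has order \<open>m - 1\<close> because its leading part is \<open>d1 f0\<close> times a Wronskian
  on the mirror; that \<open>m\<close> divides \<open>3 (m - 1)\<close> leaves \<open>m = 3\<close>.
  The squared product of the six lines has degree 12, and \<open>jac ^ 3\<close>, of weight 36, has
  degree 12 too, so no room is left for a further factor.\<close>

definition partial1 :: "(complex \<times> complex \<Rightarrow> complex) \<Rightarrow> complex \<times> complex \<Rightarrow> complex" where
  "partial1 f x = deriv (\<lambda>z. f (z, snd x)) (fst x)"

definition partial2 :: "(complex \<times> complex \<Rightarrow> complex) \<Rightarrow> complex \<times> complex \<Rightarrow> complex" where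
  "partial2 f x = deriv (\<lambda>z. f (fst x, z)) (snd x)"

definition holo2 :: "(complex \<times> complex \<Rightarrow> complex) \<Rightarrow> (complex \<times> complex) set \<Rightarrow> bool" where
  "holo2 f U \<longleftrightarrow> (\<forall>x\<in>U. \<exists>p q. (f has_derivative (\<lambda>(s, t). p * s + q * t)) (at x))"

text \<open>The integrand over \<open>t\<close> in \<open>[0, 1]\<close> of Cauchy's formula for the
  first partial derivative, along the circle of radius \<open>r\<close> about \<open>a\<close>; the
  last factor is the velocity of \<open>circlepath\<close>. The second variable enters only through
  \<open>f\<close>.\<close>

definition cauchy_kernel :: "(complex \<times> complex \<Rightarrow> complex) \<Rightarrow> complex \<Rightarrow> real \<Rightarrow> complex \<times> complex \<Rightarrow> real \<Rightarrow> complex" where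
  "cauchy_kernel f a r x t = 1 / (2 * of_real pi * \<i>) *
     (f (circlepath a r t, snd x) / (circlepath a r t - fst x)^2 * (2 * pi * \<i> * r * exp (2 * pi * \<i> * t)))"

lemma bicylinder_subset:
  fixes x :: "complex \<times> complex"
  assumes "open U" "x \<in> U"
  obtains r where "r > 0" "cball (fst x) r \<times> cball (snd x) r \<subseteq> U"
proof -
  obtain A B where AB: "open A" "open B" "x \<in> A \<times> B" "A \<times> B \<subseteq> U"
    using assms by (metis open_prod_elim)
  obtain r1 where r1: "r1 > 0" "cball (fst x) r1 \<subseteq> A"
    using AB(1,3) open_contains_cball by (metis mem_Times_iff)
  obtain r2 where r2: "r2 > 0" "cball (snd x) r2 \<subseteq> B"
    using AB(2,3) open_contains_cball by (metis mem_Times_iff)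
  have "cball (fst x) (min r1 r2) \<times> cball (snd x) (min r1 r2) \<subseteq> U"
    using r1 r2 AB(4) by (fastforce simp: subset_iff)
  then show ?thesis using r1 r2 that[of "min r1 r2"] by auto
qed

lemma circlepath_integrand:
  assumes "r > 0"
  shows "contour_integral (circlepath z r) g =
    integral {0..1} (\<lambda>t. g (circlepath z r t) * (2 * pi * \<i> * r * exp (2 * pi * \<i> * t)))"
  unfolding contour_integral_integral
  by (rule integral_cong) (simp add: vector_derivative_circlepath)

text \<open>The second variable is a mere parameter here, so Cauchy's formula in one variable
  applies; a single circle serves all points of \<open>ball a r \<times> V\<close>.\<close>

lemma deriv_integral_formula:
  fixes f :: "complex \<times> complex \<Rightarrow> complex"
  assumes "r > 0" "cball a r \<times> V \<subseteq> U" "continuous_on U f" "v \<in> V" "u \<in> ball a r"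
    and "\<And>x. x \<in> U \<Longrightarrow> (\<lambda>z. f (z, snd x)) field_differentiable at (fst x)"
  shows "partial1 f (u, v) = integral (cbox 0 1) (cauchy_kernel f a r (u, v))"
proof -
  have c: "continuous_on (cball a r) (\<lambda>z. f (z, v))"
    by (rule continuous_on_compose2[OF assms(3)]) (use assms in \<open>auto intro!: continuous_intros\<close>)
  have h: "(\<lambda>z. f (z, v)) holomorphic_on ball a r"
    unfolding holomorphic_on_def using assms(2,4,6)
    by (metis ball_subset_cball field_differentiable_at_within fst_conv mem_Sigma_iff snd_conv subset_iff)
  have "((\<lambda>z. f (z, v)) has_field_derivative (1 / (2 * of_real pi * \<i>) *
      contour_integral (circlepath a r) (\<lambda>w. f (w, v) / (w - u)^2))) (at u)"
    by (rule Cauchy_derivative_integral_circlepath(2)[OF c h assms(5)])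
  then show ?thesis
    by (simp add: partial1_def DERIV_imp_deriv circlepath_integrand[OF assms(1)] cauchy_kernel_def[abs_def]
        box_real algebra_simps flip: integral_mult_right)
qed

lemma circlepath_neq:
  assumes "u \<in> ball a r" "t \<in> {0..1}"
  shows "circlepath a r t \<noteq> u"
proof -
  have "r > 0" using assms(1) by (metis ball_eq_empty empty_iff not_le)
  then have "circlepath a r t \<in> sphere a r"
    using assms(2) by (auto simp: path_image_circlepath_nonneg[symmetric] path_image_def)
  then show ?thesis using assms(1) by auto
qed

lemma circlepath_in_cball: "r > 0 \<Longrightarrow> circlepath a r t \<in> cball a r"
  by (simp add: circlepath dist_norm norm_mult)

lemma continuous_on_circlepath: "continuous_on A (\<lambda>x. circlepath a r (h x))"
  if "continuous_on A h"
  unfolding circlepath_def using that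
  by (auto simp: part_circlepath_def linepath_def intro!: continuous_intros)

lemma continuous_on_cauchy_kernel:
  assumes f: "continuous_on U f" and r: "r > 0" "cball a r \<times> V \<subseteq> U"
  shows "continuous_on ((ball a r \<times> V) \<times> cbox 0 1) (\<lambda>(x, t). cauchy_kernel f a r x t)"
proof -
  have 1: "continuous_on ((ball a r \<times> V) \<times> cbox 0 1) (\<lambda>p. f (circlepath a r (snd p), snd (fst p)))"
    by (rule continuous_on_compose2[OF f])
      (use r circlepath_in_cball in \<open>force intro!: continuous_intros continuous_on_circlepath\<close>)+
  show ?thesis
    unfolding split_beta cauchy_kernel_def using circlepath_neq
    by (intro continuous_intros 1 continuous_on_circlepath) (fastforce simp: mem_Times_iff)+
qed

text \<open>Near each point a fixed circle can be used, and the derivative is then an integral whose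
  kernel is jointly continuous in the point and the parameter.\<close>

lemma partial1_continuous_on:
  fixes f :: "complex \<times> complex \<Rightarrow> complex"
  assumes U: "open U" and c: "continuous_on U f"
    and d: "\<And>x. x \<in> U \<Longrightarrow> (\<lambda>z. f (z, snd x)) field_differentiable at (fst x)"
  shows "continuous_on U (partial1 f)"
proof -
  have "isCont (partial1 f) x" if x: "x \<in> U" for x
  proof -
    obtain r where r: "r > 0" "cball (fst x) r \<times> cball (snd x) r \<subseteq> U"
      using bicylinder_subset[OF U x] .
    have sub: "cball (fst x) r \<times> ball (snd x) r \<subseteq> U" using r(2) by force
    let ?V = "ball (fst x) r \<times> ball (snd x) r"
    have V: "open ?V" "x \<in> ?V" using r by (auto simp: mem_Times_iff open_Times)
    have "continuous_on ?V (\<lambda>y. integral (cbox 0 1) (cauchy_kernel f (fst x) r y))"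
      by (rule integral_continuous_on_param[OF continuous_on_cauchy_kernel[OF c r(1) sub]])
    then have "continuous_on ?V (partial1 f)"
      by (rule continuous_on_eq)
        (use deriv_integral_formula[OF r c _ _ d] in auto)
    then show ?thesis using V continuous_on_eq_continuous_at by blast
  qed
  then show ?thesis by (simp add: continuous_at_imp_continuous_on)
qed

lemma partial2_swap: "partial2 f x = partial1 (\<lambda>y. f (prod.swap y)) (prod.swap x)"
  by (simp add: partial1_def partial2_def)

lemma partial2_continuous_on:
  fixes f :: "complex \<times> complex \<Rightarrow> complex"
  assumes U: "open U" and c: "continuous_on U f"
    and d: "\<And>x. x \<in> U \<Longrightarrow> (\<lambda>z. f (fst x, z)) field_differentiable at (snd x)"
  shows "continuous_on U (partial2 f)"
proof -
  let ?U = "prod.swap ` U"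
  have eq: "?U = prod.swap -` U" by (force simp: image_iff)
  have "open ?U" unfolding eq by (intro open_vimage U continuous_intros continuous_on_swap)
  moreover have "continuous_on ?U (\<lambda>y. f (prod.swap y))"
    by (rule continuous_on_compose2[OF c continuous_on_swap]) auto
  ultimately have "continuous_on ?U (partial1 (\<lambda>y. f (prod.swap y)))"
    by (rule partial1_continuous_on) (use d in auto)
  then show ?thesis
    unfolding partial2_swap[abs_def] by (rule continuous_on_compose2[OF _ continuous_on_swap]) auto
qed

lemma holo2_continuous_on:
  assumes "holo2 f U"
  shows "continuous_on U f"
  using assms unfolding holo2_def
  by (meson continuous_at_imp_continuous_on has_derivative_continuous)

lemma has_derivative_imp_partial1:
  assumes "(f has_derivative (\<lambda>(s, t). p * s + q * t)) (at (u, v))"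
  shows "((\<lambda>z. f (z, v)) has_field_derivative p) (at u)"
proof -
  have "((\<lambda>z. (z, v)) has_derivative (\<lambda>t. (t, 0))) (at u)"
    by (intro derivative_eq_intros) auto
  from has_derivative_compose[OF this assms]
  show ?thesis by (simp add: has_field_derivative_def)
qed

lemma has_derivative_imp_partial2:
  assumes "(f has_derivative (\<lambda>(s, t). p * s + q * t)) (at (u, v))"
  shows "((\<lambda>z. f (u, z)) has_field_derivative q) (at v)"
proof -
  have "((\<lambda>z. (u, z)) has_derivative (\<lambda>t. (0, t))) (at v)"
    by (intro derivative_eq_intros) auto
  from has_derivative_compose[OF this assms]
  show ?thesis by (simp add: has_field_derivative_def)
qed

lemma holo2_field_differentiable:
  assumes "holo2 f U" "x \<in> U"
  shows "(\<lambda>z. f (z, snd x)) field_differentiable at (fst x)"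
    "(\<lambda>z. f (fst x, z)) field_differentiable at (snd x)"
  using has_derivative_imp_partial1[of f _ _ "fst x" "snd x"]
    has_derivative_imp_partial2[of f _ _ "fst x" "snd x"] assms
  unfolding holo2_def field_differentiable_def by (metis prod.collapse)+

text \<open>Osgood's lemma. Total differentiability follows from the existence of both partial
  derivatives and the continuity of one of them, here \<open>partial2 f\<close>, which Cauchy's
  formula supplies.\<close>

lemma separately_holomorphic_imp_holo2:
  fixes f :: "complex \<times> complex \<Rightarrow> complex"
  assumes U: "open U" and c: "continuous_on U f"
    and d1: "\<And>x. x \<in> U \<Longrightarrow> (\<lambda>z. f (z, snd x)) field_differentiable at (fst x)"
    and d2: "\<And>x. x \<in> U \<Longrightarrow> (\<lambda>z. f (fst x, z)) field_differentiable at (snd x)"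
  shows "holo2 f U"
  unfolding holo2_def
proof
  fix x assume x: "x \<in> U"
  obtain r where r: "r > 0" "cball (fst x) r \<times> cball (snd x) r \<subseteq> U"
    using bicylinder_subset[OF U x] .
  let ?X = "ball (fst x) r" let ?Y = "ball (snd x) r"
  have XY: "?X \<times> ?Y \<subseteq> U" using r(2) by force
  have "((\<lambda>(a, b). f (a, b)) has_derivative
     (\<lambda>(tx, ty). partial1 f x * tx + blinfun_mult_right (partial2 f (fst x, snd x)) ty))
      (at (fst x, snd x) within ?X \<times> ?Y)"
  proof (rule has_derivative_partialsI)
    show "((\<lambda>a. f (a, snd x)) has_derivative (*) (partial1 f x)) (at (fst x) within ?X)"
      using d1[OF x] unfolding partial1_def
      by (metis DERIV_deriv_iff_field_differentiable has_derivative_at_withinI has_field_derivative_def)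
    show "((\<lambda>b. f (a, b)) has_derivative blinfun_apply (blinfun_mult_right (partial2 f (a, b)))) (at b within ?Y)"
      if "a \<in> ?X" "b \<in> ?Y" for a b
      using d2[of "(a, b)"] that XY
      by (auto simp: partial2_def blinfun_mult_right.rep_eq o_def subset_iff
          simp flip: has_field_derivative_def DERIV_deriv_iff_field_differentiable
          intro: has_field_derivative_at_within)
    have "continuous (at x) (partial2 f)"
      using partial2_continuous_on[OF U c d2] U x continuous_on_eq_continuous_at by blast
    then have "continuous (at x) (\<lambda>y. blinfun_mult_right (partial2 f y))"
      by (rule bounded_linear.continuous[OF bounded_linear_blinfun_mult_right])
    then show "continuous (at (fst x, snd x) within ?X \<times> ?Y) (\<lambda>(a, b). blinfun_mult_right (partial2 f (a, b)))"
      by (simp add: continuous_at_imp_continuous_at_within split_beta')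
  qed (use r in auto)
  then have "(f has_derivative (\<lambda>(s, t). partial1 f x * s + partial2 f x * t)) (at x within ?X \<times> ?Y)"
    by (simp add: blinfun_mult_right.rep_eq)
  moreover have "at x within ?X \<times> ?Y = at x"
    using r by (intro at_within_open) (auto simp: mem_Times_iff open_Times)
  ultimately show "\<exists>p q. (f has_derivative (\<lambda>(s, t). p * s + q * t)) (at x)" by metis
qed

text \<open>Differentiation under the integral sign in Cauchy's formula. It makes
  \<open>partial1 f\<close> holomorphic in the second variable and gives the derivative in a form
  that shows the symmetry of the mixed derivatives.\<close>

lemma partial1_has_derivative2_integral:
  assumes U: "open U" and f: "holo2 f U" and x: "x \<in> U"
    and r: "r > 0" "cball (fst x) r \<times> cball (snd x) r \<subseteq> U"
  shows "((\<lambda>v. partial1 f (fst x, v)) has_field_derivative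
    integral (cbox 0 1) (cauchy_kernel (partial2 f) (fst x) r x)) (at (snd x))"
proof -
  note c = holo2_continuous_on[OF f]
  note d = holo2_field_differentiable[OF f]
  let ?u = "fst x" let ?Y = "ball (snd x) r" let ?c = "circlepath ?u r"
  have Y_U: "cball ?u r \<times> ?Y \<subseteq> U" using r(2) by force
  have in_U: "(?c t, v) \<in> U" if "v \<in> ?Y" for t v
    using circlepath_in_cball[OF r(1)] that Y_U by (auto simp: subset_iff)
  have cont: "continuous_on (?Y \<times> cbox 0 1) (\<lambda>(v, t). cauchy_kernel g ?u r (?u, v) t)"
    if g: "continuous_on U g" for g
  proof -
    have "continuous_on (?Y \<times> cbox 0 1) (\<lambda>p. (\<lambda>(x, t). cauchy_kernel g ?u r x t) ((?u, fst p), snd p))"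
      by (rule continuous_on_compose2[OF continuous_on_cauchy_kernel[OF g r(1) Y_U]])
        (use r(1) in \<open>auto intro!: continuous_intros\<close>)
    then show ?thesis by (simp add: split_beta)
  qed
  have "((\<lambda>v. integral (cbox 0 1) (cauchy_kernel f ?u r (?u, v))) has_field_derivative
      integral (cbox 0 1) (cauchy_kernel (partial2 f) ?u r (?u, snd x))) (at (snd x) within ?Y)"
  proof (rule leibniz_rule_field_derivative)
    show "((\<lambda>v. cauchy_kernel f ?u r (?u, v) t) has_field_derivative cauchy_kernel (partial2 f) ?u r (?u, v) t) (at v within ?Y)"
      if "v \<in> ?Y" "t \<in> cbox 0 1" for v t
    proof -
      have "((\<lambda>v. f (?c t, v)) has_field_derivative partial2 f (?c t, v)) (at v)"
        using d(2)[of "(?c t, v)"] in_U[of v t] that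
        by (simp add: partial2_def DERIV_deriv_iff_field_differentiable)
      then show ?thesis unfolding cauchy_kernel_def fst_conv snd_conv
        by (rule DERIV_cmult[OF DERIV_cmult_right[OF DERIV_cdivide[OF has_field_derivative_at_within]]])
    qed
    show "cauchy_kernel f ?u r (?u, v) integrable_on cbox 0 1" if "v \<in> ?Y" for v
    proof (rule integrable_continuous)
      have "continuous_on (cbox 0 1) (\<lambda>t. (\<lambda>(v, t). cauchy_kernel f ?u r (?u, v) t) (v, t))"
        by (rule continuous_on_compose2[OF cont[OF c]])
          (use that in \<open>auto intro!: continuous_intros\<close>)
      then show "continuous_on (cbox 0 1) (cauchy_kernel f ?u r (?u, v))" by simp
    qed
    show "continuous_on (?Y \<times> cbox 0 1) (\<lambda>(v, t). cauchy_kernel (partial2 f) ?u r (?u, v) t)"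
      by (rule cont[OF partial2_continuous_on[OF U c d(2)]])
  qed (use r in auto)
  then have "((\<lambda>v. integral (cbox 0 1) (cauchy_kernel f ?u r (?u, v))) has_field_derivative
      integral (cbox 0 1) (cauchy_kernel (partial2 f) ?u r x)) (at (snd x))"
    using r(1) by (simp only: at_within_open[OF centre_in_ball[THEN iffD2, OF r(1)] open_ball] prod.collapse)
  then show ?thesis
  proof (rule has_field_derivative_transform_within_open[where S = ?Y])
    show "integral (cbox 0 1) (cauchy_kernel f ?u r (?u, v)) = partial1 f (?u, v)" if v: "v \<in> ?Y" for v
      by (rule deriv_integral_formula[symmetric, OF r(1) Y_U c v _ d(1)]) (use r(1) in simp_all)
  qed (use r(1) in simp_all)
qed

lemma holo2_partial1:
  assumes U: "open U" and f: "holo2 f U"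
  shows "holo2 (partial1 f) U"
proof (rule separately_holomorphic_imp_holo2[OF U])
  note c = holo2_continuous_on[OF f]
  note d = holo2_field_differentiable[OF f]
  show "continuous_on U (partial1 f)" by (rule partial1_continuous_on[OF U c d(1)])
  fix x assume x: "x \<in> U"
  obtain r where r: "r > 0" "cball (fst x) r \<times> cball (snd x) r \<subseteq> U"
    using bicylinder_subset[OF U x] .
  let ?X = "ball (fst x) r" let ?Y = "ball (snd x) r"
  have XY: "?X \<times> ?Y \<subseteq> U" using r(2) by force
  have "(\<lambda>z. f (z, snd x)) holomorphic_on ?X"
    unfolding holomorphic_on_def using XY d(1)
    by (metis centre_in_ball field_differentiable_at_within fst_conv mem_Sigma_iff r(1) snd_conv subset_iff)
  then have "deriv (\<lambda>z. f (z, snd x)) holomorphic_on ?X" by (intro holomorphic_deriv) auto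
  then show "(\<lambda>z. partial1 f (z, snd x)) field_differentiable at (fst x)"
    unfolding partial1_def using r(1) by (auto intro: holomorphic_on_imp_differentiable_at)
  show "(\<lambda>z. partial1 f (fst x, z)) field_differentiable at (snd x)"
    using partial1_has_derivative2_integral[OF U f x r] field_differentiable_def by blast
qed

lemma holo2_compose_swap:
  assumes "holo2 f U"
  shows "holo2 (\<lambda>y. f (prod.swap y)) (prod.swap ` U)"
  unfolding holo2_def
proof
  fix y assume "y \<in> prod.swap ` U"
  then have "prod.swap y \<in> U" by auto
  then obtain p q where "(f has_derivative (\<lambda>(s, t). p * s + q * t)) (at (prod.swap y))"
    using assms unfolding holo2_def by blast
  moreover have "(prod.swap has_derivative prod.swap) (at y)"
    unfolding prod.swap_def[abs_def]
    by (intro bounded_linear_imp_has_derivative bounded_linear_Pair bounded_linear_fst bounded_linear_snd)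
  ultimately have "((\<lambda>y. f (prod.swap y)) has_derivative (\<lambda>x. case prod.swap x of (s, t) \<Rightarrow> p * s + q * t)) (at y)"
    by (metis has_derivative_compose)
  moreover have "(\<lambda>x. case prod.swap x of (s, t) \<Rightarrow> p * s + q * t) = (\<lambda>(s, t). q * s + p * t)"
    by (auto simp: fun_eq_iff)
  ultimately show "\<exists>p q. ((\<lambda>y. f (prod.swap y)) has_derivative (\<lambda>(s, t). p * s + q * t)) (at y)"
    by metis
qed

lemma holo2_partial2:
  assumes U: "open U" and f: "holo2 f U"
  shows "holo2 (partial2 f) U"
proof -
  have eq: "prod.swap ` U = prod.swap -` U" by (force simp: image_iff)
  have "open (prod.swap ` U)" unfolding eq by (intro open_vimage U continuous_intros continuous_on_swap)
  from holo2_compose_swap[OF holo2_partial1[OF this holo2_compose_swap[OF f]]]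
  show ?thesis by (simp add: partial2_swap[abs_def] image_image)
qed

text \<open>Both sides are the Cauchy integral of \<open>partial2 f\<close> over the same
  circle.\<close>

lemma partial2_partial1:
  assumes U: "open U" and f: "holo2 f U" and x: "x \<in> U"
  shows "partial2 (partial1 f) x = partial1 (partial2 f) x"
proof -
  obtain r where r: "r > 0" "cball (fst x) r \<times> cball (snd x) r \<subseteq> U"
    using bicylinder_subset[OF U x] .
  have Y_U: "cball (fst x) r \<times> ball (snd x) r \<subseteq> U" using r(2) by force
  note h = holo2_partial2[OF U f]
  have "partial2 (partial1 f) x = integral (cbox 0 1) (cauchy_kernel (partial2 f) (fst x) r (fst x, snd x))"
    using DERIV_imp_deriv[OF partial1_has_derivative2_integral[OF U f x r]] by (simp add: partial2_def)
  also have "\<dots> = partial1 (partial2 f) (fst x, snd x)"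
    by (rule deriv_integral_formula[symmetric, OF r(1) Y_U holo2_continuous_on[OF h] _ _ holo2_field_differentiable(1)[OF h]])
      (use r(1) in simp_all)
  finally show ?thesis by simp
qed

section \<open>Holomorphic functions on the ball\<close>

definition ball_coords :: "(complex \<times> complex) set" where
  "ball_coords = {(u, v). 2 * Re v + (cmod u)\<^sup>2 < 0}"

lemma coords_in_ball [simp]: "coords b \<in> ball_coords"
  using coords[of b] by (simp add: ball_coords_def)

lemma coords_of_coords [simp]: "x \<in> ball_coords \<Longrightarrow> coords (of_coords x) = x"
  using of_coords_inverse[of x] by (simp add: ball_coords_def)

lemma of_coords_coords [simp]: "of_coords (coords b) = b"
  by (rule coords_inverse)

lemma ball_cases: obtains u v where "(u, v) \<in> ball_coords" "b = of_coords (u, v)"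
  by (metis coords_in_ball of_coords_coords surj_pair)

lemma open_ball_coords: "open ball_coords"
proof -
  have eq: "ball_coords = {x. 2 * Re (snd x) + (cmod (fst x))\<^sup>2 < 0}"
    by (auto simp: ball_coords_def)
  show ?thesis
    unfolding eq by (intro open_Collect_less continuous_intros)
qed

lemma convex_ball_coords: "convex ball_coords"
proof (rule convexI)
  fix x y :: "complex \<times> complex" and s t :: real
  assume x: "x \<in> ball_coords" and y: "y \<in> ball_coords" and st: "0 \<le> s" "0 \<le> t" "s + t = 1"
  obtain u v where xv: "x = (u, v)" by force
  obtain u' v' where yv: "y = (u', v')" by force
  have 1: "2 * Re v < - (cmod u)\<^sup>2" "2 * Re v' < - (cmod u')\<^sup>2"
    using x y xv yv by (auto simp: ball_coords_def)
  have "cmod (s *\<^sub>R u + t *\<^sub>R u') \<le> s * cmod u + t * cmod u'"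
    using st by (metis norm_triangle_ineq norm_scaleR abs_of_nonneg)
  then have "(cmod (s *\<^sub>R u + t *\<^sub>R u'))\<^sup>2 \<le> (s * cmod u + t * cmod u')\<^sup>2"
    by (simp add: power_mono)
  also have "\<dots> \<le> s * (cmod u)\<^sup>2 + t * (cmod u')\<^sup>2"
  proof -
    have t: "t = 1 - s" using st by simp
    have "s * (cmod u)\<^sup>2 + t * (cmod u')\<^sup>2 - (s * cmod u + t * cmod u')\<^sup>2 = s * t * (cmod u - cmod u')\<^sup>2"
      unfolding t by (simp add: power2_eq_square algebra_simps)
    moreover have "s * t * (cmod u - cmod u')\<^sup>2 \<ge> 0" using st by simp
    ultimately show ?thesis by linarith
  qed
  finally have 2: "(cmod (s *\<^sub>R u + t *\<^sub>R u'))\<^sup>2 \<le> s * (cmod u)\<^sup>2 + t * (cmod u')\<^sup>2" .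
  have "s * (2 * Re v + (cmod u)\<^sup>2) + t * (2 * Re v' + (cmod u')\<^sup>2) < 0"
  proof (cases "s = 0")
    case True
    then show ?thesis using st 1 by simp
  next
    case False
    then have "s * (2 * Re v + (cmod u)\<^sup>2) < 0" using st 1 by (simp add: mult_pos_neg)
    moreover have "t * (2 * Re v' + (cmod u')\<^sup>2) \<le> 0" using st 1 by (simp add: mult_nonneg_nonpos)
    ultimately show ?thesis by linarith
  qed
  then show "s *\<^sub>R x + t *\<^sub>R y \<in> ball_coords"
    using 2 xv yv by (auto simp: ball_coords_def algebra_simps)
qed

section \<open>Derivatives of functions on the ball\<close>

definition pt :: "complex \<Rightarrow> complex \<Rightarrow> picard_ball" where
  "pt u v = of_coords (u, v)"

lemma coords_pt [simp]: "(u, v) \<in> ball_coords \<Longrightarrow> coords (pt u v) = (u, v)"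
  by (simp add: pt_def)

definition has_d :: "(picard_ball \<Rightarrow> complex) \<Rightarrow> complex \<Rightarrow> complex \<Rightarrow> picard_ball \<Rightarrow> bool" where
  "has_d f p q b \<longleftrightarrow> ((\<lambda>x. f (of_coords x)) has_derivative (\<lambda>(s, t). p * s + q * t)) (at (coords b))"

definition hol :: "(picard_ball \<Rightarrow> complex) \<Rightarrow> bool" where
  "hol f \<longleftrightarrow> (\<forall>b. \<exists>p q. has_d f p q b)"

definition d1 :: "(picard_ball \<Rightarrow> complex) \<Rightarrow> picard_ball \<Rightarrow> complex" where
  "d1 f b = partial1 (\<lambda>x. f (of_coords x)) (coords b)"

definition d2 :: "(picard_ball \<Rightarrow> complex) \<Rightarrow> picard_ball \<Rightarrow> complex" where
  "d2 f b = partial2 (\<lambda>x. f (of_coords x)) (coords b)"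

lemma hol_iff_holo2: "hol f \<longleftrightarrow> holo2 (\<lambda>x. f (of_coords x)) ball_coords"
  unfolding hol_def holo2_def has_d_def by (metis coords_in_ball coords_of_coords)

lemma holomorphic_on_ball_iff: "holomorphic_on_ball F \<longleftrightarrow> (\<forall>i. hol (\<lambda>b. coeff (F b) i))"
  by (simp add: holomorphic_on_ball_def hol_def has_d_def)

lemma holo2_cong:
  assumes "open U" "holo2 f U" "\<And>x. x \<in> U \<Longrightarrow> f x = g x"
  shows "holo2 g U"
  using assms(2) unfolding holo2_def
  by (meson assms(1,3) has_derivative_transform_within_open)

lemma has_dD: "has_d f p q b \<Longrightarrow> d1 f b = p" "has_d f p q b \<Longrightarrow> d2 f b = q"
  unfolding has_d_def d1_def d2_def partial1_def partial2_def
  using has_derivative_imp_partial1[of _ p q "fst (coords b)" "snd (coords b)"]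
    has_derivative_imp_partial2[of _ p q "fst (coords b)" "snd (coords b)"]
  by (auto intro!: DERIV_imp_deriv)

lemma hol_has_d: "hol f \<Longrightarrow> has_d f (d1 f b) (d2 f b) b"
  unfolding hol_def using has_dD by metis

lemma holI: "(\<And>b. has_d f (p b) (q b) b) \<Longrightarrow> hol f"
  by (auto simp: hol_def)

lemma hol_d1: "hol f \<Longrightarrow> hol (d1 f)"
proof -
  assume "hol f"
  then have "holo2 (partial1 (\<lambda>x. f (of_coords x))) ball_coords"
    by (intro holo2_partial1 open_ball_coords) (simp add: hol_iff_holo2)
  then show "hol (d1 f)"
    unfolding hol_iff_holo2 d1_def
    by (rule holo2_cong[OF open_ball_coords]) simp
qed

lemma hol_d2: "hol f \<Longrightarrow> hol (d2 f)"
proof -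
  assume "hol f"
  then have "holo2 (partial2 (\<lambda>x. f (of_coords x))) ball_coords"
    by (intro holo2_partial2 open_ball_coords) (simp add: hol_iff_holo2)
  then show "hol (d2 f)"
    unfolding hol_iff_holo2 d2_def
    by (rule holo2_cong[OF open_ball_coords]) simp
qed

lemma has_d_const: "has_d (\<lambda>_. c) 0 0 b"
  by (simp add: has_d_def case_prod_unfold)

lemma has_d_fst: "has_d (\<lambda>b. fst (coords b)) 1 0 b"
proof -
  have "(fst has_derivative (\<lambda>(s, t). 1 * s + 0 * t)) (at (coords b))"
    by (simp add: case_prod_unfold has_derivative_fst)
  then show ?thesis unfolding has_d_def
    by (rule has_derivative_transform_within_open[OF _ open_ball_coords]) auto
qed

lemma has_d_snd: "has_d (\<lambda>b. snd (coords b)) 0 1 b"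
proof -
  have "(snd has_derivative (\<lambda>(s, t). 0 * s + 1 * t)) (at (coords b))"
    by (simp add: case_prod_unfold has_derivative_snd)
  then show ?thesis unfolding has_d_def
    by (rule has_derivative_transform_within_open[OF _ open_ball_coords]) auto
qed

lemma has_d_add: "has_d f p q b \<Longrightarrow> has_d g p' q' b \<Longrightarrow> has_d (\<lambda>b. f b + g b) (p + p') (q + q') b"
  unfolding has_d_def by (drule (1) has_derivative_add) (simp add: case_prod_unfold algebra_simps)

lemma has_d_diff: "has_d f p q b \<Longrightarrow> has_d g p' q' b \<Longrightarrow> has_d (\<lambda>b. f b - g b) (p - p') (q - q') b"
  unfolding has_d_def by (drule (1) has_derivative_diff) (simp add: case_prod_unfold algebra_simps)

lemma has_d_mult:
  "has_d f p q b \<Longrightarrow> has_d g p' q' b \<Longrightarrow>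
    has_d (\<lambda>b. f b * g b) (p * g b + f b * p') (q * g b + f b * q') b"
  unfolding has_d_def by (drule (1) has_derivative_mult) (simp add: case_prod_unfold algebra_simps)

lemma has_d_compose1:
  assumes "has_d f p q b" "(h has_field_derivative h') (at (f b))"
  shows "has_d (\<lambda>b. h (f b)) (h' * p) (h' * q) b"
proof -
  have "(h has_derivative (*) h') (at (f (of_coords (coords b))))"
    using assms(2) by (simp add: has_field_derivative_def)
  from has_derivative_compose[OF assms(1)[unfolded has_d_def] this]
  show ?thesis by (simp add: has_d_def case_prod_unfold algebra_simps)
qed

lemma has_d_compose2:
  assumes "has_d f p q (m b)" "has_d (\<lambda>b. fst (coords (m b))) p1 q1 b" "has_d (\<lambda>b. snd (coords (m b))) p2 q2 b"
  shows "has_d (\<lambda>b. f (m b)) (p * p1 + q * p2) (p * q1 + q * q2) b"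
proof -
  have "((\<lambda>x. (fst (coords (m (of_coords x))), snd (coords (m (of_coords x))))) has_derivative
     (\<lambda>x. ((\<lambda>(s, t). p1 * s + q1 * t) x, (\<lambda>(s, t). p2 * s + q2 * t) x))) (at (coords b))"
    using assms(2,3) unfolding has_d_def by (rule has_derivative_Pair)
  from has_derivative_compose[OF this, of "\<lambda>x. f (of_coords x)" "\<lambda>(s, t). p * s + q * t"]
  show ?thesis using assms(1) by (simp add: has_d_def case_prod_unfold algebra_simps)
qed

lemma hol_const [simp]: "hol (\<lambda>_. c)" by (rule holI) (rule has_d_const)
lemma hol_add [simp]: "hol f \<Longrightarrow> hol g \<Longrightarrow> hol (\<lambda>b. f b + g b)" unfolding hol_def by (blast intro: has_d_add)
lemma hol_diff [simp]: "hol f \<Longrightarrow> hol g \<Longrightarrow> hol (\<lambda>b. f b - g b)" unfolding hol_def by (blast intro: has_d_diff)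
lemma hol_mult [simp]: "hol f \<Longrightarrow> hol g \<Longrightarrow> hol (\<lambda>b. f b * g b)" unfolding hol_def by (blast intro: has_d_mult)
lemma hol_minus [simp]: "hol f \<Longrightarrow> hol (\<lambda>b. - f b)" using hol_diff[OF hol_const, of f 0] by simp
lemma hol_power [simp]: "hol f \<Longrightarrow> hol (\<lambda>b. f b ^ n)" by (induction n) simp_all
lemma hol_powi: assumes "hol f" "\<And>b. f b \<noteq> 0" shows "hol (\<lambda>b. f b powi k)"
proof (rule holI)
  fix b
  have "((\<lambda>z. z powi k) has_field_derivative of_int k * f b powi (k - 1) * 1) (at (f b))"
    using assms(2)[of b] by (intro DERIV_power_int DERIV_ident) simp
  from has_d_compose1[OF hol_has_d[OF assms(1)] this]
  show "has_d (\<lambda>b. f b powi k) (of_int k * f b powi (k - 1) * 1 * d1 f b) (of_int k * f b powi (k - 1) * 1 * d2 f b) b" .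
qed

lemma hol_continuous: "hol f \<Longrightarrow> continuous_on ball_coords (\<lambda>x. f (of_coords x))"
  by (simp add: hol_iff_holo2 holo2_continuous_on)

lemma hol_on_line:
  assumes f: "hol f" and U: "\<And>z. z \<in> U \<Longrightarrow> (a + z * c, a' + z * c') \<in> ball_coords"
  shows "(\<lambda>z. f (pt (a + z * c) (a' + z * c'))) holomorphic_on U"
  unfolding holomorphic_on_def
proof
  fix z assume z: "z \<in> U"
  let ?b = "pt (a + z * c) (a' + z * c')"
  have "((\<lambda>x. f (of_coords x)) has_derivative (\<lambda>(s, t). d1 f ?b * s + d2 f ?b * t)) (at (a + z * c, a' + z * c'))"
    using hol_has_d[OF f, of ?b] U[OF z] by (simp add: has_d_def)
  moreover have "((\<lambda>z. (a + z * c, a' + z * c')) has_derivative (\<lambda>t. (t * c, t * c'))) (at z)"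
    by (auto intro!: derivative_eq_intros)
  ultimately have "((\<lambda>z. f (of_coords (a + z * c, a' + z * c'))) has_derivative
      (\<lambda>t. case (t * c, t * c') of (s, t) \<Rightarrow> d1 f ?b * s + d2 f ?b * t)) (at z)"
    by (rule has_derivative_compose[rotated])
  then have "((\<lambda>z. f (of_coords (a + z * c, a' + z * c'))) has_derivative
      (\<lambda>t. d1 f ?b * (t * c) + d2 f ?b * (t * c'))) (at z)"
    by (simp only: split_conv)
  moreover have "(\<lambda>t. d1 f ?b * (t * c) + d2 f ?b * (t * c')) = (*) (d1 f ?b * c + d2 f ?b * c')"
    by (auto simp: fun_eq_iff algebra_simps)
  ultimately have "((\<lambda>z. f (of_coords (a + z * c, a' + z * c'))) has_field_derivative
      (d1 f ?b * c + d2 f ?b * c')) (at z)"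
    by (simp only: has_field_derivative_def)
  then show "(\<lambda>z. f (pt (a + z * c) (a' + z * c'))) field_differentiable at z within U"
    unfolding pt_def field_differentiable_def using has_field_derivative_at_within by blast
qed

text \<open>A point where \<open>g\<close> is non-zero is joined to an arbitrary point by a complex
  line. The line meets the ball in a convex, hence connected set, and the identity theorem in one
  variable applies. So the holomorphic functions on the ball form an integral domain.\<close>

lemma hol_mult_eq_0:
  assumes "hol f" "hol g" "\<And>b. f b * g b = 0"
  shows "(\<forall>b. f b = 0) \<or> (\<forall>b. g b = 0)"
proof (rule disjCI)
  assume "\<not> (\<forall>b. g b = 0)"
  then obtain b0 where b0: "g b0 \<noteq> 0" by blast
  obtain a a' where a: "(a, a') \<in> ball_coords" "b0 = of_coords (a, a')" by (rule ball_cases)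
  show "\<forall>b. f b = 0"
  proof
    fix b
    obtain u v where u: "(u, v) \<in> ball_coords" "b = of_coords (u, v)" by (rule ball_cases)
    \<comment> \<open>The line runs through \<open>b0\<close> at 0 and through \<open>b\<close> at
      1.\<close>
    define h where "h z = (a + z * (u - a), a' + z * (v - a'))" for z
    let ?U = "{z. h z \<in> ball_coords}"
    have ch: "continuous_on A h" for A unfolding h_def by (intro continuous_intros)
    have oU: "open ?U"
      using open_vimage[OF open_ball_coords ch] by (simp add: vimage_def)
    have "convex ?U"
    proof (rule convexI)
      fix x y :: complex and s t :: real
      assume xy: "x \<in> ?U" "y \<in> ?U" and st: "0 \<le> s" "0 \<le> t" "s + t = 1"
      have "h (s *\<^sub>R x + t *\<^sub>R y) = s *\<^sub>R h x + t *\<^sub>R h y"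
      proof -
        have t: "complex_of_real t = 1 - of_real s" using st by (metis add_diff_cancel_left' of_real_1 of_real_diff)
        show ?thesis unfolding h_def by (simp add: scaleR_conv_of_real t algebra_simps)
      qed
      then show "s *\<^sub>R x + t *\<^sub>R y \<in> ?U"
        using convexD[OF convex_ball_coords, of "h x" "h y" s t] xy st by simp
    qed
    then have conn: "connected ?U" by (rule convex_connected)
    have fh: "(\<lambda>z. f (of_coords (h z))) holomorphic_on ?U"
      using hol_on_line[OF assms(1), of ?U a "u - a" a' "v - a'"] by (simp add: h_def pt_def)
    have gh: "(\<lambda>z. g (of_coords (h z))) holomorphic_on ?U"
      using hol_on_line[OF assms(2), of ?U a "u - a" a' "v - a'"] by (simp add: h_def pt_def)
    have h0: "h 0 = (a, a')" "h 1 = (u, v)" by (auto simp: h_def)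
    have "continuous_on ?U (\<lambda>z. g (of_coords (h z)))" using gh holomorphic_on_imp_continuous_on by blast
    then have 1: "open (?U \<inter> (\<lambda>z. g (of_coords (h z))) -` (- {0}))" (is "open ?V")
      using oU by (intro continuous_open_preimage) auto
    have "0 \<in> ?V"
      using a b0 by (simp add: h0)
    then have 2: "?V \<noteq> {}" by blast
    have 3: "f (of_coords (h z)) = 0" if "z \<in> ?V" for z
      using that assms(3)[of "of_coords (h z)"] by auto
    have 4: "1 \<in> ?U" using u by (simp add: h0)
    have "f (of_coords (h 1)) = 0"
      by (rule analytic_continuation_open[OF 1 oU 2 conn Int_lower1 fh holomorphic_on_const 3 4])
    then show "f b = 0" using u h0 by simp
  qed
qed

lemma hol_cancel:
  assumes "hol f" "hol g" "hol h" "\<And>b. f b * g b = f b * h b" "\<not> (\<forall>b. f b = 0)"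
  shows "g b = h b"
  using hol_mult_eq_0[of f "\<lambda>b. g b - h b"] assms by (simp add: algebra_simps)

section \<open>The Picard modular group\<close>

no_notation fps_nth (infixl "$" 75)

text \<open>The representative of the line \<open>(v : 1 : u)\<close> whose second coordinate is 1;
  \<open>j1 g\<close> measures how \<open>g\<close> destroys this normalisation.\<close>

definition lift3 :: "picard_ball \<Rightarrow> complex^3" where
  "lift3 b = vector [snd (coords b), 1, fst (coords b)]"

lemma lift3_nth [simp]: "lift3 b $ 1 = snd (coords b)" "lift3 b $ 2 = 1" "lift3 b $ 3 = fst (coords b)"
  by (simp_all add: lift3_def)

lemma herm_self: "herm z z = of_real (2 * Re (z$1 * cnj (z$2)) + (cmod (z$3))\<^sup>2)"
proof -
  have "z$2 * cnj (z$1) = cnj (z$1 * cnj (z$2))" by simp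
  then have "herm z z = (z$1 * cnj (z$2) + cnj (z$1 * cnj (z$2))) + z$3 * cnj (z$3)"
    unfolding herm_def by simp
  then show ?thesis
    by (simp only: complex_add_cnj complex_norm_square[symmetric]) simp
qed

lemma herm_lift3: "Re (herm (lift3 b) (lift3 b)) < 0"
  using coords_in_ball[of b] by (auto simp: herm_self ball_coords_def)

lemma j1_lift: "j1 g b = (g *v lift3 b) $ 2"
  by (simp add: j1_def matrix_vector_mult_def sum_3 split_beta)

lemma Gam_herm: "g \<in> Gam \<Longrightarrow> herm (g *v z) (g *v w) = herm z w"
  by (simp add: Gam_def)

text \<open>A vector with second coordinate 0 has non-negative Hermitian norm, whereas points of the
  ball are negative vectors and stay negative under \<open>g\<close>.\<close>

lemma j1_nonzero [simp]: assumes "g \<in> Gam" shows "j1 g b \<noteq> 0"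
proof
  assume "j1 g b = 0"
  then have "(g *v lift3 b) $ 2 = 0" by (simp add: j1_lift)
  then have "Re (herm (g *v lift3 b) (g *v lift3 b)) \<ge> 0" by (simp add: herm_self)
  then show False using herm_lift3[of b] by (simp add: Gam_herm[OF assms])
qed

text \<open>\<open>of_coords\<close> is meaningful only on the ball, so the inequality has to be
  verified for the image: it is the invariance of the Hermitian form, divided by the squared modulus
  of \<open>j1\<close>.\<close>

lemma act_coords:
  assumes "g \<in> Gam"
  shows "coords (act g b) = ((g *v lift3 b) $ 3 / j1 g b, (g *v lift3 b) $ 1 / j1 g b)"
proof -
  let ?z = "g *v lift3 b" and ?j = "j1 g b"
  have j: "?j \<noteq> 0" "?z $ 2 = ?j" using assms by (simp_all add: j1_lift[symmetric])
  have "Re (herm ?z ?z) < 0" using herm_lift3[of b] by (simp add: Gam_herm[OF assms])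
  then have 1: "2 * Re (?z $ 1 * cnj ?j) + (cmod (?z $ 3))\<^sup>2 < 0" by (simp add: herm_self j)
  have 2: "?z $ 1 / ?j = (?z $ 1 * cnj ?j) / of_real ((cmod ?j)\<^sup>2)"
    using j(1) by (metis complex_div_cnj)
  have "2 * Re (?z $ 1 / ?j) + (cmod (?z $ 3 / ?j))\<^sup>2
      = (2 * Re (?z $ 1 * cnj ?j) + (cmod (?z $ 3))\<^sup>2) / (cmod ?j)\<^sup>2"
    unfolding 2 Re_divide_of_real by (simp add: norm_divide power_divide add_divide_distrib)
  also have "\<dots> < 0" using 1 j by (simp add: divide_neg_pos)
  finally have "(?z $ 3 / ?j, ?z $ 1 / ?j) \<in> ball_coords" by (simp add: ball_coords_def)
  moreover have "act g b = of_coords (?z $ 3 / ?j, ?z $ 1 / ?j)"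
    by (simp add: act_def matrix_vector_mult_def sum_3 split_beta)
  ultimately show ?thesis by simp
qed

lemma mult_lift3:
  assumes "g \<in> Gam"
  shows "g *v lift3 b = j1 g b *s lift3 (act g b)"
  using assms by (simp add: vec_eq_iff forall_3 act_coords j1_lift[symmetric])

lemma lift3_eq_iff: "c *s lift3 a = c' *s lift3 b \<Longrightarrow> c \<noteq> 0 \<Longrightarrow> c = c' \<and> a = b"
  by (auto simp: vec_eq_iff forall_3 coords_inject[symmetric] intro: prod_eqI)

section \<open>The ring of Eisenstein integers\<close>

lemma O_F_int [simp]: "of_int a \<in> O_F"
proof -
  have "of_int a = of_int a + of_int 0 * rho" by simp
  then show ?thesis unfolding O_F_def by blast
qed
lemma O_F_0 [simp]: "0 \<in> O_F" using O_F_int[of 0] by simp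
lemma O_F_1 [simp]: "1 \<in> O_F" using O_F_int[of 1] by simp
lemma O_F_numeral [simp]: "numeral n \<in> O_F" using O_F_int[of "numeral n"] by simp
lemma O_F_rho [simp]: "rho \<in> O_F"
proof -
  have "rho = of_int 0 + of_int 1 * rho" by simp
  then show ?thesis unfolding O_F_def by blast
qed
lemma O_F_minus [simp]: "x \<in> O_F \<Longrightarrow> - x \<in> O_F"
proof (unfold O_F_def, clarify)
  fix a b :: int
  have "- (of_int a + of_int b * rho) = of_int (- a) + of_int (- b) * rho"
    by simp
  then show "\<exists>c d. - (of_int a + of_int b * rho) = of_int c + of_int d * rho \<and> True"
    by blast
qed
lemma O_F_add [simp]: "x \<in> O_F \<Longrightarrow> y \<in> O_F \<Longrightarrow> x + y \<in> O_F"
proof (unfold O_F_def, clarsimp)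
  fix a b c d :: int
  have "of_int a + of_int b * rho + (of_int c + of_int d * rho) = of_int (a + c) + of_int (b + d) * rho"
    by (simp add: algebra_simps)
  then show "\<exists>aa ba. of_int a + of_int b * rho + (of_int c + of_int d * rho) = of_int aa + of_int ba * rho"
    by blast
qed
lemma O_F_diff [simp]: "x \<in> O_F \<Longrightarrow> y \<in> O_F \<Longrightarrow> x - y \<in> O_F"
  using O_F_add[of x "- y"] by simp

lemma sqrt3_sq: "complex_of_real (sqrt 3) * complex_of_real (sqrt 3) = 3"
  by (simp flip: of_real_mult)

lemma sqrt_m3_sq: "sqrt_m3 * sqrt_m3 = - 3"
  by (simp add: sqrt_m3_def algebra_simps sqrt3_sq)

lemma sqrt_m3_rho: "sqrt_m3 = 1 + 2 * rho"
  by (simp add: rho_def field_simps)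

lemma rho_sq: "rho * rho = - 1 - rho"
proof -
  have "4 * (rho * rho) = 4 * (- 1 - rho)"
    using sqrt_m3_sq unfolding sqrt_m3_rho by (simp add: algebra_simps eq_neg_iff_add_eq_0)
  then show ?thesis by (simp only: mult_cancel_left) simp
qed

lemma rho_cube: "rho * (rho * rho) = 1"
  by (simp add: rho_sq algebra_simps)

lemma cnj_rho: "cnj rho = - 1 - rho"
  by (simp add: rho_def sqrt_m3_def field_simps)

lemma rho_nonzero [simp]: "rho \<noteq> 0" using rho_cube by auto

lemma O_F_mult [simp]: "x \<in> O_F \<Longrightarrow> y \<in> O_F \<Longrightarrow> x * y \<in> O_F"
proof (unfold O_F_def, clarsimp)
  fix a b c d :: int
  have "(of_int a + of_int b * rho) * (of_int c + of_int d * rho)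
     = of_int (a * c) + of_int (a * d + b * c) * rho + of_int (b * d) * (rho * rho)"
    by (simp add: algebra_simps)
  also have "\<dots> = of_int (a * c - b * d) + of_int (a * d + b * c - b * d) * rho"
    unfolding rho_sq by (simp add: algebra_simps)
  finally show "\<exists>aa ba. (of_int a + of_int b * rho) * (of_int c + of_int d * rho) = of_int aa + of_int ba * rho"
    by blast
qed

lemma O_F_sum [simp]: "(\<And>i. i \<in> I \<Longrightarrow> f i \<in> O_F) \<Longrightarrow> sum f I \<in> O_F"
  by (induction I rule: infinite_finite_induct) auto

lemma sqrt_m3_in_O_F [simp]: "sqrt_m3 \<in> O_F" by (simp add: sqrt_m3_rho)

lemma O_F_matrix_mult: "(\<And>i j. g$i$j \<in> O_F) \<Longrightarrow> (\<And>i j. h$i$j \<in> O_F) \<Longrightarrow> ((g::complex^3^3) ** h)$i$j \<in> O_F"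
  by (simp add: matrix_matrix_mult_def)

section \<open>Group laws and the cocycle relation\<close>

lemma Gam_mult: assumes "g \<in> Gam" "h \<in> Gam" shows "g ** h \<in> Gam"
proof -
  obtain g' where g: "\<And>i j. g$i$j \<in> O_F" "\<And>i j. g'$i$j \<in> O_F" "g ** g' = mat 1" "g' ** g = mat 1"
    using assms(1) unfolding Gam_def GL3_O_F_def by blast
  obtain h' where h: "\<And>i j. h$i$j \<in> O_F" "\<And>i j. h'$i$j \<in> O_F" "h ** h' = mat 1" "h' ** h = mat 1"
    using assms(2) unfolding Gam_def GL3_O_F_def by blast
  have "(g ** h) ** (h' ** g') = mat 1" "(h' ** g') ** (g ** h) = mat 1"
    by (metis g(3,4) h(3,4) matrix_mul_assoc matrix_mul_rid)+
  then have "g ** h \<in> GL3_O_F"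
    unfolding GL3_O_F_def using O_F_matrix_mult g h by blast
  then show ?thesis
    using assms by (simp add: Gam_def matrix_vector_mul_assoc[symmetric])
qed

lemma Gam_inverse:
  assumes "g \<in> Gam"
  obtains g' where "g' \<in> Gam" "g ** g' = mat 1" "g' ** g = mat 1"
proof -
  obtain g' where g: "\<And>i j. g$i$j \<in> O_F" "\<And>i j. g'$i$j \<in> O_F" "g ** g' = mat 1" "g' ** g = mat 1"
    using assms unfolding Gam_def GL3_O_F_def by blast
  have "herm (g' *v z) (g' *v w) = herm z w" for z w
    using Gam_herm[OF assms, of "g' *v z" "g' *v w"] by (simp add: matrix_vector_mul_assoc g)
  moreover have "g' \<in> GL3_O_F" unfolding GL3_O_F_def using g by blast
  ultimately have "g' \<in> Gam" by (simp add: Gam_def)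
  then show ?thesis using that g(3,4) by blast
qed

lemma Gam_1 [simp]: "mat 1 \<in> Gam"
  proof -
  have "(mat 1 :: complex^3^3)$i$j \<in> O_F" for i j by (simp add: mat_def)
  then show ?thesis
    unfolding Gam_def GL3_O_F_def by (auto intro!: exI[of _ "mat 1"])
qed

lemma matrix_inv_eq:
  fixes g h :: "complex^'n^'n"
  assumes "g ** h = mat 1" "h ** g = mat 1"
  shows "matrix_inv g = h"
proof -
  have "g ** matrix_inv g = mat 1 \<and> matrix_inv g ** g = mat 1"
    unfolding matrix_inv_def by (rule someI_ex) (use assms in blast)
  then show ?thesis by (metis assms(2) matrix_mul_assoc matrix_mul_lid matrix_mul_rid)
qed

lemma Gam_matrix_inv: "g \<in> Gam \<Longrightarrow> matrix_inv g \<in> Gam"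
  "g \<in> Gam \<Longrightarrow> g ** matrix_inv g = mat 1" "g \<in> Gam \<Longrightarrow> matrix_inv g ** g = mat 1"
  by (metis Gam_inverse matrix_inv_eq)+

lemma Gam_det_nonzero: "g \<in> Gam \<Longrightarrow> det g \<noteq> 0"
  by (metis Gam_inverse det_I det_mul mult_zero_left zero_neq_one)

text \<open>The vectors \<open>(g ** h) *v lift3 b\<close> and \<open>g *v (h *v lift3 b)\<close>
  agree; comparing their scalar factors and their lines gives both rules at once.\<close>

lemma j1_act_mult:
  assumes "g \<in> Gam" "h \<in> Gam"
  shows "j1 (g ** h) b = j1 g (act h b) * j1 h b" "act (g ** h) b = act g (act h b)"
proof -
  have "j1 (g ** h) b *s lift3 (act (g ** h) b) = g *v (h *v lift3 b)"
    by (simp add: mult_lift3[OF Gam_mult[OF assms], symmetric] matrix_vector_mul_assoc)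
  also have "\<dots> = (j1 h b * j1 g (act h b)) *s lift3 (act g (act h b))"
    by (simp add: mult_lift3 assms vec.scale)
  finally have "j1 (g ** h) b = j1 h b * j1 g (act h b) \<and> act (g ** h) b = act g (act h b)"
    by (rule lift3_eq_iff) (simp add: Gam_mult assms)
  then show "j1 (g ** h) b = j1 g (act h b) * j1 h b" "act (g ** h) b = act g (act h b)" by auto
qed

lemma act_1 [simp]: "act (mat 1) b = b" "j1 (mat 1) b = 1"
proof -
  have "j1 (mat 1) b *s lift3 (act (mat 1) b) = 1 *s lift3 b"
    by (simp flip: mult_lift3)
  from lift3_eq_iff[OF this] show "act (mat 1) b = b" "j1 (mat 1) b = 1" by auto
qed

lemma Gam_sqrt_m3_subset: "g \<in> Gam_sqrt_m3 \<Longrightarrow> g \<in> Gam"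
  by (simp add: Gam_sqrt_m3_def)

lemma matrix_mult_diff:
  fixes A B C :: "complex^'n^'n"
  shows "A ** (B - C) = A ** B - A ** C" "(B - C) ** A = B ** A - C ** A"
  by (simp_all add: matrix_matrix_mult_def vec_eq_iff algebra_simps sum_subtractf)

text \<open>Normality of the congruence subgroup, from
  \<open>g h g' - 1 = g (h - 1) g'\<close>.\<close>

lemma Gam_sqrt_m3_conj:
  assumes "h \<in> Gam_sqrt_m3" "g \<in> Gam" "g' \<in> Gam" "g ** g' = mat 1"
  shows "g ** h ** g' \<in> Gam_sqrt_m3"
proof -
  obtain a where a: "\<And>i j. a i j \<in> O_F" "\<And>i j. (h - mat 1)$i$j = sqrt_m3 * a i j"
    using assms(1) unfolding Gam_sqrt_m3_def by clarsimp metis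
  define A :: "complex^3^3" where "A = (\<chi> i j. a i j)"
  have eq: "(g ** h ** g' - mat 1)$i$j = sqrt_m3 * (g ** A ** g')$i$j" for i j
  proof -
    have "g ** h ** g' - mat 1 = g ** (h - mat 1) ** g'"
      using assms(4) by (simp add: matrix_mult_diff)
    moreover have "(g ** (h - mat 1) ** g')$i$j = sqrt_m3 * (g ** A ** g')$i$j"
      by (simp only: a(2) A_def vec_lambda_beta matrix_matrix_mult_def)
        (simp add: sum_distrib_left sum_distrib_right algebra_simps)
    ultimately show ?thesis by simp
  qed
  have "g$i$j \<in> O_F" "g'$i$j \<in> O_F" "A$i$j \<in> O_F" for i j
    using assms a by (auto simp: Gam_def GL3_O_F_def A_def)
  then have "(g ** A ** g')$i$j \<in> O_F" for i j
    by (intro O_F_matrix_mult) auto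
  moreover have "g ** h ** g' \<in> Gam"
    using assms by (simp add: Gam_mult Gam_sqrt_m3_subset)
  ultimately show ?thesis
    unfolding Gam_sqrt_m3_def using eq by blast
qed

text \<open>The norm equation has the six units as solutions. Since \<open>rho\<close> is 1 modulo
  \<open>sqrt_m3\<close>, the residue of \<open>a + b rho\<close> is \<open>a + b\<close> modulo 3,
  and the condition selects the cube roots of unity.\<close>

lemma Eisenstein_units:
  assumes "a * a - a * b + b * b = (1::int)" "(a + b) mod 3 = 1"
  shows "(of_int a + of_int b * rho) ^ 3 = 1"
proof -
  have 1: "(2 * a - b)\<^sup>2 + 3 * b\<^sup>2 = 4" "(2 * b - a)\<^sup>2 + 3 * a\<^sup>2 = 4"
    using assms(1) by (simp_all add: power2_eq_square algebra_simps)
  have "b\<^sup>2 < 2\<^sup>2" "a\<^sup>2 < 2\<^sup>2" using 1 zero_le_power2[of "2 * a - b"] zero_le_power2[of "2 * b - a"] by (simp_all, linarith+)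
  then have "\<bar>a\<bar> < 2" "\<bar>b\<bar> < 2" by (metis abs_numeral power2_less_imp_less abs_ge_zero power2_abs zero_le_numeral)+
  then have "a \<in> {-1, 0, 1}" "b \<in> {-1, 0, 1}" by auto
  then have "(a, b) = (1, 0) \<or> (a, b) = (0, 1) \<or> (a, b) = (-1, -1)"
    using assms by auto
  then show ?thesis
  proof (elim disjE)
    assume ab: "(a, b) = (-1, -1)"
    have "(- 1 - rho) ^ 3 = (rho * (rho * rho)) * (rho * (rho * rho))"
      unfolding rho_sq[symmetric] by (simp add: power3_eq_cube mult_ac)
    with ab show ?thesis by (simp add: rho_cube)
  qed (auto simp: power3_eq_cube rho_cube mult.assoc)
qed

lemma Eisenstein_norm:
  "(of_int a + of_int b * rho) * (of_int a + of_int b * cnj rho) = of_int (a * a - a * b + b * b)"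
proof -
  have "rho * cnj rho = 1" by (simp add: cnj_rho algebra_simps rho_sq)
  moreover have "(of_int a + of_int b * rho) * (of_int a + of_int b * cnj rho)
    = of_int (a * a) + of_int (a * b) * (rho + cnj rho) + of_int (b * b) * (rho * cnj rho)"
    by (simp add: algebra_simps)
  ultimately show ?thesis by (simp add: cnj_rho)
qed

lemma of_int_rho_inject:
  assumes "of_int a + of_int b * rho = of_int c + of_int d * rho"
  shows "a = c" "b = d"
proof -
  have "Im rho \<noteq> 0" by (simp add: rho_def sqrt_m3_def)
  moreover have "Im (of_int a + of_int b * rho) = Im (of_int c + of_int d * rho)" using assms by simp
  ultimately show "b = d" by simp
  with assms show "a = c" by simp
qed

lemma det_in_O_F: "(\<And>i j. g$i$j \<in> O_F) \<Longrightarrow> det (g::complex^3^3) \<in> O_F"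
  by (simp add: det_3)

text \<open>The determinant is a unit of the Eisenstein integers, because its norm is a positive
  integer with an inverse, and it is congruent to 1 modulo \<open>sqrt_m3\<close>.\<close>

lemma det_cube:
  assumes "g \<in> Gam_sqrt_m3"
  shows "det g ^ 3 = 1"
proof -
  obtain a where a: "\<And>i j. a i j \<in> O_F" "\<And>i j. (g - mat 1)$i$j = sqrt_m3 * a i j"
    using assms unfolding Gam_sqrt_m3_def by clarsimp metis
  have g: "g$i$j = mat 1 $i$j + sqrt_m3 * a i j" for i j
    using a(2)[of i j] by (simp add: algebra_simps)
  obtain g' where g': "g' \<in> Gam" "g ** g' = mat 1"
    using Gam_inverse Gam_sqrt_m3_subset assms by metis
  have gO: "g$i$j \<in> O_F" "g'$i$j \<in> O_F" for i j
    using assms g' by (auto simp: Gam_sqrt_m3_def Gam_def GL3_O_F_def)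
  obtain x y where xy: "det g = of_int x + of_int y * rho"
    using det_in_O_F[OF gO(1)] by (auto simp: O_F_def)
  obtain x' y' where xy': "det g' = of_int x' + of_int y' * rho"
    using det_in_O_F[OF gO(2)] by (auto simp: O_F_def)
  have d1: "det g * det g' = 1" by (simp add: g' flip: det_mul)
  have "of_int ((x * x - x * y + y * y) * (x' * x' - x' * y' + y' * y')) = (det g * det g') * (cnj (det g) * cnj (det g'))"
    unfolding of_int_mult Eisenstein_norm[symmetric] xy xy' by simp
  also have "\<dots> = 1" by (metis complex_cnj_mult complex_cnj_one d1 mult_1)
  finally have "(x * x - x * y + y * y) * (x' * x' - x' * y' + y' * y') = 1"
    by (metis of_int_eq_1_iff)
  moreover have "x * x - x * y + y * y \<ge> 0"
  proof -
    have "4 * (x * x - x * y + y * y) = (2 * x - y)\<^sup>2 + 3 * y\<^sup>2" by (simp add: power2_eq_square algebra_simps)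
    then have "4 * 0 \<le> 4 * (x * x - x * y + y * y)" by simp
    then show ?thesis by (rule mult_left_le_imp_le) simp
  qed
  ultimately have norm: "x * x - x * y + y * y = 1"
    using pos_zmult_eq_1_iff_lemma zmult_eq_1_iff by fastforce
  have "\<exists>c\<in>O_F. det g = 1 + sqrt_m3 * c"
  proof -
    define s where "s = sqrt_m3"
    have "s \<in> O_F" by (simp add: s_def)
    \<comment> \<open>Expansion of the determinant of \<open>1 + s A\<close> by powers of
      \<open>s\<close>: trace, sum of the principal 2 by 2 minors, and determinant of
      \<open>A\<close>, after one factor \<open>s\<close> has been taken out.\<close>
    let ?c = "a 1 1 + a 2 2 + a 3 3 + s * (a 1 1 * a 2 2 - a 1 2 * a 2 1 + a 1 1 * a 3 3 - a 1 3 * a 3 1 + a 2 2 * a 3 3 - a 2 3 * a 3 2)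
      + s * s * (a 1 1 * a 2 2 * a 3 3 + a 1 2 * a 2 3 * a 3 1 + a 1 3 * a 2 1 * a 3 2 - a 1 1 * a 2 3 * a 3 2 - a 1 2 * a 2 1 * a 3 3 - a 1 3 * a 2 2 * a 3 1)"
    have "det g = 1 + s * ?c"
      unfolding det_3 g s_def[symmetric] by (simp add: mat_def algebra_simps)
    moreover have "?c \<in> O_F" using a(1) \<open>s \<in> O_F\<close> by simp
    ultimately show ?thesis unfolding s_def by blast
  qed
  then obtain p q where "det g = 1 + sqrt_m3 * (of_int p + of_int q * rho)" by (auto simp: O_F_def)
  also have "\<dots> = 1 + of_int p + (of_int q + 2 * of_int p) * rho + 2 * of_int q * (rho * rho)"
    by (simp add: sqrt_m3_rho algebra_simps)
  also have "\<dots> = of_int (1 + p - 2 * q) + of_int (2 * p - q) * rho"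
    unfolding rho_sq by (simp add: algebra_simps)
  finally have "x = 1 + p - 2 * q" "y = 2 * p - q"
    using of_int_rho_inject xy by metis+
  then have "(x + y) mod 3 = 1" by presburger
  then show ?thesis unfolding xy by (rule Eisenstein_units[OF norm])
qed

section \<open>Factors of automorphy, scalar-valued and vector-valued forms\<close>

definition act_u :: "complex^3^3 \<Rightarrow> picard_ball \<Rightarrow> complex" where
  "act_u g b = fst (coords (act g b))"

definition act_v :: "complex^3^3 \<Rightarrow> picard_ball \<Rightarrow> complex" where
  "act_v g b = snd (coords (act g b))"

lemma has_d_j1: "has_d (j1 g) (g$2$3) (g$2$1) b"
proof -
  have "j1 g = (\<lambda>b. (g$2$1 * snd (coords b) + g$2$2) + g$2$3 * fst (coords b))"
    by (simp add: j1_def fun_eq_iff split_beta)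
  moreover have "has_d (\<lambda>b. (g$2$1 * snd (coords b) + g$2$2) + g$2$3 * fst (coords b))
    (((0 * snd (coords b) + g$2$1 * 0) + 0) + (0 * fst (coords b) + g$2$3 * 1))
    (((0 * snd (coords b) + g$2$1 * 1) + 0) + (0 * fst (coords b) + g$2$3 * 0)) b"
    by (intro has_d_add has_d_mult has_d_const has_d_fst has_d_snd)
  ultimately show ?thesis by simp
qed

lemma hol_j1 [simp]: "hol (j1 g)" by (rule holI, rule has_d_j1)

lemma act_u_eq: "g \<in> Gam \<Longrightarrow> act_u g b = (g$3$1 * snd (coords b) + g$3$2 + g$3$3 * fst (coords b)) / j1 g b"
  by (simp add: act_u_def act_coords matrix_vector_mult_def sum_3)

lemma act_v_eq: "g \<in> Gam \<Longrightarrow> act_v g b = (g$1$1 * snd (coords b) + g$1$2 + g$1$3 * fst (coords b)) / j1 g b"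
  by (simp add: act_v_def act_coords matrix_vector_mult_def sum_3)

lemma has_d_linear_quotient:
  assumes g: "g \<in> Gam"
  shows "has_d (\<lambda>b. (g$i$1 * snd (coords b) + g$i$2 + g$i$3 * fst (coords b)) / j1 g b)
    ((g$i$3 * j1 g b - g$2$3 * (g$i$1 * snd (coords b) + g$i$2 + g$i$3 * fst (coords b))) / (j1 g b)\<^sup>2)
    ((g$i$1 * j1 g b - g$2$1 * (g$i$1 * snd (coords b) + g$i$2 + g$i$3 * fst (coords b))) / (j1 g b)\<^sup>2) b"
proof -
  have "has_d (\<lambda>b. (g$i$1 * snd (coords b) + g$i$2) + g$i$3 * fst (coords b))
    (((0 * snd (coords b) + g$i$1 * 0) + 0) + (0 * fst (coords b) + g$i$3 * 1))
    (((0 * snd (coords b) + g$i$1 * 1) + 0) + (0 * fst (coords b) + g$i$3 * 0)) b"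
    by (intro has_d_add has_d_mult has_d_const has_d_fst has_d_snd)
  moreover have "has_d (\<lambda>b. inverse (j1 g b)) (- (inverse (j1 g b ^ 2)) * g$2$3) (- (inverse (j1 g b ^ 2)) * g$2$1) b"
    by (rule has_d_compose1[OF has_d_j1]) (use g in \<open>auto intro!: derivative_eq_intros simp: power2_eq_square\<close>)
  ultimately have "has_d (\<lambda>b. ((g$i$1 * snd (coords b) + g$i$2) + g$i$3 * fst (coords b)) * inverse (j1 g b))
     ((((0 * snd (coords b) + g$i$1 * 0) + 0) + (0 * fst (coords b) + g$i$3 * 1)) * inverse (j1 g b)
       + ((g$i$1 * snd (coords b) + g$i$2) + g$i$3 * fst (coords b)) * (- (inverse (j1 g b ^ 2)) * g$2$3))
     ((((0 * snd (coords b) + g$i$1 * 1) + 0) + (0 * fst (coords b) + g$i$3 * 0)) * inverse (j1 g b)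
       + ((g$i$1 * snd (coords b) + g$i$2) + g$i$3 * fst (coords b)) * (- (inverse (j1 g b ^ 2)) * g$2$1)) b"
    by (rule has_d_mult)
  moreover have "x * inverse j + y * (- inverse (j\<^sup>2) * z) = (x * j - z * y) / j\<^sup>2" if "j \<noteq> 0" for x y z j :: complex
    using that by (simp add: field_simps power2_eq_square)
  ultimately show ?thesis
    using j1_nonzero[OF g, of b] by (simp add: divide_inverse)
qed

lemma skip_simps: "skip 1 1 = 2" "skip 1 2 = 3" "skip 2 1 = 1" "skip 2 2 = 3" "skip 3 1 = 1" "skip 3 2 = 2"
  by (simp_all add: skip_def)

lemma minor_eq:
  "minor g i j = g$skip i 1$skip j 1 * g$skip i 2$skip j 2 - g$skip i 1$skip j 2 * g$skip i 2$skip j 1"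
  by (simp add: minor_def det_2)

text \<open>By the quotient rule the numerators are combinations of the 2 by 2 minors of rows 2 and
  3; this is where the minors in \<open>j2\<close> come from.\<close>

lemma has_d_act_u:
  assumes g: "g \<in> Gam"
  shows "has_d (act_u g) ((minor g 1 2 * snd (coords b) + minor g 1 1) / (j1 g b)\<^sup>2)
    (- (minor g 1 2 * fst (coords b) + minor g 1 3) / (j1 g b)\<^sup>2) b"
proof -
  have "act_u g = (\<lambda>b. (g$3$1 * snd (coords b) + g$3$2 + g$3$3 * fst (coords b)) / j1 g b)"
    using act_u_eq[OF g] by (simp add: fun_eq_iff)
  with has_d_linear_quotient[OF g, of 3 b] show ?thesis
    by (simp add: minor_eq skip_simps j1_def split_beta algebra_simps)
qed

lemma has_d_act_v:
  assumes g: "g \<in> Gam"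
  shows "has_d (act_v g) (- (minor g 3 2 * snd (coords b) + minor g 3 1) / (j1 g b)\<^sup>2)
    ((minor g 3 2 * fst (coords b) + minor g 3 3) / (j1 g b)\<^sup>2) b"
proof -
  have "act_v g = (\<lambda>b. (g$1$1 * snd (coords b) + g$1$2 + g$1$3 * fst (coords b)) / j1 g b)"
    using act_v_eq[OF g] by (simp add: fun_eq_iff)
  with has_d_linear_quotient[OF g, of 1 b] show ?thesis
    by (simp add: minor_eq skip_simps j1_def split_beta algebra_simps)
qed

lemmas d_act = has_dD[OF has_d_act_u] has_dD[OF has_d_act_v]

lemma hol_act_u [simp]: "g \<in> Gam \<Longrightarrow> hol (act_u g)" by (rule holI, rule has_d_act_u)
lemma hol_act_v [simp]: "g \<in> Gam \<Longrightarrow> hol (act_v g)" by (rule holI, rule has_d_act_v)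

lemma has_d_compose_act:
  assumes "g \<in> Gam" "hol f"
  shows "has_d (\<lambda>b. f (act g b)) (d1 f (act g b) * d1 (act_u g) b + d2 f (act g b) * d1 (act_v g) b)
    (d1 f (act g b) * d2 (act_u g) b + d2 f (act g b) * d2 (act_v g) b) b"
  using has_d_compose2[of f _ _ "act g" b, OF hol_has_d[OF assms(2)]]
    hol_has_d[OF hol_act_u[OF assms(1)], of b] hol_has_d[OF hol_act_v[OF assms(1)], of b]
  by (simp add: act_u_def[abs_def] act_v_def[abs_def])

lemma hol_compose_act [simp]: "g \<in> Gam \<Longrightarrow> hol f \<Longrightarrow> hol (\<lambda>b. f (act g b))"
  by (rule holI, rule has_d_compose_act)

text \<open>By \<open>num\<close> the numerator is \<open>det g * j1\<close>: it is composed of 2 by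
  2 minors of the cofactor matrix, and these are \<open>det g\<close> times entries of the second
  row of \<open>g\<close>. One factor of \<open>j1 ^ 4\<close> in the denominator cancels.\<close>

lemma jacobian_act:
  assumes g: "g \<in> Gam"
  shows "d1 (act_u g) b * d2 (act_v g) b - d2 (act_u g) b * d1 (act_v g) b = det g / j1 g b ^ 3"
proof -
  have j: "j1 g b \<noteq> 0" using g by simp
  have num: "(minor g 1 2 * snd (coords b) + minor g 1 1) * (minor g 3 2 * fst (coords b) + minor g 3 3)
     - (minor g 1 2 * fst (coords b) + minor g 1 3) * (minor g 3 2 * snd (coords b) + minor g 3 1)
     = det g * j1 g b"
    by (simp add: minor_eq skip_simps det_3 j1_def split_beta algebra_simps)
  have "x / j\<^sup>2 * (y / j\<^sup>2) - (- z / j\<^sup>2) * (- w / j\<^sup>2) = (x * y - z * w) / j ^ 4" for x y z w j :: complex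
    by (simp add: diff_divide_distrib eval_nat_numeral mult.assoc)
  then have "d1 (act_u g) b * d2 (act_v g) b - d2 (act_u g) b * d1 (act_v g) b
    = (det g * j1 g b) / j1 g b ^ 4"
    unfolding d_act[OF g] num[symmetric] by blast
  also have "\<dots> = det g / j1 g b ^ 3" using j by (simp add: eval_nat_numeral)
  finally show ?thesis .
qed

section \<open>The slash operator in components\<close>

lemma Sym_0: "Sym 0 A p = [:coeff p 0:]"
  by (simp add: Sym_def)

lemma Sym_1_coeff: "Sym 1 A p = [:A$1$1 * coeff p 0 + A$1$2 * coeff p 1, A$2$1 * coeff p 0 + A$2$2 * coeff p 1:]"
  by (simp add: Sym_def algebra_simps)

lemma slash_0: "slash 0 k F g = (\<lambda>b. [:j1 g b powi (- k) * coeff (F (act g b)) 0:])"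
  by (simp add: slash_def Sym_0)

text \<open>The right-hand side is \<open>j1\<close> times the transposed derivative of the action.
  The entries of \<open>j2\<close> are those of its adjugate up to a factor, and
  \<open>jacobian_act\<close> shows that the factor is the correct one.\<close>

lemma matrix_inv_j2:
  assumes g: "g \<in> Gam"
  shows "matrix_inv (j2 g b) =
     vector [vector [j1 g b * d1 (act_u g) b, j1 g b * d1 (act_v g) b],
       vector [j1 g b * d2 (act_u g) b, j1 g b * d2 (act_v g) b]]" (is "_ = ?B")
proof -
  let ?a = "d1 (act_u g) b" and ?c = "d1 (act_v g) b" and ?d = "d2 (act_u g) b" and ?e = "d2 (act_v g) b"
  let ?j = "j1 g b"
  have j: "?j \<noteq> 0" "det g \<noteq> 0" using g by (simp_all add: Gam_det_nonzero)
  have J: "?a * ?e - ?d * ?c = det g / ?j ^ 3" by (rule jacobian_act[OF g])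
  have entries: "j2 g b $1$1 = ?j\<^sup>2 / det g * ?e" "j2 g b $1$2 = - (?j\<^sup>2 / det g * ?c)"
    "j2 g b $2$1 = - (?j\<^sup>2 / det g * ?d)" "j2 g b $2$2 = ?j\<^sup>2 / det g * ?a"
    using j unfolding d_act[OF g] j2_def split_beta
    by (simp_all add: inverse_eq_divide field_simps)
  have "?j\<^sup>2 / det g * ?j * (?a * ?e - ?d * ?c) = 1"
    unfolding J using j by (simp add: eval_nat_numeral)
  then have 1: "?j\<^sup>2 / det g * ?j * (?a * ?e) - ?j\<^sup>2 / det g * ?j * (?d * ?c) = 1"
    by (simp only: right_diff_distrib)
  define c where "c = ?j\<^sup>2 / det g"
  have "j2 g b ** ?B = mat 1" "?B ** j2 g b = mat 1"
    unfolding vec_eq_iff forall_2 using 1 unfolding c_def[symmetric]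
    by (simp_all add: matrix_matrix_mult_def sum_2 entries mat_def flip: c_def) (simp_all add: algebra_simps)
  then show ?thesis by (rule matrix_inv_eq)
qed

lemma slash_1:
  assumes g: "g \<in> Gam"
  shows "slash 1 k F g = (\<lambda>b.
    [:j1 g b powi (1 - k) * (coeff (F (act g b)) 0 * d1 (act_u g) b + coeff (F (act g b)) 1 * d1 (act_v g) b),
      j1 g b powi (1 - k) * (coeff (F (act g b)) 0 * d2 (act_u g) b + coeff (F (act g b)) 1 * d2 (act_v g) b):])"
proof -
  have "j1 g b powi (1 - k) = j1 g b powi (- k) * j1 g b" for b
    using j1_nonzero[OF g, of b] power_int_add_1[of "j1 g b" "- k"] by (simp add: algebra_simps)
  then show ?thesis
    by (simp add: slash_def Sym_1_coeff matrix_inv_j2[OF g] fun_eq_iff algebra_simps del: One_nat_def)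
qed

text \<open>With \<open>D\<close> the derivative of \<open>act g\<close> one has \<open>transpose (inverse D) = j1 * j2\<close>, so \<open>slash 1 k\<close> is
  \<open>j1 powi (1 - k)\<close> times the pullback of the differential form \<open>f1 du + f2 dv\<close>.\<close>

definition sform :: "int \<Rightarrow> int \<Rightarrow> (picard_ball \<Rightarrow> complex) \<Rightarrow> bool" where
  "sform k n f \<longleftrightarrow> hol f \<and>
     (\<forall>g\<in>Gam_sqrt_m3. \<forall>b. f (act g b) = j1 g b powi k * det g powi n * f b)"

definition sl :: "int \<Rightarrow> complex^3^3 \<Rightarrow> (picard_ball \<Rightarrow> complex) \<Rightarrow> picard_ball \<Rightarrow> complex" where
  "sl k g f b = j1 g b powi (- k) * f (act g b)"

definition pull1 :: "complex^3^3 \<Rightarrow> (picard_ball \<Rightarrow> complex) \<Rightarrow> (picard_ball \<Rightarrow> complex) \<Rightarrow> picard_ball \<Rightarrow> complex" where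
  "pull1 g f1 f2 b = f1 (act g b) * d1 (act_u g) b + f2 (act g b) * d1 (act_v g) b"

definition pull2 :: "complex^3^3 \<Rightarrow> (picard_ball \<Rightarrow> complex) \<Rightarrow> (picard_ball \<Rightarrow> complex) \<Rightarrow> picard_ball \<Rightarrow> complex" where
  "pull2 g f1 f2 b = f1 (act g b) * d2 (act_u g) b + f2 (act g b) * d2 (act_v g) b"

definition vform :: "int \<Rightarrow> (picard_ball \<Rightarrow> complex) \<Rightarrow> (picard_ball \<Rightarrow> complex) \<Rightarrow> bool" where
  "vform k f1 f2 \<longleftrightarrow> hol f1 \<and> hol f2 \<and> (\<forall>g\<in>Gam_sqrt_m3. \<forall>b.
     pull1 g f1 f2 b = j1 g b powi (k - 1) * f1 b \<and> pull2 g f1 f2 b = j1 g b powi (k - 1) * f2 b)"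

lemma powi_minus_eq_iff: "j \<noteq> 0 \<Longrightarrow> j powi (- k) * x = y \<longleftrightarrow> x = j powi k * (y::complex)"
  by (simp add: power_int_minus field_simps)

lemma M_forms_0_iff: "F \<in> M_forms 0 k \<longleftrightarrow> (\<exists>f. F = (\<lambda>b. [:f b:]) \<and> sform k 0 f)"
proof
  assume "F \<in> M_forms 0 k"
  then have F: "holomorphic_on_ball F" "\<And>b. degree (F b) = 0"
    "\<And>g. g \<in> Gam_sqrt_m3 \<Longrightarrow> slash 0 k F g = F"
    by (auto simp: M_forms_def modular_forms_def Sym_space_def)
  define f where "f b = coeff (F b) 0" for b
  have Ff: "F = (\<lambda>b. [:f b:])"
    unfolding f_def using F(2) by (metis degree_0_id)
  have "f (act g b) = j1 g b powi k * det g powi 0 * f b" if g: "g \<in> Gam_sqrt_m3" for g b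
  proof -
    have "j1 g b powi (- k) * f (act g b) = f b"
      using fun_cong[OF F(3)[OF g], of b] by (simp add: slash_0 Ff)
    then show ?thesis using g by (simp add: powi_minus_eq_iff Gam_sqrt_m3_subset)
  qed
  moreover have "hol f" using F(1) unfolding holomorphic_on_ball_iff f_def by simp
  ultimately show "\<exists>f. F = (\<lambda>b. [:f b:]) \<and> sform k 0 f" using Ff unfolding sform_def by blast
next
  assume "\<exists>f. F = (\<lambda>b. [:f b:]) \<and> sform k 0 f"
  then obtain f where f: "F = (\<lambda>b. [:f b:])" "hol f"
    "\<And>g b. g \<in> Gam_sqrt_m3 \<Longrightarrow> f (act g b) = j1 g b powi k * f b"
    by (auto simp: sform_def)
  have "hol (\<lambda>b. coeff (F b) i)" for i
    using f(1,2) by (cases i) auto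
  moreover have "slash 0 k F g = F" if "g \<in> Gam_sqrt_m3" for g
    using f(3)[OF that] Gam_sqrt_m3_subset[OF that]
    by (simp add: slash_0 f(1) fun_eq_iff powi_minus_eq_iff)
  ultimately show "F \<in> M_forms 0 k"
    by (simp add: M_forms_def modular_forms_def Sym_space_def holomorphic_on_ball_iff f(1))
qed

lemma degree_le_1_pCons: "degree p \<le> 1 \<Longrightarrow> p = [:coeff p 0, coeff p 1:]"
  by (intro poly_eqI) (auto simp: coeff_pCons coeff_eq_0 split: nat.split)

lemma coeff_pCons_1: "coeff [:a, c:] 1 = c"
  by simp

lemma M_forms_1_iff: "F \<in> M_forms 1 k \<longleftrightarrow> (\<exists>f1 f2. F = (\<lambda>b. [:f1 b, f2 b:]) \<and> vform k f1 f2)"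
proof -
  have slash: "slash 1 k (\<lambda>b. [:f1 b, f2 b:]) g = (\<lambda>b. [:f1 b, f2 b:]) \<longleftrightarrow>
     (\<forall>b. pull1 g f1 f2 b = j1 g b powi (k - 1) * f1 b \<and> pull2 g f1 f2 b = j1 g b powi (k - 1) * f2 b)"
    if "g \<in> Gam_sqrt_m3" for g f1 f2
    using that Gam_sqrt_m3_subset[OF that] powi_minus_eq_iff[of "j1 g _" "k - 1"]
    by (simp add: slash_1 pull1_def pull2_def fun_eq_iff coeff_pCons_1 del: One_nat_def)
  show ?thesis
  proof
    assume "F \<in> M_forms 1 k"
    then have F: "holomorphic_on_ball F" "\<And>b. degree (F b) \<le> 1"
      "\<And>g. g \<in> Gam_sqrt_m3 \<Longrightarrow> slash 1 k F g = F"
      by (auto simp: M_forms_def modular_forms_def Sym_space_def)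
    define f1 f2 where "f1 = (\<lambda>b. coeff (F b) 0)" "f2 = (\<lambda>b. coeff (F b) 1)"
    have Ff: "F = (\<lambda>b. [:f1 b, f2 b:])"
      unfolding f1_f2_def using degree_le_1_pCons[OF F(2)] by blast
    have "vform k f1 f2"
      unfolding vform_def
    proof (intro conjI ballI)
      show "hol f1" "hol f2" using F(1) by (simp_all add: f1_f2_def holomorphic_on_ball_iff)
      fix g assume g: "g \<in> Gam_sqrt_m3"
      show "\<forall>b. pull1 g f1 f2 b = j1 g b powi (k - 1) * f1 b \<and> pull2 g f1 f2 b = j1 g b powi (k - 1) * f2 b"
        using slash[OF g, of f1 f2] F(3)[OF g] unfolding Ff[symmetric] by blast
    qed
    then show "\<exists>f1 f2. F = (\<lambda>b. [:f1 b, f2 b:]) \<and> vform k f1 f2" using Ff by blast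
  next
    assume "\<exists>f1 f2. F = (\<lambda>b. [:f1 b, f2 b:]) \<and> vform k f1 f2"
    then obtain f1 f2 where f: "F = (\<lambda>b. [:f1 b, f2 b:])" "vform k f1 f2" by blast
    have "hol (\<lambda>b. coeff (F b) i)" for i
      using f unfolding vform_def by (cases i; cases "i - 1") (auto simp: coeff_pCons)
    moreover have "slash 1 k F g = F" if "g \<in> Gam_sqrt_m3" for g
      unfolding f(1) slash[OF that] using f(2) that by (simp add: vform_def)
    ultimately show "F \<in> M_forms 1 k"
      by (simp add: M_forms_def modular_forms_def Sym_space_def holomorphic_on_ball_iff f(1))
  qed
qed

text \<open>Conjugation by \<open>g\<close> moves \<open>h\<close> past \<open>g\<close> inside the
  normal subgroup. As it preserves determinants, the characters \<open>det ^ n\<close> are invariant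
  under \<open>Gam\<close>, and so are the spaces of forms.\<close>

lemma conj_exists:
  assumes "g \<in> Gam" "h \<in> Gam_sqrt_m3"
  obtains h' where "h' \<in> Gam_sqrt_m3" "h' ** g = g ** h" "det h' = det h"
    "\<And>b. act g (act h b) = act h' (act g b)"
    "\<And>b. j1 g (act h b) * j1 h b = j1 h' (act g b) * j1 g b"
proof -
  obtain g' where g': "g' \<in> Gam" "g ** g' = mat 1" "g' ** g = mat 1"
    using Gam_inverse[OF assms(1)] .
  let ?h = "g ** h ** g'"
  have 1: "?h \<in> Gam_sqrt_m3" by (rule Gam_sqrt_m3_conj) (use assms g' in auto)
  have 2: "?h ** g = g ** h" by (metis g'(3) matrix_mul_assoc matrix_mul_rid)
  have "det g * det g' = 1" using g'(2) by (metis det_I det_mul)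
  then have 3: "det ?h = det h" by (simp add: det_mul)
  note hG = Gam_sqrt_m3_subset[OF assms(2)] Gam_sqrt_m3_subset[OF 1]
  show ?thesis
    by (rule that[OF 1 2 3]) (metis 2 assms(1) hG j1_act_mult)+
qed

lemma powi_transfer:
  fixes x y z w :: complex
  assumes "x * y = z * w" "x \<noteq> 0" "w \<noteq> 0"
  shows "x powi (- k) * z powi k = y powi k * w powi (- k)"
proof -
  have "x powi k * y powi k = z powi k * w powi k"
    by (metis assms(1) power_int_mult_distrib)
  then show ?thesis using assms by (simp add: power_int_minus field_simps)
qed

lemma hol_sl [simp]: "g \<in> Gam \<Longrightarrow> hol f \<Longrightarrow> hol (sl k g f)"
  unfolding sl_def[abs_def] by (intro hol_mult hol_powi hol_compose_act) auto

lemma sform_sl: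
  assumes g: "g \<in> Gam" and f: "sform k n f"
  shows "sform k n (sl k g f)"
  unfolding sform_def
proof (intro conjI ballI allI)
  show "hol (sl k g f)" using assms by (simp add: sform_def)
  fix h b assume h: "h \<in> Gam_sqrt_m3"
  obtain h' where h': "h' \<in> Gam_sqrt_m3" "det h' = det h"
    "act g (act h b) = act h' (act g b)" "j1 g (act h b) * j1 h b = j1 h' (act g b) * j1 g b"
    using conj_exists[OF g h] by metis
  have "sl k g f (act h b) = j1 g (act h b) powi (- k) * j1 h' (act g b) powi k * det h powi n * f (act g b)"
    using f h' by (simp add: sl_def sform_def)
  also have "j1 g (act h b) powi (- k) * j1 h' (act g b) powi k = j1 h b powi k * j1 g b powi (- k)"
    by (rule powi_transfer[OF h'(4)]) (use g in auto)
  finally show "sl k g f (act h b) = j1 h b powi k * det h powi n * sl k g f b"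
    by (simp add: sl_def)
qed

text \<open>The wedge product pulls back with the Jacobian \<open>det g / j1 ^ 3\<close>, which
  yields the character \<open>1 / det\<close> and the weight
  \<open>(k - 1) + (l - 1) + 3\<close>.\<close>

lemma sform_wedge:
  assumes f: "vform k f1 f2" and h: "vform l h1 h2"
  shows "sform (k + l + 1) (- 1) (\<lambda>b. f1 b * h2 b - f2 b * h1 b)"
  unfolding sform_def
proof (intro conjI ballI allI)
  show "hol (\<lambda>b. f1 b * h2 b - f2 b * h1 b)" using assms by (simp add: vform_def)
  fix g b assume g: "g \<in> Gam_sqrt_m3"
  note gG = Gam_sqrt_m3_subset[OF g]
  have j: "j1 g b \<noteq> 0" "det g \<noteq> 0" using gG by (simp_all add: Gam_det_nonzero)
  let ?W = "\<lambda>b. f1 b * h2 b - f2 b * h1 b"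
  have "pull1 g f1 f2 b * pull2 g h1 h2 b - pull2 g f1 f2 b * pull1 g h1 h2 b
    = (d1 (act_u g) b * d2 (act_v g) b - d2 (act_u g) b * d1 (act_v g) b) * ?W (act g b)"
    by (simp add: pull1_def pull2_def algebra_simps)
  also have "\<dots> = det g / j1 g b ^ 3 * ?W (act g b)" by (simp add: jacobian_act[OF gG])
  finally have "det g * ?W (act g b) = j1 g b ^ 3 * (pull1 g f1 f2 b * pull2 g h1 h2 b - pull2 g f1 f2 b * pull1 g h1 h2 b)"
    using j by (simp add: field_simps)
  also have "\<dots> = j1 g b powi 3 * j1 g b powi (k - 1) * j1 g b powi (l - 1) * ?W b"
    using f h g by (simp add: vform_def algebra_simps)
  also have "j1 g b powi 3 * j1 g b powi (k - 1) * j1 g b powi (l - 1) = j1 g b powi (3 + (k - 1) + (l - 1))"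
    using j(1) by (simp only: power_int_add simp_thms)
  also have "3 + (k - 1) + (l - 1) = k + l + 1" by simp
  finally show "?W (act g b) = j1 g b powi (k + l + 1) * det g powi - 1 * ?W b"
    using j by (simp add: field_simps power_int_minus)
qed

section \<open>Brackets of scalar forms\<close>

definition bracket1 :: "(picard_ball \<Rightarrow> complex) \<Rightarrow> (picard_ball \<Rightarrow> complex) \<Rightarrow> picard_ball \<Rightarrow> complex" where
  "bracket1 f h b = f b * d1 h b - h b * d1 f b"

definition bracket2 :: "(picard_ball \<Rightarrow> complex) \<Rightarrow> (picard_ball \<Rightarrow> complex) \<Rightarrow> picard_ball \<Rightarrow> complex" where
  "bracket2 f h b = f b * d2 h b - h b * d2 f b"

lemma hol_brackets [simp]: "hol f \<Longrightarrow> hol h \<Longrightarrow> hol (bracket1 f h)" "hol f \<Longrightarrow> hol h \<Longrightarrow> hol (bracket2 f h)"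
  unfolding bracket1_def[abs_def] bracket2_def[abs_def] by (simp_all add: hol_d1 hol_d2)

text \<open>The derivatives of the automorphy factor cancel in \<open>f dh - h df\<close>.\<close>

lemma pull_bracket:
  assumes g: "g \<in> Gam" and "hol f" "hol h" "hol f'" "hol h'"
    and "\<And>b. f (act g b) = j1 g b powi k * f' b" "\<And>b. h (act g b) = j1 g b powi k * h' b"
  shows "pull1 g (bracket1 f h) (bracket2 f h) b = j1 g b powi (2 * k) * bracket1 f' h' b"
    "pull2 g (bracket1 f h) (bracket2 f h) b = j1 g b powi (2 * k) * bracket2 f' h' b"
proof -
  define A where "A = (\<lambda>b. j1 g b powi k)"
  have hA: "hol A" unfolding A_def using g by (intro hol_powi) auto
  have eq: "(\<lambda>b. f (act g b)) = (\<lambda>b. A b * f' b)" "(\<lambda>b. h (act g b)) = (\<lambda>b. A b * h' b)"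
    using assms by (auto simp: A_def)
  note df = has_dD[OF has_d_compose_act[OF g \<open>hol f\<close>]] has_dD[OF has_d_compose_act[OF g \<open>hol h\<close>]]
  note da = has_dD[OF has_d_mult[OF hol_has_d[OF hA] hol_has_d[OF \<open>hol f'\<close>]]]
    has_dD[OF has_d_mult[OF hol_has_d[OF hA] hol_has_d[OF \<open>hol h'\<close>]]]
  have "j1 g b powi (2 * k) = j1 g b powi k * j1 g b powi k"
    by (subst mult_2, subst power_int_add) (use g in auto)
  then have e: "j1 g b powi (2 * k) = A b * A b" by (simp only: A_def)
  have v: "f (act g b) = A b * f' b" "h (act g b) = A b * h' b"
    by (simp_all only: A_def assms(6,7))
  have "pull1 g (bracket1 f h) (bracket2 f h) b = f (act g b) * d1 (\<lambda>b. h (act g b)) b - h (act g b) * d1 (\<lambda>b. f (act g b)) b"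
    by (simp only: df pull1_def bracket1_def bracket2_def) algebra
  also have "\<dots> = A b * f' b * d1 (\<lambda>b. A b * h' b) b - A b * h' b * d1 (\<lambda>b. A b * f' b) b"
    by (simp only: eq v)
  also have "\<dots> = A b * A b * bracket1 f' h' b"
    by (simp only: da bracket1_def) algebra
  finally show "pull1 g (bracket1 f h) (bracket2 f h) b = j1 g b powi (2 * k) * bracket1 f' h' b"
    unfolding e .
  have "pull2 g (bracket1 f h) (bracket2 f h) b = f (act g b) * d2 (\<lambda>b. h (act g b)) b - h (act g b) * d2 (\<lambda>b. f (act g b)) b"
    by (simp only: df pull2_def bracket1_def bracket2_def) algebra
  also have "\<dots> = A b * f' b * d2 (\<lambda>b. A b * h' b) b - A b * h' b * d2 (\<lambda>b. A b * f' b) b"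
    by (simp only: eq v)
  also have "\<dots> = A b * A b * bracket2 f' h' b"
    by (simp only: da bracket2_def) algebra
  finally show "pull2 g (bracket1 f h) (bracket2 f h) b = j1 g b powi (2 * k) * bracket2 f' h' b"
    unfolding e .
qed

text \<open>The factor \<open>j1 ^ (2 k)\<close> in the pullback of \<open>f dh - h df\<close> is
  \<open>j1\<close> to the weight minus one, whence the weight \<open>2 k + 1\<close>, which is 7
  for \<open>k = 3\<close>.\<close>

lemma vform_bracket:
  assumes "sform k 0 f" "sform k 0 h"
  shows "vform (2 * k + 1) (bracket1 f h) (bracket2 f h)"
  using assms pull_bracket[of _ f h f h k] Gam_sqrt_m3_subset
  by (auto simp: vform_def sform_def)

text \<open>The transformation law may be checked after multiplication by \<open>f\<close>, which
  can be cancelled. Thus a quotient known only to be holomorphic is a form.\<close>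

lemma sform_quotient:
  assumes f: "sform k n f" "\<not> (\<forall>b. f b = 0)" and h: "hol h" and fh: "sform (k + l) (n + m) (\<lambda>b. f b * h b)"
  shows "sform l m h"
  unfolding sform_def
proof (intro conjI ballI allI h)
  fix g b assume g: "g \<in> Gam_sqrt_m3"
  note gG = Gam_sqrt_m3_subset[OF g]
  have hf: "hol f" using f by (simp add: sform_def)
  show "h (act g b) = j1 g b powi l * det g powi m * h b"
  proof (rule hol_cancel[OF hf _ _ _ f(2), of "\<lambda>b. h (act g b)" "\<lambda>b. j1 g b powi l * det g powi m * h b"])
    fix b
    have nz: "j1 g b \<noteq> 0" "det g \<noteq> 0" using gG by (simp_all add: Gam_det_nonzero)
    have "j1 g b powi k * det g powi n * f b * h (act g b)
      = j1 g b powi (k + l) * det g powi (n + m) * (f b * h b)"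
      using f(1) fh g by (simp add: sform_def)
    then have "(j1 g b powi k * det g powi n) * (f b * h (act g b))
      = (j1 g b powi k * det g powi n) * (f b * (j1 g b powi l * det g powi m * h b))"
      using nz by (simp add: power_int_add algebra_simps)
    then show "f b * h (act g b) = f b * (j1 g b powi l * det g powi m * h b)"
      using nz by simp
  next
    show "hol (\<lambda>b. h (act g b))" using gG h by (rule hol_compose_act)
    have "hol (\<lambda>b. j1 g b powi l)" using gG by (intro hol_powi) auto
    then show "hol (\<lambda>b. j1 g b powi l * det g powi m * h b)" using h by (intro hol_mult hol_const)
  qed
qed

lemma sform_mult: "sform k n f \<Longrightarrow> sform l m h \<Longrightarrow> sform (k + l) (n + m) (\<lambda>b. f b * h b)"
  unfolding sform_def using Gam_sqrt_m3_subset
  by (auto simp: power_int_add Gam_det_nonzero algebra_simps)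

lemma sform_add: "sform k n f \<Longrightarrow> sform k n h \<Longrightarrow> sform k n (\<lambda>b. f b + h b)"
  unfolding sform_def by (auto simp: algebra_simps)

lemma sform_cmult: "sform k n f \<Longrightarrow> sform k n (\<lambda>b. c * f b)"
  unfolding sform_def by (auto simp: algebra_simps)

lemma sform_zero: "sform k n (\<lambda>b. 0)"
  by (simp add: sform_def)

lemma sform_const: "sform 0 0 (\<lambda>b. c)"
  by (simp add: sform_def)

lemma sform_det_cube: "sform k (- 3) f \<Longrightarrow> sform k 0 f"
proof -
  have "det g powi (- 3) = 1" if "g \<in> Gam_sqrt_m3" for g
    using det_cube[OF that] by (simp add: power_int_minus)
  then show "sform k (- 3) f \<Longrightarrow> sform k 0 f" by (simp add: sform_def)
qed

section \<open>Permutations of the cusps\<close>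

definition mat3 :: "complex \<Rightarrow> complex \<Rightarrow> complex \<Rightarrow> complex \<Rightarrow> complex \<Rightarrow> complex \<Rightarrow> complex \<Rightarrow> complex \<Rightarrow> complex \<Rightarrow> complex^3^3" where
  "mat3 a b c d e f g h i = vector [vector [a, b, c], vector [d, e, f], vector [g, h, i]]"

lemma mat3_nth [simp]:
  "mat3 a b c d e f g h i $ 1 = vector [a, b, c]"
  "mat3 a b c d e f g h i $ 2 = vector [d, e, f]"
  "mat3 a b c d e f g h i $ 3 = vector [g, h, i]"
  by (simp_all add: mat3_def)

lemma mat3_mult: "mat3 a b c d e f g h i ** mat3 a' b' c' d' e' f' g' h' i' =
  mat3 (a * a' + b * d' + c * g') (a * b' + b * e' + c * h') (a * c' + b * f' + c * i')
       (d * a' + e * d' + f * g') (d * b' + e * e' + f * h') (d * c' + e * f' + f * i')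
       (g * a' + h * d' + i * g') (g * b' + h * e' + i * h') (g * c' + h * f' + i * i')"
  by (simp add: vec_eq_iff forall_3 matrix_matrix_mult_def sum_3)

lemma mat3_mult_vec: "mat3 a b c d e f g h i *v vector [x, y, z] =
  vector [a * x + b * y + c * z, d * x + e * y + f * z, g * x + h * y + i * z]"
  by (simp add: vec_eq_iff forall_3 matrix_vector_mult_def sum_3)

lemma mat3_one: "mat 1 = mat3 1 0 0 0 1 0 0 0 1"
  by (simp add: vec_eq_iff forall_3 mat_def)

lemma mat3_det: "det (mat3 a b c d e f g h i) = a * e * i + b * f * g + c * d * h - a * f * h - b * d * i - c * e * g"
  by (simp add: det_3)

lemma mat3_in_O_F: "{a, b, c, d, e, f, g, h, i} \<subseteq> O_F \<Longrightarrow> mat3 a b c d e f g h i $ k $ l \<in> O_F"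
  using exhaust_3[of k] exhaust_3[of l] by auto

lemma mat3_in_Gam:
  assumes "{a, b, c, d, e, f, g, h, i} \<subseteq> O_F" "{a', b', c', d', e', f', g', h', i'} \<subseteq> O_F"
    and "mat3 a b c d e f g h i ** mat3 a' b' c' d' e' f' g' h' i' = mat 1"
    and "\<And>z w. herm (mat3 a b c d e f g h i *v z) (mat3 a b c d e f g h i *v w) = herm z w"
  shows "mat3 a b c d e f g h i \<in> Gam"
proof -
  have "mat3 a' b' c' d' e' f' g' h' i' ** mat3 a b c d e f g h i = mat 1"
    using assms(3) matrix_left_right_inverse by blast
  then show ?thesis
    unfolding Gam_def GL3_O_F_def
    using assms(3,4) mat3_in_O_F[OF assms(1)] mat3_in_O_F[OF assms(2)]
    by (intro CollectI conjI exI[of _ "mat3 a' b' c' d' e' f' g' h' i'"] allI) assumption+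
qed

lemma mat3_in_Gam_sqrt_m3:
  assumes "mat3 a b c d e f g h i \<in> Gam"
    and "\<forall>x\<in>{a - 1, b, c, d, e - 1, f, g, h, i - 1}. \<exists>y\<in>O_F. x = sqrt_m3 * y"
  shows "mat3 a b c d e f g h i \<in> Gam_sqrt_m3"
  unfolding Gam_sqrt_m3_def
proof (intro CollectI conjI allI assms(1))
  fix k l :: 3
  have "(mat3 a b c d e f g h i - mat 1) $ k $ l \<in> {a - 1, b, c, d, e - 1, f, g, h, i - 1}"
    using exhaust_3[of k] exhaust_3[of l] by (auto simp: mat_def)
  then show "\<exists>y\<in>O_F. (mat3 a b c d e f g h i - mat 1) $ k $ l = sqrt_m3 * y"
    using assms(2) by blast
qed

text \<open>\<open>refl3\<close> and \<open>refl2\<close> act by \<open>u \<mapsto> rho u\<close>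
  and \<open>u \<mapsto> - u\<close>, so both fix the mirror \<open>u = 0\<close> pointwise;
  \<open>swap12\<close> preserves it and acts on it by \<open>v \<mapsto> 1 / v\<close>. The signs
  in \<open>refl2\<close> and \<open>swap12\<close> make the determinants 1, as the action on the
  \<open>x_i\<close> is prescribed for such elements.\<close>

definition refl3 :: "complex^3^3" where "refl3 = mat3 1 0 0 0 1 0 0 0 rho"
definition refl2 :: "complex^3^3" where "refl2 = mat3 (-1) 0 0 0 (-1) 0 0 0 1"
definition swap12 :: "complex^3^3" where "swap12 = mat3 0 (-1) 0 (-1) 0 0 0 0 (-1)"
text \<open>Unipotent elements fixing the cusp \<open>(1 : 0 : 0)\<close>, a Heisenberg group; the
  equation \<open>t + cnj t + b * cnj b = 0\<close> expresses invariance of the Hermitian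
  form.\<close>

definition heis :: "complex \<Rightarrow> complex \<Rightarrow> complex^3^3" where "heis t b = mat3 1 t (- cnj b) 0 1 0 0 b 1"

lemma rho_cnj_rho: "rho * cnj rho = 1"
  by (simp add: cnj_rho algebra_simps rho_sq)

lemma rho_rho_mult: "rho * (rho * x) = - x - rho * x"
  unfolding mult.assoc[symmetric] rho_sq by (simp add: algebra_simps)

text \<open>\<open>rho - 1\<close> is \<open>sqrt_m3\<close> times a unit, so this reflection lies
  in the congruence subgroup and every form obeys a transformation law under it.\<close>

lemma refl3_Gam: "refl3 \<in> Gam_sqrt_m3"
proof -
  have r: "rho * (z * (cnj rho * w)) = z * w" for z w
    using rho_cnj_rho by (metis mult.assoc mult.left_commute mult_1)
  have "refl3 \<in> Gam" unfolding refl3_def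
    by (rule mat3_in_Gam[of _ _ _ _ _ _ _ _ _ 1 0 0 0 1 0 0 0 "rho * rho"])
      (auto simp: mat3_mult mat3_one rho_cube herm_def matrix_vector_mult_def sum_3 r mult.assoc)
  moreover have "rho - 1 = sqrt_m3 * (rho + 1)"
    by (simp add: sqrt_m3_rho algebra_simps rho_sq rho_rho_mult)
  ultimately show ?thesis unfolding refl3_def
    by (intro mat3_in_Gam_sqrt_m3) (auto intro: bexI[of _ 0])
qed

lemma refl2_Gam: "refl2 \<in> Gam" "matrix_inv refl2 = refl2" "det refl2 = 1"
proof -
  show "refl2 \<in> Gam" unfolding refl2_def
    by (rule mat3_in_Gam[of _ _ _ _ _ _ _ _ _ "-1" 0 0 0 "-1" 0 0 0 1])
      (auto simp: mat3_mult mat3_one herm_def matrix_vector_mult_def sum_3)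
  show "matrix_inv refl2 = refl2"
    by (rule matrix_inv_eq) (simp_all add: refl2_def mat3_mult mat3_one)
qed (simp add: refl2_def mat3_det)

lemma swap12_Gam: "swap12 \<in> Gam" "matrix_inv swap12 = swap12" "det swap12 = 1"
proof -
  show "swap12 \<in> Gam" unfolding swap12_def
    by (rule mat3_in_Gam[of _ _ _ _ _ _ _ _ _ 0 "-1" 0 "-1" 0 0 0 0 "-1"])
      (auto simp: mat3_mult mat3_one herm_def matrix_vector_mult_def sum_3)
  show "matrix_inv swap12 = swap12"
    by (rule matrix_inv_eq) (simp_all add: swap12_def mat3_mult mat3_one)
qed (simp add: swap12_def mat3_det)

lemma heis_Gam:
  assumes "{t, b, cnj t, cnj b} \<subseteq> O_F" "t + cnj t + b * cnj b = 0"
  shows "heis t b \<in> Gam" "det (heis t b) = 1"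
proof -
  have t: "cnj t = - t - b * cnj b" using assms(2) by (simp add: algebra_simps eq_neg_iff_add_eq_0)
  have "heis t b ** heis (cnj t) (- b) = mat 1"
    by (simp add: heis_def mat3_mult mat3_one t mult.commute)
  moreover have "herm (heis t b *v z) (heis t b *v w) = herm z w" for z w
    by (simp add: heis_def herm_def matrix_vector_mult_def sum_3 t algebra_simps)
  ultimately show "heis t b \<in> Gam" unfolding heis_def
    by (rule mat3_in_Gam[rotated 2]) (use assms in auto)
qed (simp add: heis_def mat3_det)

lemma heis_Gam_sqrt_m3:
  assumes "{a, c, c'} \<subseteq> O_F" "t = sqrt_m3 * a" "b = sqrt_m3 * c" "cnj b = sqrt_m3 * c'" "cnj t \<in> O_F"
    "t + cnj t + b * cnj b = 0"
  shows "heis t b \<in> Gam_sqrt_m3"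
proof -
  have "heis t b \<in> Gam" by (rule heis_Gam) (use assms in auto)
  moreover have "- cnj b = sqrt_m3 * (- c')" using assms by simp
  ultimately show ?thesis unfolding heis_def
    by (intro mat3_in_Gam_sqrt_m3) (use assms in \<open>auto intro: bexI[of _ 0] bexI[of _ "- c'"]\<close>)
qed

lemma sqrt_m3_cnj: "cnj sqrt_m3 = - sqrt_m3"
  by (simp add: sqrt_m3_def)

lemma smult_vec3: "c *s (vector [x, y, z] :: complex^3) = vector [c * x, c * y, c * z]"
  by (simp add: vec_eq_iff forall_3)

lemma uminus_vec3: "- (vector [x, y, z] :: complex^3) = vector [- x, - y, - z]"
  by (simp add: vec_eq_iff forall_3)

lemma induces_permI:
  assumes "\<sigma> permutes {1..4}"
    "\<And>i. i \<in> {1, 2, 3, 4} \<Longrightarrow> \<exists>\<gamma>\<in>Gam_sqrt_m3. \<exists>c. c \<noteq> 0 \<and> \<gamma> *v (g *v cusp s i) = c *s cusp s (\<sigma> i)"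
  shows "induces_perm s g \<sigma>"
  unfolding induces_perm_def
proof (intro conjI ballI assms(1))
  fix i :: nat assume "i \<in> {1..4}"
  then have "i \<in> {1, 2, 3, 4}" by auto
  then show "\<exists>\<gamma>\<in>Gam_sqrt_m3. \<exists>c. c \<noteq> 0 \<and> \<gamma> *v (g *v cusp s i) = c *s cusp s (\<sigma> i)" by (rule assms(2))
qed

lemma Gam_sqrt_m3_1: "mat 1 \<in> Gam_sqrt_m3"
  unfolding Gam_sqrt_m3_def by (auto intro: bexI[of _ 0])

lemma Gam_sqrt_m3_mult:
  assumes "g \<in> Gam_sqrt_m3" "h \<in> Gam_sqrt_m3"
  shows "g ** h \<in> Gam_sqrt_m3"
  unfolding Gam_sqrt_m3_def
proof (intro CollectI conjI allI)
  show "g ** h \<in> Gam" using assms by (simp add: Gam_mult Gam_sqrt_m3_subset)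
  fix i j
  obtain a where a: "\<And>i j. a i j \<in> O_F" "\<And>i j. (g - mat 1)$i$j = sqrt_m3 * a i j"
    using assms(1) unfolding Gam_sqrt_m3_def by clarsimp metis
  obtain c where c: "c \<in> O_F" "(h - mat 1)$i$j = sqrt_m3 * c"
    using assms(2) unfolding Gam_sqrt_m3_def by blast
  have h: "h$i$j \<in> O_F" for i j
    using assms(2) by (auto simp: Gam_sqrt_m3_def Gam_def GL3_O_F_def)
  have "g ** h - mat 1 = (g - mat 1) ** h + (h - mat 1)"
    by (simp add: matrix_mult_diff)
  then have "(g ** h - mat 1)$i$j = ((g - mat 1) ** h)$i$j + (h - mat 1)$i$j"
    by (simp only: vector_add_component)
  also have "((g - mat 1) ** h)$i$j = (\<Sum>k\<in>UNIV. (g - mat 1)$i$k * h$k$j)"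
    by (simp add: matrix_matrix_mult_def)
  also have "(\<Sum>k\<in>UNIV. (g - mat 1)$i$k * h$k$j) + (h - mat 1)$i$j = sqrt_m3 * ((\<Sum>k\<in>UNIV. a i k * h$k$j) + c)"
    by (simp only: a(2) c(2)) (simp add: sum_distrib_left algebra_simps)
  finally show "\<exists>x\<in>O_F. (g ** h - mat 1)$i$j = sqrt_m3 * x"
    using a(1) c(1) h by (intro bexI[of _ "(\<Sum>k\<in>UNIV. a i k * h$k$j) + c"]) auto
qed

lemma cusp_simps: "cusp s 1 = vector [1, 0, 0]" "cusp s (Suc 0) = vector [1, 0, 0]" "cusp s 2 = vector [0, 1, 0]"
  "cusp s 3 = vector [rho, 1, s]" "cusp s 4 = vector [rho, 1, - s]"
  by (simp_all add: cusp_def)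

lemma refl2_perm: "induces_perm s refl2 (Transposition.transpose 3 4)"
proof (rule induces_permI)
  show "Transposition.transpose 3 (4::nat) permutes {1..4}" by (rule permutes_swap_id) auto
  fix i :: nat assume "i \<in> {1, 2, 3, 4}"
  then have "refl2 *v cusp s i = (- 1) *s cusp s (Transposition.transpose 3 4 i)"
    by (auto simp: cusp_simps Transposition.transpose_def refl2_def mat3_mult_vec smult_vec3 uminus_vec3)
  then show "\<exists>\<gamma>\<in>Gam_sqrt_m3. \<exists>c. c \<noteq> 0 \<and> \<gamma> *v (refl2 *v cusp s i) = c *s cusp s (Transposition.transpose 3 4 i)"
    using Gam_sqrt_m3_1 by (intro bexI[of _ "mat 1"] exI[of _ "-1"]) auto
qed

lemma swap12_perm: "induces_perm s swap12 (Transposition.transpose 1 2)"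
proof (rule induces_permI)
  show "Transposition.transpose 1 (2::nat) permutes {1..4}" by (rule permutes_swap_id) auto
  fix i :: nat assume i: "i \<in> {1, 2, 3, 4}"
  have G: "heis sqrt_m3 0 \<in> Gam_sqrt_m3"
    by (rule heis_Gam_sqrt_m3[of 1 0 0]) (auto simp: sqrt_m3_cnj)
  \<comment> \<open>\<open>swap12\<close> sends \<open>(rho : 1 : s)\<close> to
    \<open>(1 : rho : s)\<close>. Adding \<open>sqrt_m3\<close> times the second coordinate turns
    the first into \<open>1 + sqrt_m3 * rho = rho ^ 2\<close>, and \<open>refl3\<close> multiplies
    the last one by \<open>rho\<close>. The same works for \<open>- s\<close>.\<close>
  let ?g = "refl3 ** heis sqrt_m3 0"
  have g: "?g \<in> Gam_sqrt_m3" by (rule Gam_sqrt_m3_mult[OF refl3_Gam G])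
  have 1: "(mat 1 :: complex^3^3) *v (swap12 *v cusp s i) = (- 1) *s cusp s (Transposition.transpose 1 2 i)"
    if "i \<in> {1, 2}"
    using that by (auto simp: cusp_simps Transposition.transpose_def swap12_def mat3_mult_vec smult_vec3 uminus_vec3)
  have 2: "?g *v (swap12 *v cusp s i) = (- rho) *s cusp s (Transposition.transpose 1 2 i)"
    if "i \<in> {3, 4}"
  proof -
    have r: "- 1 - sqrt_m3 * rho = - (rho * rho)"
      by (simp add: sqrt_m3_rho rho_sq rho_rho_mult algebra_simps)
    then show ?thesis using that
      by (auto simp: cusp_simps Transposition.transpose_def swap12_def heis_def refl3_def matrix_vector_mul_assoc[symmetric]
          mat3_mult_vec smult_vec3 uminus_vec3)
  qed
  show "\<exists>\<gamma>\<in>Gam_sqrt_m3. \<exists>c. c \<noteq> 0 \<and> \<gamma> *v (swap12 *v cusp s i) = c *s cusp s (Transposition.transpose 1 2 i)"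
  proof (cases "i \<in> {1, 2}")
    case True
    with 1 show ?thesis using Gam_sqrt_m3_1 by (intro bexI[of _ "mat 1"] exI[of _ "-1"]) auto
  next
    case False
    with i have "i \<in> {3, 4}" by auto
    with 2 show ?thesis using g by (intro bexI[of _ "?g"] exI[of _ "- rho"]) auto
  qed
qed

definition cyc :: "nat \<Rightarrow> nat" where
  "cyc = Transposition.transpose 2 3 \<circ> Transposition.transpose 3 4"

lemma cyc_simps [simp]: "cyc 1 = 1" "cyc (Suc 0) = 1" "cyc 2 = 3" "cyc 3 = 4" "cyc 4 = 2"
  by (auto simp: cyc_def Transposition.transpose_def)

lemma heis_rho_Gam:
  assumes "s \<in> {1, - 1}"
  shows "heis rho s \<in> Gam" "det (heis rho s) = 1"
  by (rule heis_Gam; use assms in \<open>auto simp: cnj_rho\<close>)+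

text \<open>The first column is that of the identity and the second one is the third cusp itself.
  Together with \<open>swap12\<close> this element carries one pair of cusps to all six
  pairs.\<close>

lemma heis_rho_perm:
  assumes s: "s \<in> {1, - 1}"
  shows "induces_perm s (heis rho s) cyc"
proof (rule induces_permI)
  show "cyc permutes {1..4}" unfolding cyc_def
    by (intro permutes_compose permutes_swap_id) auto
  have s2: "cnj s = s" "s * s = 1" "s \<in> O_F" using s by auto
  \<comment> \<open>The image of the third cusp is \<open>(2 rho - 1 : 1 : 2 s)\<close>. The shift
    by \<open>- 3 s\<close> brings its last coordinate to \<open>- s\<close>, and
    \<open>- rho - 5\<close> is the translation that then restores \<open>rho\<close>.\<close>
  have "heis (- rho - 5) (- 3 * s) \<in> Gam_sqrt_m3"
  proof (rule heis_Gam_sqrt_m3[of "1 + 3 * rho" "sqrt_m3 * s" "sqrt_m3 * s"])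
    have "sqrt_m3 * (1 + 3 * rho) = 1 + 5 * rho + 6 * (rho * rho)"
      by (simp add: sqrt_m3_rho algebra_simps)
    then show "- rho - 5 = sqrt_m3 * (1 + 3 * rho)" by (simp add: rho_sq)
  qed (use s in \<open>auto simp: sqrt_m3_sq cnj_rho mult.assoc[symmetric]\<close>)
  moreover have "heis (- rho - 5) (- 3 * s) *v (heis rho s *v cusp s 3) = 1 *s cusp s 4"
    using s by (auto simp: cusp_simps heis_def mat3_mult_vec smult_vec3 uminus_vec3)
  ultimately have 3: "\<exists>\<gamma>\<in>Gam_sqrt_m3. \<exists>c. c \<noteq> 0 \<and> \<gamma> *v (heis rho s *v cusp s 3) = c *s cusp s (cyc 3)"
    by (intro bexI[of _ "heis (- rho - 5) (- 3 * s)"] exI[of _ 1]) auto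
  \<comment> \<open>The image of the fourth cusp is \<open>(sqrt_m3 : 1 : 0)\<close>.\<close>
  have "heis (- sqrt_m3) 0 \<in> Gam_sqrt_m3"
    by (rule heis_Gam_sqrt_m3[of "-1" 0 0]) (auto simp: sqrt_m3_cnj)
  moreover have "heis (- sqrt_m3) 0 *v (heis rho s *v cusp s 4) = 1 *s cusp s 2"
    using s by (auto simp: cusp_simps heis_def mat3_mult_vec smult_vec3 uminus_vec3 sqrt_m3_rho)
  ultimately have 4: "\<exists>\<gamma>\<in>Gam_sqrt_m3. \<exists>c. c \<noteq> 0 \<and> \<gamma> *v (heis rho s *v cusp s 4) = c *s cusp s (cyc 4)"
    by (intro bexI[of _ "heis (- sqrt_m3) 0"] exI[of _ 1]) auto
  have "(mat 1 :: complex^3^3) *v (heis rho s *v cusp s i) = 1 *s cusp s (cyc i)" if "i \<in> {1, 2}" for i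
    using that s by (auto simp: cusp_simps heis_def mat3_mult_vec smult_vec3 uminus_vec3)
  then have 12: "\<exists>\<gamma>\<in>Gam_sqrt_m3. \<exists>c. c \<noteq> 0 \<and> \<gamma> *v (heis rho s *v cusp s i) = c *s cusp s (cyc i)"
    if "i \<in> {1, 2}" for i
    using that Gam_sqrt_m3_1 by (intro bexI[of _ "mat 1"] exI[of _ 1]) auto
  fix i :: nat assume "i \<in> {1, 2, 3, 4}"
  then show "\<exists>\<gamma>\<in>Gam_sqrt_m3. \<exists>c. c \<noteq> 0 \<and> \<gamma> *v (heis rho s *v cusp s i) = c *s cusp s (cyc i)"
    using 12[of i] 3 4 by (elim insertE) simp_all
qed

lemma act_concrete:
  "act refl3 b = pt (rho * fst (coords b)) (snd (coords b))" "j1 refl3 b = 1" "det refl3 = rho"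
  "act refl2 b = pt (- fst (coords b)) (snd (coords b))" "j1 refl2 b = - 1"
  "act swap12 b = pt (fst (coords b) / snd (coords b)) (1 / snd (coords b))" "j1 swap12 b = - snd (coords b)"
  by (simp_all add: act_def j1_def refl3_def refl2_def swap12_def pt_def split_beta mat3_det)

section \<open>Polynomials in the generators\<close>

definition ring_hom_fun :: "('a::comm_ring_1 \<Rightarrow> 'b::comm_ring_1) \<Rightarrow> bool" where
  "ring_hom_fun h \<longleftrightarrow> h 0 = 0 \<and> h 1 = 1 \<and> (\<forall>x y. h (x + y) = h x + h y) \<and> (\<forall>x y. h (x * y) = h x * h y)"

text \<open>Extends \<open>h\<close> to polynomials by sending the variable to \<open>z\<close>;
  three iterations evaluate a polynomial in three variables.\<close>

definition lift_poly :: "('a::comm_ring_1 \<Rightarrow> 'b::comm_ring_1) \<Rightarrow> 'b \<Rightarrow> 'a poly \<Rightarrow> 'b" where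
  "lift_poly h z P = fold_coeffs (\<lambda>a b. h a + z * b) P 0"

lemma lift_poly_0 [simp]: "lift_poly h z 0 = 0"
  by (simp add: lift_poly_def)

lemma lift_poly_pCons: "h 0 = 0 \<Longrightarrow> lift_poly h z (pCons a P) = h a + z * lift_poly h z P"
  by (cases "a = 0 \<and> P = 0") (auto simp: lift_poly_def)

lemma ring_hom_lift_poly:
  assumes h: "ring_hom_fun h"
  shows "ring_hom_fun (lift_poly h z)"
proof -
  have h0: "h 0 = 0" "h 1 = 1" "\<And>x y. h (x + y) = h x + h y" "\<And>x y. h (x * y) = h x * h y"
    using h by (auto simp: ring_hom_fun_def)
  note pc = lift_poly_pCons[where h = h, OF h0(1)]
  have add: "lift_poly h z (P + Q) = lift_poly h z P + lift_poly h z Q" for P Q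
    by (induction P Q rule: poly_induct2) (simp_all add: pc h0 algebra_simps)
  have smult: "lift_poly h z (smult c P) = h c * lift_poly h z P" for c P
    by (induction P) (simp_all add: pc h0 algebra_simps)
  have mult: "lift_poly h z (P * Q) = lift_poly h z P * lift_poly h z Q" for P Q
    by (induction P) (simp_all add: pc h0 add smult algebra_simps)
  show ?thesis
    unfolding ring_hom_fun_def using add mult by (simp add: one_pCons pc h0)
qed

lemma ring_hom_funD:
  assumes "ring_hom_fun h"
  shows "h 0 = 0" "h 1 = 1" "h (x + y) = h x + h y" "h (x * y) = h x * h y" "h (- x) = - h x"
    "h (x - y) = h x - h y" "h (x ^ n) = h x ^ n"
proof -
  show *: "h 0 = 0" "h 1 = 1" "h (x + y) = h x + h y" "h (x * y) = h x * h y" for x y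
    using assms by (auto simp: ring_hom_fun_def)
  show m: "h (- x) = - h x" for x using *(1) *(3)[of x "- x"] by (simp add: add_eq_0_iff)
  show "h (x - y) = h x - h y" using *(3)[of x "- y"] m[of y] by simp
  show "h (x ^ n) = h x ^ n" by (induction n) (simp_all add: *)
qed

text \<open>The variable of the target polynomials records the degree, so that homogeneous components can
  be read off as coefficients.\<close>

definition ev3 :: "complex \<Rightarrow> complex \<Rightarrow> complex \<Rightarrow> complex poly poly poly \<Rightarrow> complex poly" where
  "ev3 x y z = lift_poly (lift_poly (lift_poly (\<lambda>c. [:c:]) [:0, x:]) [:0, y:]) [:0, z:]"

definition ev2 :: "complex \<Rightarrow> complex \<Rightarrow> complex poly poly \<Rightarrow> complex poly" where
  "ev2 x y = lift_poly (lift_poly (\<lambda>c. [:c:]) [:0, x:]) [:0, y:]"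

definition ev1 :: "complex \<Rightarrow> complex poly \<Rightarrow> complex poly" where
  "ev1 x = lift_poly (\<lambda>c. [:c:]) [:0, x:]"

lemma ring_hom_ev: "ring_hom_fun (ev1 x)" "ring_hom_fun (ev2 x y)" "ring_hom_fun (ev3 x y z)"
proof -
  have "ring_hom_fun (\<lambda>c::complex. [:c:])" by (simp add: ring_hom_fun_def one_pCons)
  then show "ring_hom_fun (ev1 x)" "ring_hom_fun (ev2 x y)" "ring_hom_fun (ev3 x y z)"
    by (simp_all add: ev1_def ev2_def ev3_def ring_hom_lift_poly)
qed

lemmas ev1_hom = ring_hom_funD[OF ring_hom_ev(1)]
lemmas ev2_hom = ring_hom_funD[OF ring_hom_ev(2)]
lemmas ev3_hom = ring_hom_funD[OF ring_hom_ev(3)]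

lemma ev_pCons:
  "ev1 x (pCons c p) = [:c:] + [:0, x:] * ev1 x p"
  "ev2 x y (pCons p q) = ev1 x p + [:0, y:] * ev2 x y q"
  "ev3 x y z (pCons q r) = ev2 x y q + [:0, z:] * ev3 x y z r"
  using ev1_hom(1) ev2_hom(1) unfolding ev1_def ev2_def ev3_def
  by (subst lift_poly_pCons; simp)+

lemma ev_0 [simp]: "ev1 x 0 = 0" "ev2 x y 0 = 0" "ev3 x y z 0 = 0"
  by (simp_all add: ev1_hom ev2_hom ev3_hom)

text \<open>\<open>PZ\<close> is the outermost variable, so that reduction modulo \<open>PZ\<close>
  is \<open>coeff _ 0\<close>. In the application it stands for a form that vanishes on the
  mirror.\<close>

definition PX :: "complex poly poly poly" where "PX = [:[:[:0, 1:]:]:]"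
definition PY :: "complex poly poly poly" where "PY = [:[:0, 1:]:]"
definition PZ :: "complex poly poly poly" where "PZ = [:0, 1:]"
definition PC :: "complex \<Rightarrow> complex poly poly poly" where "PC c = [:[:[:c:]:]:]"

lemma ev3_gens [simp]: "ev3 x y z PX = [:0, x:]" "ev3 x y z PY = [:0, y:]" "ev3 x y z PZ = [:0, z:]"
  "ev3 x y z (PC c) = [:c:]"
  by (simp_all add: PX_def PY_def PZ_def PC_def ev_pCons one_pCons)

lemma coeff_0_ev: "coeff (ev1 x p) 0 = coeff p 0" "coeff (ev2 x y q) 0 = coeff (coeff q 0) 0"
  "coeff (ev3 x y z r) 0 = coeff (coeff (coeff r 0) 0) 0"
proof -
  show 1: "coeff (ev1 x p) 0 = coeff p 0" for p by (cases p) (simp add: ev_pCons)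
  show 2: "coeff (ev2 x y q) 0 = coeff (coeff q 0) 0" for q by (cases q) (simp add: ev_pCons 1)
  show "coeff (ev3 x y z r) 0 = coeff (coeff (coeff r 0) 0) 0" by (cases r) (simp add: ev_pCons 2)
qed

lemma poly_ev1: "poly (ev1 x p) t = poly p (t * x)"
  by (induction p) (simp_all add: ev_pCons algebra_simps)

lemma poly_ev2: "poly (ev2 x y q) t = poly (poly q [:t * y:]) (t * x)"
  by (induction q) (simp_all add: ev_pCons poly_ev1 algebra_simps)

context
  fixes x y z :: "picard_ball \<Rightarrow> complex"
  assumes xyz: "sform 3 0 x" "sform 3 0 y" "sform 3 0 z"
begin

text \<open>The factor \<open>[:0, w b:]\<close> raises the degree by one and the weight by 3
  simultaneously, which keeps the coefficient \<open>n\<close> in weight \<open>3 n\<close>.\<close>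

lemma sform_shift:
  assumes "sform 3 0 w" "\<And>n. sform (3 * int n) 0 (\<lambda>b. coeff (f b) n)"
  shows "sform (3 * int n) 0 (\<lambda>b. coeff ([:0, w b:] * f b) n)"
proof (cases n)
  case (Suc m)
  have "sform (3 + 3 * int m) (0 + 0) (\<lambda>b. w b * coeff (f b) m)"
    by (rule sform_mult[OF assms(1) assms(2)])
  then show ?thesis using Suc by (simp add: algebra_simps)
qed (simp add: sform_zero)

lemma sform_coeff_ev1: "sform (3 * int n) 0 (\<lambda>b. coeff (ev1 (x b) p) n)"
proof (induction p arbitrary: n)
  case (pCons c p)
  have "sform (3 * int n) 0 (\<lambda>b. coeff [:c:] n)"
    by (cases n) (simp_all add: sform_const sform_zero)
  then show ?case
    unfolding ev_pCons coeff_add by (intro sform_add sform_shift pCons xyz)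
qed (simp add: sform_zero)

lemma sform_coeff_ev2: "sform (3 * int n) 0 (\<lambda>b. coeff (ev2 (x b) (y b) q) n)"
proof (induction q arbitrary: n)
  case (pCons c p)
  show ?case
    unfolding ev_pCons coeff_add by (intro sform_add sform_shift pCons xyz sform_coeff_ev1)
qed (simp add: sform_zero)

lemma sform_coeff_ev3: "sform (3 * int n) 0 (\<lambda>b. coeff (ev3 (x b) (y b) (z b) r) n)"
proof (induction r arbitrary: n)
  case (pCons c p)
  show ?case
    unfolding ev_pCons coeff_add by (intro sform_add sform_shift pCons xyz sform_coeff_ev2)
qed (simp add: sform_zero)

lemma hol_poly_ev1: "hol (\<lambda>b. poly (ev1 (x b) p) t)"
  using xyz by (induction p) (simp_all add: ev_pCons sform_def)

lemma hol_poly_ev2: "hol (\<lambda>b. poly (ev2 (x b) (y b) q) t)"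
  using xyz by (induction q) (simp_all add: ev_pCons sform_def hol_poly_ev1)

lemma hol_poly_ev3: "hol (\<lambda>b. poly (ev3 (x b) (y b) (z b) r) t)"
  using xyz by (induction r) (simp_all add: ev_pCons sform_def hol_poly_ev2)

end

lemma poly_eq_0_if_infinite:
  fixes p :: "'a::idom poly"
  assumes "infinite A" "\<And>x. x \<in> A \<Longrightarrow> poly p x = 0"
  shows "p = 0"
proof (rule ccontr)
  assume "p \<noteq> 0"
  then have "finite {x. poly p x = 0}" by (rule poly_roots_finite)
  moreover have "A \<subseteq> {x. poly p x = 0}" using assms(2) by blast
  ultimately show False using assms(1) finite_subset by blast
qed

lemma infinite_nonzero_complex: "infinite (- {0 :: complex})"
  using infinite_UNIV_char_0 by (metis Compl_eq_Diff_UNIV finite.emptyI finite_Diff2 finite_insert)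

text \<open>If \<open>x / y\<close> takes infinitely many values then the points \<open>(t x, t y)\<close> are Zariski dense in the plane.\<close>

lemma ev2_eq_0:
  assumes ev: "\<And>b. b \<in> S \<Longrightarrow> ev2 (x b) (y b) q = 0" and inf: "infinite {x b / y b | b. b \<in> S \<and> y b \<noteq> (0::complex)}"
  shows "q = 0"
proof (rule poly_eq_0_if_infinite)
  show "infinite ((\<lambda>s::complex. [:s:]) ` (- {0}))"
    using infinite_nonzero_complex by (subst finite_image_iff) (auto simp: inj_on_def)
  fix c assume "c \<in> (\<lambda>s::complex. [:s:]) ` (- {0})"
  then obtain s where s: "s \<noteq> 0" "c = [:s:]" by auto
  show "poly q c = 0"
  proof (rule poly_eq_0_if_infinite)
    show "infinite ((*) s ` {x b / y b | b. b \<in> S \<and> y b \<noteq> 0})"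
      using inf s by (subst finite_image_iff) (auto simp: inj_on_def)
    fix w assume "w \<in> (*) s ` {x b / y b | b. b \<in> S \<and> y b \<noteq> 0}"
    then obtain b where b: "b \<in> S" "y b \<noteq> 0" "w = s * (x b / y b)" by auto
    \<comment> \<open>With \<open>t = s / y\<close> the point \<open>(t x, t y)\<close> has first
      coordinate \<open>w\<close> and second coordinate \<open>s\<close>.\<close>
    have "poly (ev2 (x b) (y b) q) (s / y b) = 0" using ev[OF b(1)] by simp
    then show "poly (poly q c) w = 0" using b s by (simp add: poly_ev2)
  qed
qed

text \<open>Modulo \<open>PZ\<close> the relation involves \<open>PX\<close> and \<open>PY\<close>
  only and is solved by \<open>p0 = PY r0\<close>, \<open>p1 = - PX r0\<close>. Subtracting this
  solution leaves a relation divisible by \<open>PZ\<close>, which determines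
  \<open>p2\<close>.\<close>

lemma koszul:
  assumes "PX * p0 + PY * p1 + PZ * p2 = 0"
  obtains a0 a1 a2 where "p0 = PY * a2 - PZ * a1" "p1 = PZ * a0 - PX * a2" "p2 = PX * a1 - PY * a0"
proof -
  obtain c0 q0 where p0: "p0 = pCons c0 q0" by (cases p0)
  obtain c1 q1 where p1: "p1 = pCons c1 q1" by (cases p1)
  have "coeff (PX * p0 + PY * p1 + PZ * p2) 0 = 0" using assms by simp
  then have c: "[:[:0, 1:]:] * c0 + [:0, 1:] * c1 = 0"
    by (simp add: PX_def PY_def PZ_def p0 p1)
  obtain e0 r0 where c0: "c0 = pCons e0 r0" by (cases c0)
  have "coeff ([:[:0, 1:]:] * c0 + [:0, 1:] * c1) 0 = 0" using c by simp
  then have "e0 = 0" by (simp add: c0)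
  then have c0': "c0 = [:0, 1:] * r0" by (simp add: c0)
  have "[:0, 1:] * ([:[:0, 1:]:] * r0 + c1) = 0" using c unfolding c0' by (simp only: algebra_simps)
  then have c1': "c1 = - ([:[:0, 1:]:] * r0)" by (simp add: add_eq_0_iff)
  have P0: "p0 = PY * [:r0:] + PZ * q0" unfolding p0 c0' by (simp add: PY_def PZ_def)
  have P1: "p1 = - (PX * [:r0:]) + PZ * q1" unfolding p1 c1' by (simp add: PX_def PZ_def)
  have "PZ * (PX * q0 + PY * q1 + p2) = 0" using assms unfolding P0 P1 by (simp add: algebra_simps)
  moreover have "PZ \<noteq> 0" by (simp add: PZ_def)
  ultimately have "PX * q0 + PY * q1 + p2 = 0" by simp
  then have P2: "p2 = - (PX * q0) - PY * q1" by (simp add: eq_neg_iff_add_eq_0 algebra_simps)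
  show ?thesis
    by (rule that[of "[:r0:]" "- q0" q1]) (simp_all add: P0 P1 P2 algebra_simps)
qed

section \<open>Prime linear forms and the six lines\<close>

lemma prime_linear: "prime_elem [:c, 1 :: 'a::idom:]"
proof (rule prime_elemI)
  show "\<not> [:c, 1:] dvd 1"
    using poly_eq_0_iff_dvd[of 1 "- c"] by simp
  fix p q :: "'a poly" assume "[:c, 1:] dvd p * q"
  then have "poly (p * q) (- c) = 0" using poly_eq_0_iff_dvd[of "p * q" "- c"] by simp
  then have "poly p (- c) = 0 \<or> poly q (- c) = 0" by simp
  then show "[:c, 1:] dvd p \<or> [:c, 1:] dvd q"
    using poly_eq_0_iff_dvd[of p "- c"] poly_eq_0_iff_dvd[of q "- c"] by simp
qed simp

lemma dvd_linear_iff: "[:c, 1 :: 'a::idom:] dvd p \<longleftrightarrow> poly p (- c) = 0"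
  using poly_eq_0_iff_dvd[of p "- c"] by simp

lemma prime_square_dvd_mult:
  fixes p :: "'a::idom"
  assumes "prime_elem p" "p\<^sup>2 dvd a * b" "\<not> p dvd a"
  shows "p\<^sup>2 dvd b"
proof -
  have "p dvd a * b" using assms(2) by (metis dvd_mult_left power2_eq_square)
  then have "p dvd b" using assms by (simp add: prime_elem_dvd_mult_iff)
  then obtain c where c: "b = p * c" by blast
  have p0: "p \<noteq> 0" using assms(1) by auto
  have "p * p dvd p * (a * c)" using assms(2) c by (simp add: power2_eq_square mult_ac)
  then have "p dvd a * c" using p0 by (simp only: dvd_mult_cancel_left) simp
  then have "p dvd c" using assms by (simp add: prime_elem_dvd_mult_iff)
  then show ?thesis using c by (simp add: power2_eq_square mult_dvd_mono)
qed

lemma prime_elem_not_dvd_prod: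
  assumes "prime_elem p" "finite I" "\<And>i. i \<in> I \<Longrightarrow> \<not> p dvd f i"
  shows "\<not> p dvd prod f I"
  using assms(2,3)
  by (induction I rule: finite_induct) (use assms(1) in \<open>auto simp: prime_elem_dvd_mult_iff dest: prime_elem_not_unit\<close>)

text \<open>The square of each new prime passes to the cofactor \<open>T\<close>, because that prime
  does not divide the product of the others. The argument rests on primality and not on unique
  factorisation.\<close>

lemma prime_square_dvd_prod:
  fixes f :: "'i \<Rightarrow> 'a::idom"
  assumes "finite I" "\<And>i. i \<in> I \<Longrightarrow> prime_elem (f i)" "\<And>i. i \<in> I \<Longrightarrow> (f i)\<^sup>2 dvd S"
    and "\<And>i j. i \<in> I \<Longrightarrow> j \<in> I \<Longrightarrow> i \<noteq> j \<Longrightarrow> \<not> f i dvd f j"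
  shows "(\<Prod>i\<in>I. f i)\<^sup>2 dvd S"
  using assms
proof (induction I rule: finite_induct)
  case (insert i I)
  then have "(\<Prod>i\<in>I. f i)\<^sup>2 dvd S" by auto
  then obtain T where T: "S = (\<Prod>i\<in>I. f i)\<^sup>2 * T" by blast
  have "\<not> f i dvd (\<Prod>i\<in>I. f i)"
    using insert by (intro prime_elem_not_dvd_prod) auto
  moreover have "prime_elem (f i)" using insert by simp
  ultimately have "\<not> f i dvd (\<Prod>i\<in>I. f i)\<^sup>2" using prime_elem_dvd_power by blast
  moreover have "(f i)\<^sup>2 dvd (\<Prod>i\<in>I. f i)\<^sup>2 * T"
    using insert.prems(2)[OF insertI1] by (simp only: T)
  ultimately have "(f i)\<^sup>2 dvd T" using \<open>prime_elem (f i)\<close> prime_square_dvd_mult by blast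
  then have "(f i)\<^sup>2 * (\<Prod>i\<in>I. f i)\<^sup>2 dvd T * (\<Prod>i\<in>I. f i)\<^sup>2" by (rule mult_dvd_mono) simp
  then show ?case using insert(1,2) by (simp add: power_mult_distrib T mult.commute)
qed simp

text \<open>Up to factors 4 and signs these are the differences \<open>x_i - x_j\<close> in the
  coordinates \<open>p0\<close>, \<open>p1\<close> and \<open>f0 = p1 - p2\<close>; thus
  \<open>PZ - PY\<close> stands for \<open>- p2\<close>.\<close>

definition line_poly :: "nat \<Rightarrow> complex poly poly poly" where
  "line_poly i = [PX, PY, PY - PX, PZ, PZ - PY, PZ - PY + PX] ! i"

lemma less_6_cases: "i < 6 \<Longrightarrow> i = 0 \<or> i = 1 \<or> i = 2 \<or> i = 3 \<or> i = 4 \<or> i = (5::nat)"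
  by linarith

lemma line_poly_simps:
  "line_poly 0 = PX" "line_poly 1 = PY" "line_poly 2 = PY - PX" "line_poly 3 = PZ"
  "line_poly 4 = PZ - PY" "line_poly 5 = PZ - PY + PX"
  by (simp_all add: line_poly_def)

text \<open>After stripping constant layers each of them is monic linear in its outermost
  variable.\<close>

lemma line_poly_prime:
  assumes "i < 6"
  shows "prime_elem (line_poly i)"
proof -
  have "prime_elem PX" "prime_elem PY" "prime_elem PZ"
    by (simp_all add: PX_def PY_def PZ_def prime_elem_const_poly_iff prime_linear)
  moreover have "prime_elem (PY - PX)"
    using prime_linear[of "- [:0, 1:] :: complex poly"]
    by (simp add: PX_def PY_def prime_elem_const_poly_iff)
  moreover have "prime_elem (PZ - PY)" "prime_elem (PZ - PY + PX)"
    using prime_linear[of "- [:0, 1:] :: complex poly poly"]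
      prime_linear[of "- [:0, 1:] + [:[:0, 1:]:] :: complex poly poly"]
    by (simp_all add: PX_def PY_def PZ_def)
  ultimately show ?thesis
    using less_6_cases[OF assms] by (auto simp only: line_poly_simps)
qed

lemma ev3_line_poly:
  "ev3 x y z (line_poly 0) = [:0, x:]" "ev3 x y z (line_poly 1) = [:0, y:]"
  "ev3 x y z (line_poly 2) = [:0, y - x:]" "ev3 x y z (line_poly 3) = [:0, z:]"
  "ev3 x y z (line_poly 4) = [:0, z - y:]" "ev3 x y z (line_poly 5) = [:0, z - y + x:]"
  by (simp_all only: line_poly_simps ev3_hom ev3_gens) simp_all

text \<open>Each of the six lines contains a point that lies on none of the other five.\<close>

lemma line_poly_not_dvd:
  assumes "i < 6" "j < 6" "i \<noteq> j"
  shows "\<not> line_poly i dvd line_poly j"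
proof
  assume "line_poly i dvd line_poly j"
  then obtain r where "line_poly j = line_poly i * r" by blast
  then have *: "ev3 x y z (line_poly i) = 0 \<Longrightarrow> ev3 x y z (line_poly j) = 0" for x y z
    by (simp add: ev3_hom)
  have p: "ev3 0 1 3 (line_poly 0) = 0" "ev3 1 0 3 (line_poly 1) = 0" "ev3 1 1 3 (line_poly 2) = 0"
    "ev3 1 3 0 (line_poly 3) = 0" "ev3 1 3 3 (line_poly 4) = 0" "ev3 1 3 2 (line_poly 5) = 0"
    by (simp_all only: ev3_line_poly) simp_all
  show False
    using less_6_cases[OF assms(1)]
  proof (elim disjE)
    assume i: "i = 0"
    show False using *[of 0 1 3] p(1) less_6_cases[OF assms(2)] assms(3) unfolding i
      by (elim disjE) (simp_all only: ev3_line_poly, simp_all)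
  next
    assume i: "i = 1"
    show False using *[of 1 0 3] p(2) less_6_cases[OF assms(2)] assms(3) unfolding i
      by (elim disjE) (simp_all only: ev3_line_poly, simp_all)
  next
    assume i: "i = 2"
    show False using *[of 1 1 3] p(3) less_6_cases[OF assms(2)] assms(3) unfolding i
      by (elim disjE) (simp_all only: ev3_line_poly, simp_all)
  next
    assume i: "i = 3"
    show False using *[of 1 3 0] p(4) less_6_cases[OF assms(2)] assms(3) unfolding i
      by (elim disjE) (simp_all only: ev3_line_poly, simp_all)
  next
    assume i: "i = 4"
    show False using *[of 1 3 3] p(5) less_6_cases[OF assms(2)] assms(3) unfolding i
      by (elim disjE) (simp_all only: ev3_line_poly, simp_all)
  next
    assume i: "i = 5"
    show False using *[of 1 3 2] p(6) less_6_cases[OF assms(2)] assms(3) unfolding i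
      by (elim disjE) (simp_all only: ev3_line_poly, simp_all)
  qed
qed

section \<open>Taylor expansions along the mirror\<close>

text \<open>The reflection \<open>refl3\<close> fixes the mirror \<open>u = 0\<close>. Restrictions to the mirror are regarded as
  functions on the ball that do not depend on \<open>u\<close>; \<open>tay f b\<close> expands \<open>f\<close> in powers of \<open>u\<close> at the point
  \<open>(0, v)\<close> for \<open>b = (u, v)\<close>.\<close>

definition rst :: "(picard_ball \<Rightarrow> complex) \<Rightarrow> picard_ball \<Rightarrow> complex" where
  "rst f b = f (pt 0 (snd (coords b)))"

definition tay :: "(picard_ball \<Rightarrow> complex) \<Rightarrow> picard_ball \<Rightarrow> complex fps" where
  "tay f b = fps_expansion (\<lambda>u. f (pt u (snd (coords b)))) 0"

definition slice :: "picard_ball \<Rightarrow> complex set" where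
  "slice b = {u. (u, snd (coords b)) \<in> ball_coords}"

lemma zero_in_slice [simp]: "0 \<in> slice b"
proof -
  have "2 * Re (snd (coords b)) + (cmod (fst (coords b)))\<^sup>2 < 0"
    using coords_in_ball[of b] by (simp add: ball_coords_def split_beta)
  then have "Re (snd (coords b)) < 0" by (smt (verit) zero_le_power2)
  then show ?thesis by (simp add: slice_def ball_coords_def)
qed

lemma fst_in_slice: "fst (coords b) \<in> slice b"
  by (simp add: slice_def)

lemma slice_eq: "slice b = ball 0 (sqrt (- 2 * Re (snd (coords b))))"
proof -
  let ?x = "- 2 * Re (snd (coords b))"
  have x: "?x > 0"
    using zero_in_slice[of b] by (simp add: slice_def ball_coords_def)
  have "(cmod u)\<^sup>2 < ?x \<longleftrightarrow> cmod u < sqrt ?x" for u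
  proof
    assume "cmod u < sqrt ?x"
    then have "(cmod u)\<^sup>2 < (sqrt ?x)\<^sup>2" by (intro power_strict_mono) auto
    then show "(cmod u)\<^sup>2 < ?x" using x by simp
  qed (rule real_less_rsqrt)
  moreover have "u \<in> slice b \<longleftrightarrow> (cmod u)\<^sup>2 < ?x" for u
    by (auto simp: slice_def ball_coords_def)
  ultimately show ?thesis by (simp only: set_eq_iff) simp
qed

lemma open_slice: "open (slice b)" and connected_slice: "connected (slice b)"
  by (simp_all add: slice_eq)

lemma pt_coords [simp]: "pt (fst (coords b)) (snd (coords b)) = b"
  by (simp add: pt_def)

lemma coords_pt_slice [simp]: "u \<in> slice b \<Longrightarrow> coords (pt u (snd (coords b))) = (u, snd (coords b))"
  by (simp add: slice_def)

lemma holomorphic_on_slice: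
  assumes "hol f"
  shows "(\<lambda>u. f (pt u (snd (coords b)))) holomorphic_on slice b"
proof -
  have "(\<lambda>z. f (pt (0 + z * 1) (snd (coords b) + z * 0))) holomorphic_on slice b"
    by (rule hol_on_line[OF assms]) (simp add: slice_def)
  then show ?thesis by simp
qed

lemma has_fps_expansion_tay: "hol f \<Longrightarrow> (\<lambda>u. f (pt u (snd (coords b)))) has_fps_expansion tay f b"
  unfolding tay_def by (rule has_fps_expansion_fps_expansion[OF open_slice[of b] zero_in_slice[of b] holomorphic_on_slice])

lemma tay_diff: "hol f \<Longrightarrow> hol g \<Longrightarrow> tay (\<lambda>b. f b - g b) b = tay f b - tay g b"
  unfolding tay_def[of "\<lambda>b. f b - g b"]
  by (intro fps_expansion_eqI has_fps_expansion_diff has_fps_expansion_tay)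

lemma tay_mult: "hol f \<Longrightarrow> hol g \<Longrightarrow> tay (\<lambda>b. f b * g b) b = tay f b * tay g b"
  unfolding tay_def[of "\<lambda>b. f b * g b"]
  by (intro fps_expansion_eqI has_fps_expansion_mult has_fps_expansion_tay)

lemma tay_const: "tay (\<lambda>_. c) b = fps_const c"
  unfolding tay_def by (intro fps_expansion_eqI has_fps_expansion_const)

lemma tay_power: "hol f \<Longrightarrow> tay (\<lambda>b. f b ^ n) b = tay f b ^ n"
  by (induction n) (simp_all add: tay_const tay_mult)

lemma tay_nth_0: "hol f \<Longrightarrow> fps_nth (tay f b) 0 = rst f b"
  using has_fps_expansion_imp_0_eq_fps_nth_0[OF has_fps_expansion_tay[of f b]] by (simp add: rst_def)

lemma tay_d1: assumes "hol f" shows "tay (d1 f) b = fps_deriv (tay f b)"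
proof -
  have "deriv (\<lambda>u. f (pt u (snd (coords b)))) has_fps_expansion fps_deriv (tay f b)"
    by (intro has_fps_expansion_deriv has_fps_expansion_tay assms)
  moreover have "\<forall>\<^sub>F u in nhds 0. deriv (\<lambda>u. f (pt u (snd (coords b)))) u = d1 f (pt u (snd (coords b)))"
  proof (rule eventually_nhds_in_open[OF open_slice zero_in_slice, THEN eventually_mono])
    fix u assume "u \<in> slice b"
    then show "deriv (\<lambda>u. f (pt u (snd (coords b)))) u = d1 f (pt u (snd (coords b)))"
      by (simp add: d1_def partial1_def pt_def[symmetric])
  qed
  ultimately have "(\<lambda>u. d1 f (pt u (snd (coords b)))) has_fps_expansion fps_deriv (tay f b)"
    by (rule has_fps_expansion_cong[OF _ refl, THEN iffD1, rotated])
  then show ?thesis unfolding tay_def[of "d1 f"] by (rule fps_expansion_eqI)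
qed

lemma tay_nth_Suc: "hol f \<Longrightarrow> fps_nth (tay f b) (Suc n) = fps_nth (tay (d1 f) b) n / of_nat (Suc n)"
  by (simp add: tay_d1 del: of_nat_Suc)

lemma has_d_rst: assumes "hol f" shows "has_d (rst f) 0 (d2 f (pt 0 (snd (coords b)))) b"
proof -
  let ?m = "\<lambda>b. pt 0 (snd (coords b))"
  have "(\<lambda>b. fst (coords (?m b))) = (\<lambda>_. 0)" "(\<lambda>b. snd (coords (?m b))) = (\<lambda>b. snd (coords b))"
    by (simp_all add: fun_eq_iff)
  then have "has_d (\<lambda>b. fst (coords (?m b))) 0 0 b" "has_d (\<lambda>b. snd (coords (?m b))) 0 1 b"
    using has_d_const has_d_snd by metis+
  from has_d_compose2[OF hol_has_d[OF assms] this] show ?thesis by (simp add: rst_def[abs_def])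
qed

lemma hol_rst [simp]: "hol f \<Longrightarrow> hol (rst f)"
  by (rule holI, rule has_d_rst)

lemma d2_rst: "hol f \<Longrightarrow> d2 (rst f) b = rst (d2 f) b"
  using has_dD(2)[OF has_d_rst] by (simp add: rst_def)

lemma partial_cong:
  assumes "\<And>x. x \<in> ball_coords \<Longrightarrow> f x = g x" "x \<in> ball_coords"
  shows "partial1 f x = partial1 g x" "partial2 f x = partial2 g x"
proof -
  have o: "open {z. (z, snd x) \<in> ball_coords}" "open {z. (fst x, z) \<in> ball_coords}"
    using open_vimage[OF open_ball_coords continuous_on_Pair[OF continuous_on_id continuous_on_const], of "snd x"]
      open_vimage[OF open_ball_coords continuous_on_Pair[OF continuous_on_const continuous_on_id], of "fst x"]
    by (simp_all add: vimage_def)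
  show "partial1 f x = partial1 g x"
    unfolding partial1_def
    by (intro deriv_cong_ev eventually_nhds_in_open[OF o(1), THEN eventually_mono] refl) (use assms in auto)
  show "partial2 f x = partial2 g x"
    unfolding partial2_def
    by (intro deriv_cong_ev eventually_nhds_in_open[OF o(2), THEN eventually_mono] refl) (use assms in auto)
qed

text \<open>Symmetry of the mixed derivatives lets \<open>d2\<close> be applied to the Taylor
  coefficients in \<open>u\<close> one by one.\<close>

lemma d2_d1: assumes f: "hol f" shows "d1 (d2 f) = d2 (d1 f)"
proof
  fix b
  let ?f = "\<lambda>x. f (of_coords x)"
  have "d1 (d2 f) b = partial1 (partial2 ?f) (coords b)"
    unfolding d1_def by (rule partial_cong) (simp_all add: d2_def)
  also have "\<dots> = partial2 (partial1 ?f) (coords b)"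
    using f by (intro partial2_partial1[symmetric, OF open_ball_coords]) (simp_all add: hol_iff_holo2)
  also have "\<dots> = d2 (d1 f) b"
    unfolding d2_def by (rule partial_cong) (simp_all add: d1_def)
  finally show "d1 (d2 f) b = d2 (d1 f) b" .
qed

lemma d2_cmult: "hol f \<Longrightarrow> d2 (\<lambda>b. f b / c) b = d2 f b / c"
  using has_dD(2)[OF has_d_mult[OF hol_has_d[of f b] has_d_const[of "inverse c" b]]]
  by (simp add: divide_inverse)

lemma hol_tay_nth [simp]: "hol f \<Longrightarrow> hol (\<lambda>b. fps_nth (tay f b) n)"
proof (induction n arbitrary: f)
  case 0
  then have "(\<lambda>b. fps_nth (tay f b) 0) = rst f" by (simp add: tay_nth_0 fun_eq_iff)
  with 0 show ?case by simp
next
  case (Suc n)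
  from hol_mult[OF Suc.IH[OF hol_d1[OF Suc.prems]] hol_const] show ?case
    by (simp only: tay_nth_Suc[OF Suc.prems] divide_inverse)
qed

lemma tay_d2: "hol f \<Longrightarrow> fps_nth (tay (d2 f) b) n = d2 (\<lambda>b. fps_nth (tay f b) n) b"
proof (induction n arbitrary: f b)
  case 0
  then show ?case by (simp add: tay_nth_0 hol_d2 d2_rst)
next
  case (Suc n)
  have "fps_nth (tay (d2 f) b) (Suc n) = d2 (\<lambda>b. fps_nth (tay (d1 f) b) n) b / of_nat (Suc n)"
    using Suc by (simp add: tay_nth_Suc hol_d2 hol_d1 d2_d1 del: of_nat_Suc)
  also have "\<dots> = d2 (\<lambda>b. fps_nth (tay (d1 f) b) n / of_nat (Suc n)) b"
    using Suc.prems by (simp add: d2_cmult hol_d1 del: of_nat_Suc)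
  finally show ?case using Suc.prems by (simp add: tay_nth_Suc del: of_nat_Suc)
qed

lemma tay_eq_0D:
  assumes "hol f" "tay f b = 0"
  shows "f b = 0"
proof -
  have "(\<lambda>u. f (pt u (snd (coords b)))) has_fps_expansion 0"
    using has_fps_expansion_tay[OF assms(1), of b] assms(2) by simp
  from has_fps_expansion_0_analytic_continuation[OF this holomorphic_on_slice[OF assms(1)]
      open_slice connected_slice zero_in_slice fst_in_slice]
  show ?thesis by simp
qed

text \<open>Comparison of coefficients in \<open>f (c u, v) = d f (u, v)\<close>; it restricts the
  exponents that occur in the expansion of a function equivariant under a reflection.\<close>

lemma tay_scale:
  assumes f: "hol f" and c: "\<And>b. f (pt (c * fst (coords b)) (snd (coords b))) = d * f b"
  shows "c ^ n * fps_nth (tay f b) n = d * fps_nth (tay f b) n"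
proof -
  let ?f = "\<lambda>u. f (pt u (snd (coords b)))"
  have "(\<lambda>u. c * u) has_fps_expansion fps_const c * fps_X"
    by (intro has_fps_expansion_mult has_fps_expansion_const has_fps_expansion_fps_X)
  then have "(?f \<circ> (\<lambda>u. c * u)) has_fps_expansion fps_compose (tay f b) (fps_const c * fps_X)"
    by (intro has_fps_expansion_compose has_fps_expansion_tay f) auto
  moreover have "\<forall>\<^sub>F u in nhds 0. (?f \<circ> (\<lambda>u. c * u)) u = d * ?f u"
  proof (rule eventually_nhds_in_open[OF open_slice zero_in_slice, THEN eventually_mono])
    fix u assume "u \<in> slice b"
    then show "(?f \<circ> (\<lambda>u. c * u)) u = d * ?f u"
      using c[of "pt u (snd (coords b))"] by simp
  qed
  ultimately have "(\<lambda>u. d * ?f u) has_fps_expansion fps_compose (tay f b) (fps_const c * fps_X)"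
    by (rule has_fps_expansion_cong[OF _ refl, THEN iffD1, rotated])
  moreover have "(\<lambda>u. d * ?f u) has_fps_expansion fps_const d * tay f b"
    by (intro has_fps_expansion_cmult_left has_fps_expansion_tay f)
  ultimately have "fps_compose (tay f b) (fps_const c * fps_X) = fps_const d * tay f b"
    by (rule fps_expansion_unique_complex)
  then have "fps_nth (fps_compose (tay f b) (fps_const c * fps_X)) n = fps_nth (fps_const d * tay f b) n" by simp
  then show ?thesis by (simp add: fps_compose_linear)
qed

text \<open>In the absence of zero divisors the product of the functions is not identically zero.
  This provides generic points.\<close>

lemma hol_nonzero_common:
  assumes "finite I" "\<And>i. i \<in> I \<Longrightarrow> hol (f i)" "\<And>i. i \<in> I \<Longrightarrow> \<not> (\<forall>b. f i b = 0)"
  shows "\<exists>b. \<forall>i\<in>I. f i b \<noteq> 0"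
proof -
  have "hol (\<lambda>b. \<Prod>i\<in>I. f i b) \<and> \<not> (\<forall>b. (\<Prod>i\<in>I. f i b) = 0)"
    using assms
  proof (induction I rule: finite_induct)
    case (insert i I)
    then have "hol (f i)" "\<not> (\<forall>b. f i b = 0)" "hol (\<lambda>b. \<Prod>i\<in>I. f i b)" "\<not> (\<forall>b. (\<Prod>i\<in>I. f i b) = 0)"
      by auto
    then show ?case using insert(1,2) hol_mult_eq_0[of "f i" "\<lambda>b. \<Prod>i\<in>I. f i b"] by auto
  qed simp
  then show ?thesis using assms(1) by auto
qed

lemma fps_mult_nth_lowest:
  fixes f g :: "'a::comm_ring_1 fps"
  assumes "\<And>i. i < n \<Longrightarrow> fps_nth f i = 0"
  shows "fps_nth (f * g) n = fps_nth f n * fps_nth g 0" "i < n \<Longrightarrow> fps_nth (f * g) i = 0"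
proof -
  have "fps_nth (f * g) n = (\<Sum>i=0..n. fps_nth f i * fps_nth g (n - i))" by (rule fps_mult_nth)
  also have "\<dots> = (\<Sum>i\<in>{n}. fps_nth f i * fps_nth g (n - i))"
    by (rule sum.mono_neutral_right) (use assms in auto)
  finally show "fps_nth (f * g) n = fps_nth f n * fps_nth g 0" by simp
  show "fps_nth (f * g) i = 0" if "i < n"
    unfolding fps_mult_nth by (rule sum.neutral) (use assms that in auto)
qed

section \<open>The order of vanishing along the mirror\<close>

text \<open>On \<open>u = 0\<close> the function is a power series in \<open>w\<close> alone, with
  limit its constant term at \<open>w = 0\<close>, and \<open>w\<close> tends to 0 as
  \<open>v\<close> tends to minus infinity along the reals.\<close>

lemma FJ_limit:
  assumes "FJ_constant_term (\<lambda>b. [:f b:]) (\<lambda>u. 1)"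
  shows "((\<lambda>t. f (pt 0 (complex_of_real t))) \<longlongrightarrow> 1) at_bot"
proof -
  obtain c where c: "FJ_expansion (\<lambda>b. [:f b:]) c" "c 0 = (\<lambda>u. 1)"
    using assms unfolding FJ_constant_term_def by blast
  define a where "a n = coeff (c n 0) 0" for n
  have a: "(\<lambda>n. a n * exp (of_real (2 * pi) * v / of_real (sqrt 3)) ^ n) sums f (pt 0 v)" if "Re v < 0" for v
  proof -
    have "(0, v) \<in> ball_coords" using that by (simp add: ball_coords_def)
    moreover have "case coords (pt 0 v) of (x, y) \<Rightarrow>
      (\<lambda>n. coeff (c n x) 0 * exp (of_real (2 * pi) * y / of_real (sqrt 3)) ^ n) sums coeff [:f (pt 0 v):] 0"
      by (rule spec[OF spec[OF c(1)[unfolded FJ_expansion_def], of "pt 0 v"], of 0])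
    ultimately show ?thesis by (simp add: a_def)
  qed
  \<comment> \<open>\<open>Ln\<close> merely selects a preimage \<open>v\<close> of
    \<open>w\<close>; the value is the sum of the series in \<open>w\<close> and does not depend on
    the choice.\<close>
  define g where "g w = f (pt 0 (of_real (sqrt 3) / of_real (2 * pi) * Ln w))" for w
  have "(g \<longlongrightarrow> a 0) (at 0)"
  proof (rule powser_limit_0_strong[of 1])
    fix w :: complex assume w: "w \<noteq> 0" "norm w < 1"
    define v where "v = of_real (sqrt 3) / of_real (2 * pi) * Ln w"
    have "Re v = sqrt 3 / (2 * pi) * ln (norm w)"
      using w(1) by (simp add: v_def Re_divide_of_real flip: of_real_divide)
    moreover have "ln (norm w) < 0" using w by simp
    ultimately have "Re v < 0" by (simp add: mult_pos_neg divide_neg_pos)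
    moreover have "of_real (2 * pi) * v / of_real (sqrt 3) = Ln w" by (simp add: v_def)
    ultimately show "(\<lambda>n. a n * w ^ n) sums g w"
      using a[of v] w(1) by (simp add: g_def v_def)
  qed simp
  moreover have "a 0 = 1" by (simp add: a_def c)
  moreover have "filterlim (\<lambda>t. complex_of_real (exp (2 * pi * t / sqrt 3))) (at 0) at_bot"
  proof -
    have "((\<lambda>t. exp (2 * pi * t / sqrt 3)) \<longlongrightarrow> 0) at_bot"
      by (intro filterlim_compose[OF exp_at_bot] ) (real_asymp)
    from tendsto_of_real[OF this] show ?thesis
      by (intro filterlim_atI) auto
  qed
  ultimately have "((\<lambda>t. g (complex_of_real (exp (2 * pi * t / sqrt 3)))) \<longlongrightarrow> 1) at_bot"
    using filterlim_compose by metis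
  moreover have "g (complex_of_real (exp (2 * pi * t / sqrt 3))) = f (pt 0 (complex_of_real t))" for t
    by (simp add: g_def Ln_of_real)
  ultimately show ?thesis by simp
qed

lemma rho_power_mod: "rho ^ n = rho ^ (n mod 3)"
proof -
  have "rho ^ n = (rho ^ 3) ^ (n div 3) * rho ^ (n mod 3)"
    by (metis mult.commute mult_div_mod_eq power_add power_mult)
  then show ?thesis by (simp add: power3_eq_cube rho_cube mult.assoc)
qed

lemma rho_neq: "rho \<noteq> 1" "rho * rho \<noteq> 1"
proof -
  have "Im rho \<noteq> 0" by (simp add: rho_def sqrt_m3_def)
  then show "rho \<noteq> 1" by auto
  have "Im (rho * rho) \<noteq> 0" unfolding rho_sq using \<open>Im rho \<noteq> 0\<close> by simp
  then show "rho * rho \<noteq> 1" by (metis one_complex.sel(2))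
qed

lemma rho_power_eq_1: "rho ^ n = 1 \<Longrightarrow> 3 dvd n"
proof -
  assume "rho ^ n = 1"
  then have "rho ^ (n mod 3) = 1" by (simp flip: rho_power_mod)
  moreover have "n mod 3 = 0 \<or> n mod 3 = 1 \<or> n mod 3 = 2" by auto
  ultimately show ?thesis using rho_neq by (auto simp: power2_eq_square)
qed

text \<open>\<open>refl3\<close> has automorphy factor 1 and determinant \<open>rho\<close>, so it
  multiplies the coefficient of \<open>u ^ i\<close> by \<open>rho ^ i\<close> and the form by
  \<open>rho ^ n\<close>.\<close>

lemma sform_tay:
  assumes "sform k n f" "fps_nth (tay f b) i \<noteq> 0"
  shows "rho ^ i = rho powi n"
proof -
  have "f (pt (rho * fst (coords b)) (snd (coords b))) = rho powi n * f b" for b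
    using assms(1) refl3_Gam unfolding sform_def by (metis act_concrete(1,2,3) mult_1 power_int_1_left)
  then have "rho ^ i * fps_nth (tay f b) i = rho powi n * fps_nth (tay f b) i"
    using assms(1) by (intro tay_scale) (auto simp: sform_def)
  with assms(2) show ?thesis by simp
qed

text \<open>The reflection only allows exponents congruent to 2 modulo 3. This is the vanishing to
  second order along the mirror.\<close>

lemma sform_minus1_tay:
  assumes "sform k (- 1) f" "i < 2"
  shows "fps_nth (tay f b) i = 0"
proof (rule ccontr)
  assume "fps_nth (tay f b) i \<noteq> 0"
  then have "rho ^ i = rho powi (- 1)" using sform_tay assms(1) by blast
  then have "rho ^ (Suc i) = 1" by (simp add: power_int_minus)
  then have "3 dvd Suc i" by (rule rho_power_eq_1)
  with assms(2) show False by (auto dest: dvd_imp_le)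
qed

lemma has_d_partials:
  assumes "hol f" "(u, v) \<in> ball_coords"
  shows "((\<lambda>z. f (pt z v)) has_field_derivative d1 f (pt u v)) (at u)"
    "((\<lambda>z. f (pt u z)) has_field_derivative d2 f (pt u v)) (at v)"
proof -
  have "((\<lambda>x. f (of_coords x)) has_derivative (\<lambda>(s, t). d1 f (pt u v) * s + d2 f (pt u v) * t)) (at (u, v))"
    using hol_has_d[OF assms(1), of "pt u v"] assms(2) by (simp add: has_d_def)
  from has_derivative_imp_partial1[OF this] has_derivative_imp_partial2[OF this]
  show "((\<lambda>z. f (pt z v)) has_field_derivative d1 f (pt u v)) (at u)"
    "((\<lambda>z. f (pt u z)) has_field_derivative d2 f (pt u v)) (at v)" by (simp_all add: pt_def)
qed

lemma half_plane_deriv: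
  assumes "hol f" "Re v < 0"
  shows "((\<lambda>v. f (pt 0 v)) has_field_derivative d2 f (pt 0 v)) (at v)"
  using assms by (intro has_d_partials(2)) (simp_all add: ball_coords_def)

text \<open>The mirror is the half-plane \<open>Re v < 0\<close>. Near a point where
  \<open>g\<close> is non-zero the quotient has derivative zero, and the identity theorem spreads
  the proportionality.\<close>

lemma wronskian_eq_0:
  assumes f: "hol f" and g: "hol g" and W: "\<And>b. rst f b * rst (d2 g) b - rst g b * rst (d2 f) b = 0"
    and g0: "rst g b0 \<noteq> 0"
  obtains q where "\<And>b. rst f b = q * rst g b"
proof -
  define H where "H = {v::complex. Re v < 0}"
  define F G where "F v = f (pt 0 v)" and "G v = g (pt 0 v)" for v
  have H: "open H" "connected H" unfolding H_def
    by (simp add: open_halfspace_Re_lt) (intro convex_connected convex_halfspace_Re_lt)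
  have FH: "F holomorphic_on H" and GH: "G holomorphic_on H"
    unfolding holomorphic_on_def F_def[abs_def] G_def[abs_def] H_def
    using half_plane_deriv[OF f] half_plane_deriv[OF g] field_differentiable_at_within field_differentiable_def by blast+
  define v0 where "v0 = snd (coords b0)"
  have v_in: "snd (coords b) \<in> H" for b
    using zero_in_slice[of b] by (simp add: slice_def ball_coords_def H_def)
  have v0: "v0 \<in> H" "G v0 \<noteq> 0" using v_in g0 by (simp_all add: v0_def G_def rst_def)
  have "continuous_on H G" using GH holomorphic_on_imp_continuous_on by blast
  then have "open (H \<inter> G -` (- {0}))" using H(1) by (intro continuous_open_preimage) auto
  then obtain e where e: "e > 0" "ball v0 e \<subseteq> H \<inter> G -` (- {0})"
    using v0 by (metis ComplI IntI openE singletonD vimageI)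
  have der: "((\<lambda>v. F v / G v) has_field_derivative 0) (at v within ball v0 e)" if v: "v \<in> ball v0 e" for v
  proof -
    have v': "Re v < 0" "G v \<noteq> 0" using e v by (auto simp: H_def)
    then have "(0, v) \<in> ball_coords" by (simp add: ball_coords_def)
    then have "d2 f (pt 0 v) * G v - F v * d2 g (pt 0 v) = 0"
      using W[of "pt 0 v"] by (simp add: rst_def F_def G_def algebra_simps)
    then have "((\<lambda>v. F v / G v) has_field_derivative 0) (at v)"
      using DERIV_divide[OF half_plane_deriv[OF f v'(1)] half_plane_deriv[OF g v'(1)]] v'(2)
      by (simp add: F_def[abs_def] G_def[abs_def])
    then show ?thesis by (rule has_field_derivative_at_within)
  qed
  obtain q where q: "\<And>v. v \<in> ball v0 e \<Longrightarrow> F v / G v = q"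
    using has_field_derivative_zero_constant[OF convex_ball der] by blast
  have e': "ball v0 e \<noteq> {}" "ball v0 e \<subseteq> H" using e by auto
  have "F v = q * G v" if "v \<in> H" for v
  proof (rule analytic_continuation_open[OF open_ball H(1) e'(1) H(2) e'(2) FH _ _ that])
    show "(\<lambda>v. q * G v) holomorphic_on H" using GH by (intro holomorphic_intros)
    show "F v = q * G v" if "v \<in> ball v0 e" for v
      using q[OF that] subsetD[OF e(2) that] by (auto simp: field_simps)
  qed
  then show ?thesis using that[of q] v_in by (simp add: rst_def F_def G_def)
qed

section \<open>The generators and their restrictions to the mirror\<close>

definition xform :: "(picard_ball \<Rightarrow> complex) \<Rightarrow> (picard_ball \<Rightarrow> complex) \<Rightarrow> (picard_ball \<Rightarrow> complex) \<Rightarrow> nat \<Rightarrow> picard_ball \<Rightarrow> complex" where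
  "xform p0 p1 p2 i b = (if i = 1 then p0 b + p1 b + p2 b
     else if i = 2 then - 3 * p0 b + p1 b + p2 b
     else if i = 3 then p0 b - 3 * p1 b + p2 b
     else p0 b + p1 b - 3 * p2 b)"

lemma xform_simps:
  "xform p0 p1 p2 1 b = p0 b + p1 b + p2 b" "xform p0 p1 p2 (Suc 0) b = p0 b + p1 b + p2 b"
  "xform p0 p1 p2 2 b = - 3 * p0 b + p1 b + p2 b"
  "xform p0 p1 p2 3 b = p0 b - 3 * p1 b + p2 b" "xform p0 p1 p2 4 b = p0 b + p1 b - 3 * p2 b"
  by (simp_all add: xform_def)

text \<open>The hypotheses in terms of complex-valued functions. In \<open>surj\<close> the
  polynomial is taken in \<open>p0\<close>, \<open>p1\<close> and \<open>p1 - p2\<close>, and the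
  value \<open>monom (f b) d\<close> records that it is homogeneous of degree \<open>d\<close> along
  the generators. Algebraic independence is recovered in \<open>ev_eq_0\<close> from
  \<open>p12\<close> and the behaviour on the mirror.\<close>

locale picard_generators =
  fixes s :: complex and p0 p1 p2 :: "picard_ball \<Rightarrow> complex"
  assumes s: "s \<in> {1, - 1}"
    and sform_p: "sform 3 0 p0" "sform 3 0 p1" "sform 3 0 p2"
    and FJ: "FJ_constant_term (\<lambda>b. [:p0 b:]) (\<lambda>u. 1)" "FJ_constant_term (\<lambda>b. [:p1 b:]) (\<lambda>u. 1)"
      "FJ_constant_term (\<lambda>b. [:p2 b:]) (\<lambda>u. 1)"
    and surj: "\<And>k f. sform k 0 f \<Longrightarrow> \<not> (\<forall>b. f b = 0) \<Longrightarrow>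
      \<exists>P d. k = 3 * int d \<and> (\<forall>b. ev3 (p0 b) (p1 b) (p1 b - p2 b) P = monom (f b) d)"
    and p12: "\<not> (\<forall>b. p1 b = p2 b)"
    and xform: "\<And>g \<sigma> i b. g \<in> Gam \<Longrightarrow> det g = 1 \<Longrightarrow> induces_perm s g \<sigma> \<Longrightarrow> i \<in> {1..4} \<Longrightarrow>
      sl 3 (matrix_inv g) (xform p0 p1 p2 i) b = of_int (sign \<sigma>) * xform p0 p1 p2 (\<sigma> i) b"
begin

lemma hol_p [simp]: "hol p0" "hol p1" "hol p2"
  using sform_p by (simp_all add: sform_def)

definition f0 where "f0 = (\<lambda>b. p1 b - p2 b)"
definition ev where "ev b P = ev3 (p0 b) (p1 b) (f0 b) P"

lemma sform_f0: "sform 3 0 f0"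
  using sform_add[OF sform_p(2) sform_cmult[OF sform_p(3), of "-1"]] by (simp add: f0_def)

lemma hol_f0 [simp]: "hol f0"
  using sform_f0 by (simp add: sform_def)

lemma f0_nonzero: "\<not> (\<forall>b. f0 b = 0)"
  using p12 by (simp add: f0_def)

lemma ex_poly:
  assumes "sform k 0 f" "\<not> (\<forall>b. f b = 0)"
  obtains P d where "k = 3 * int d" "\<And>b. ev b P = monom (f b) d"
  using surj[OF assms] unfolding ev_def f0_def by blast

text \<open>The sign of the transposition cancels against the factor \<open>(- 1) powi (- 3)\<close>
  that comes from \<open>j1 refl2\<close>.\<close>

lemma xform_refl2:
  assumes "i \<in> {1..4}"
  shows "xform p0 p1 p2 i (act refl2 b) = xform p0 p1 p2 (Transposition.transpose 3 4 i) b"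
  using xform[OF refl2_Gam(1,3) refl2_perm assms, of b]
  by (simp add: sl_def refl2_Gam(2) act_concrete sign_swap_id power_int_minus)

lemma reflection:
  "p0 (pt (- fst (coords b)) (snd (coords b))) = p0 b"
  "p1 (pt (- fst (coords b)) (snd (coords b))) = p2 b"
  "p2 (pt (- fst (coords b)) (snd (coords b))) = p1 b"
proof -
  let ?b = "pt (- fst (coords b)) (snd (coords b))"
  have x: "p0 ?b + p1 ?b + p2 ?b = p0 b + p1 b + p2 b"
    "- 3 * p0 ?b + p1 ?b + p2 ?b = - 3 * p0 b + p1 b + p2 b"
    "p0 ?b - 3 * p1 ?b + p2 ?b = p0 b + p1 b - 3 * p2 b"
    using xform_refl2[of 1 b] xform_refl2[of 2 b] xform_refl2[of 3 b]
    by (simp_all add: act_concrete xform_simps Transposition.transpose_def)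
  have 0: "p0 ?b = p0 b"
  proof -
    have "(p0 ?b + p1 ?b + p2 ?b) - (- 3 * p0 ?b + p1 ?b + p2 ?b) = (p0 b + p1 b + p2 b) - (- 3 * p0 b + p1 b + p2 b)"
      using x by simp
    then show ?thesis by (simp add: algebra_simps)
  qed
  have 1: "p1 ?b = p2 b"
  proof -
    have "(p0 ?b + p1 ?b + p2 ?b) - (p0 ?b - 3 * p1 ?b + p2 ?b) = (p0 b + p1 b + p2 b) - (p0 b + p1 b - 3 * p2 b)"
      using x by simp
    then show ?thesis by (simp add: algebra_simps)
  qed
  show "p0 ?b = p0 b" "p1 ?b = p2 b" "p2 ?b = p1 b"
    using 0 1 x(1) by simp_all
qed

text \<open>\<open>refl2\<close> exchanges \<open>p1\<close> and \<open>p2\<close> and fixes the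
  mirror pointwise.\<close>

lemma rst_p1_p2: "rst p1 b = rst p2 b" "rst f0 b = 0"
proof -
  have "(0, snd (coords b)) \<in> ball_coords" using zero_in_slice[of b] by (simp add: slice_def)
  then show "rst p1 b = rst p2 b"
    using reflection(2)[of "pt 0 (snd (coords b))"] by (simp add: rst_def)
  then show "rst f0 b = 0" by (simp add: f0_def rst_def)
qed

text \<open>The swap of the two cusps on the mirror \<open>u = 0\<close> excludes \<open>x\<^sub>1 = - 3 x\<^sub>2\<close>, which is
  the only linear relation compatible with the constant terms.\<close>

lemma rst_independent:
  assumes lin: "\<And>b. \<alpha> * rst p0 b + \<beta> * rst p1 b = 0"
  shows "\<alpha> = 0" "\<beta> = 0"
proof -
  have neg: "(0, complex_of_real t) \<in> ball_coords" if "t < 0" for t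
    using that by (simp add: ball_coords_def)
  have ev: "\<forall>\<^sub>F t in at_bot. t < (0::real)" by (rule eventually_gt_at_bot)
  \<comment> \<open>Both generators tend to 1 as \<open>v\<close> tends to minus infinity, so the
    coefficients of a linear relation add up to 0.\<close>
  have "((\<lambda>t. \<alpha> * p0 (pt 0 (complex_of_real t)) + \<beta> * p1 (pt 0 (complex_of_real t))) \<longlongrightarrow> \<alpha> * 1 + \<beta> * 1) at_bot"
    by (intro tendsto_intros FJ_limit FJ)
  moreover have "\<forall>\<^sub>F t in at_bot. \<alpha> * p0 (pt 0 (complex_of_real t)) + \<beta> * p1 (pt 0 (complex_of_real t)) = 0"
    using ev
  proof eventually_elim
    case (elim t)
    then show ?case using lin[of "pt 0 (complex_of_real t)"] neg by (simp add: rst_def)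
  qed
  ultimately have "\<alpha> * 1 + \<beta> * 1 = 0"
    using tendsto_unique[OF trivial_limit_at_bot_linorder _ tendsto_eventually] by blast
  then have ab: "\<beta> = - \<alpha>" by (simp add: add_eq_0_iff)
  have "\<alpha> = 0"
  proof (rule ccontr)
    assume "\<alpha> \<noteq> 0"
    then have eq: "rst p0 b = rst p1 b" for b using lin[of b] ab by (simp add: algebra_simps)
    have "rst p0 b = 0" for b
    proof -
      let ?v = "snd (coords b)"
      let ?b = "pt 0 ?v" and ?c = "pt 0 (1 / ?v)"
      have v: "(0, ?v) \<in> ball_coords" "Re ?v < 0"
        using zero_in_slice[of b] by (simp_all add: slice_def ball_coords_def)
      then have v0: "?v \<noteq> 0" by auto
      have "Re (1 / ?v) = Re ?v / (cmod ?v)\<^sup>2" by (simp add: Re_divide cmod_power2)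
      then have c: "(0, 1 / ?v) \<in> ball_coords" using v v0 by (simp add: ball_coords_def divide_neg_pos)
      have x: "(- ?v) powi (- 3) * xform p0 p1 p2 i ?c = - xform p0 p1 p2 (Transposition.transpose 1 2 i) ?b"
        if "i \<in> {1..4}" for i
        using xform[OF swap12_Gam(1,3) swap12_perm that, of ?b] v(1)
        by (simp add: sl_def swap12_Gam(2) act_concrete sign_swap_id)
      have e: "p1 ?b = p0 ?b" "p2 ?b = p0 ?b" "p1 ?c = p0 ?c" "p2 ?c = p0 ?c"
        using eq[of ?b] eq[of ?c] rst_p1_p2(1)[of ?b] rst_p1_p2(1)[of ?c] v(1) c by (simp_all add: rst_def)
      \<comment> \<open>Where the three generators agree, \<open>x_1 = 3 p0\<close> and
        \<open>x_2 = - p0\<close>. Exchanging \<open>x_1\<close> and \<open>x_2\<close> multiplies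
        by 3 in one equation and by 1/3 in the other, which forces \<open>p0 = 9 p0\<close>.\<close>
      have "(- ?v) powi (- 3) * (3 * p0 ?c) = p0 ?b" "(- ?v) powi (- 3) * (- p0 ?c) = - 3 * p0 ?b"
        using x[of 1] x[of 2] by (simp_all add: xform_simps Transposition.transpose_def e)
      then have "p0 ?b = 9 * p0 ?b" by (simp add: algebra_simps)
      then show "rst p0 b = 0" by (simp add: rst_def)
    qed
    then have z: "p0 (pt 0 (complex_of_real t)) = 0" if "t < 0" for t
      using neg[OF that] by (simp add: rst_def) (metis coords_pt snd_conv)
    have "\<forall>\<^sub>F t in at_bot. p0 (pt 0 (complex_of_real t)) = 0"
      using ev by eventually_elim (rule z)
    then have "(1::complex) = 0"
      using tendsto_unique[OF trivial_limit_at_bot_linorder FJ_limit[OF FJ(1)] tendsto_eventually] by blast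
    then show False by simp
  qed
  then show "\<alpha> = 0" "\<beta> = 0" using ab by simp_all
qed

text \<open>The ratio of \<open>rst p0\<close> and \<open>rst p1\<close> takes infinitely many
  values: otherwise the finitely many functions \<open>rst p0 - q * rst p1\<close>, for all values
  \<open>q\<close>, and \<open>rst p1\<close>, each non-zero by linear independence, would have a
  point where none vanishes, which is absurd.\<close>

lemma mirror_poly_eq_0:
  assumes "\<And>b. ev2 (rst p0 b) (rst p1 b) q = 0"
  shows "q = 0"
proof (rule ev2_eq_0[where S = UNIV, OF assms])
  show "infinite {rst p0 b / rst p1 b |b. b \<in> UNIV \<and> rst p1 b \<noteq> 0}" (is "infinite ?Q")
  proof
    assume fin: "finite ?Q"
    define F where "F x b = (case x of None \<Rightarrow> rst p1 b | Some q \<Rightarrow> rst p0 b - q * rst p1 b)" for x b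
    have "\<exists>b. \<forall>x\<in>insert None (Some ` ?Q). F x b \<noteq> 0"
    proof (rule hol_nonzero_common)
      show "hol (F x)" for x unfolding F_def by (cases x) simp_all
      show "\<not> (\<forall>b. F x b = 0)" for x
        using rst_independent[of 0 1] rst_independent[of 1 "- q" for q] by (cases x) (auto simp: F_def)
    qed (use fin in simp)
    then obtain b where b: "\<forall>x\<in>insert None (Some ` ?Q). F x b \<noteq> 0" by blast
    then have "rst p1 b \<noteq> 0" by (simp add: F_def)
    moreover from this have "F (Some (rst p0 b / rst p1 b)) b \<noteq> 0" using b by blast
    ultimately show False by (simp add: F_def)
  qed
qed

lemma ev_mirror:
  assumes "(0, v) \<in> ball_coords"
  shows "ev (pt 0 v) P = ev2 (p0 (pt 0 v)) (p1 (pt 0 v)) (coeff P 0)"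
proof -
  have "f0 (pt 0 v) = 0" using rst_p1_p2(2)[of "pt 0 v"] assms by (simp add: rst_def)
  then show ?thesis by (cases P) (simp add: ev_def ev_pCons)
qed

lemma ev_hom: "ev b 0 = 0" "ev b (P + Q) = ev b P + ev b Q" "ev b (P * Q) = ev b P * ev b Q"
  "ev b (P - Q) = ev b P - ev b Q" "ev b (P ^ n) = ev b P ^ n" "ev b (- P) = - ev b P"
  by (simp_all add: ev_def ev3_hom)

lemma ev_gens: "ev b PX = [:0, p0 b:]" "ev b PY = [:0, p1 b:]" "ev b PZ = [:0, f0 b:]"
  by (simp_all add: ev_def)

lemma hol_poly_ev [simp]: "hol (\<lambda>b. poly (ev b P) t)"
  unfolding ev_def by (intro hol_poly_ev3 sform_p sform_f0)

lemma sform_coeff_ev: "sform (3 * int n) 0 (\<lambda>b. coeff (ev b P) n)"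
  unfolding ev_def by (intro sform_coeff_ev3 sform_p sform_f0)

text \<open>Induction on the powers of \<open>PZ\<close>: on the mirror only the coefficient of
  \<open>PZ ^ 0\<close> survives and must vanish, after which \<open>f0\<close> can be
  cancelled.\<close>

lemma ev_eq_0:
  assumes "\<And>b. ev b P = 0"
  shows "P = 0"
  using assms
proof (induction P)
  case (pCons q P)
  have "ev2 (rst p0 b) (rst p1 b) q = 0" for b
  proof -
    have "(0, snd (coords b)) \<in> ball_coords" using zero_in_slice[of b] by (simp add: slice_def)
    from ev_mirror[OF this, of "pCons q P"] show ?thesis using pCons.prems by (simp add: rst_def)
  qed
  then have q: "q = 0" by (rule mirror_poly_eq_0)
  have "ev b P = 0" for b
  proof -
    have "f0 b * poly (ev b P) t = 0" if "t \<noteq> 0" for b t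
    proof -
      have "[:0, f0 b:] * ev b P = 0" using pCons.prems[of b] by (simp add: ev_def ev_pCons q)
      then have "poly ([:0, f0 b:] * ev b P) t = 0" by (simp only: poly_0)
      then show ?thesis using that by (simp del: mult_pCons_left)
    qed
    then have "poly (ev b P) t = 0" if "t \<noteq> 0" for t
      using hol_mult_eq_0[of f0 "\<lambda>b. poly (ev b P) t"] f0_nonzero that by auto
    then show ?thesis
      by (intro poly_eq_0_if_infinite[OF infinite_nonzero_complex]) auto
  qed
  then show ?case using pCons.IH q by simp
qed simp

text \<open>The determinant with rows \<open>p_i\<close>, \<open>d1 p_i\<close> and
  \<open>d2 p_i\<close>.\<close>

definition jac :: "picard_ball \<Rightarrow> complex" where
  "jac b = p0 b * (d1 p1 b * d2 p2 b - d1 p2 b * d2 p1 b) - p1 b * (d1 p0 b * d2 p2 b - d1 p2 b * d2 p0 b)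
    + p2 b * (d1 p0 b * d2 p1 b - d1 p1 b * d2 p0 b)"

lemma hol_jac [simp]: "hol jac"
  unfolding jac_def[abs_def] by (simp add: hol_d1 hol_d2)

lemma p0_nonzero: "\<not> (\<forall>b. p0 b = 0)"
  using rst_independent[of 1 0] by (auto simp: rst_def)

text \<open>\<open>p0 * jac\<close> is the wedge of two brackets of weight 7 and so has weight
  \<open>7 + 7 + 1 = 15\<close>; division by \<open>p0\<close> leaves 12.\<close>

lemma sform_jac: "sform 12 (- 1) jac"
proof (rule sform_quotient[OF sform_p(1) p0_nonzero hol_jac])
  have "(\<lambda>b. p0 b * jac b) = (\<lambda>b. bracket1 p2 p0 b * bracket2 p0 p1 b - bracket2 p2 p0 b * bracket1 p0 p1 b)"
    by (simp add: fun_eq_iff jac_def bracket1_def bracket2_def algebra_simps)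
  then show "sform (3 + 12) (0 + - 1) (\<lambda>b. p0 b * jac b)"
    using sform_wedge[OF vform_bracket[OF sform_p(3,1)] vform_bracket[OF sform_p(1,2)]] by simp
qed

text \<open>\<open>refl2\<close> changes the sign of \<open>f0\<close> and \<open>refl3\<close>
  leaves it invariant. Oddness excludes the order zero.\<close>

lemma tay_f0_odd:
  assumes "fps_nth (tay f0 b) n \<noteq> 0"
  shows "odd n" "3 dvd n"
proof -
  have "(- 1) ^ n * fps_nth (tay f0 b) n = (- 1) * fps_nth (tay f0 b) n"
  proof (rule tay_scale)
    show "f0 (pt (- 1 * fst (coords b)) (snd (coords b))) = - 1 * f0 b" for b
      using reflection[of b] by (simp add: f0_def)
  qed simp
  then show "odd n" using assms by (cases "even n") auto
  show "3 dvd n" using sform_tay[OF sform_f0 assms] by (intro rho_power_eq_1) simp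
qed

text \<open>The generic order along the mirror: at special points the order may be larger, so the
  least one is taken.\<close>

definition ord_f0 :: nat where "ord_f0 = (LEAST n. \<exists>b. fps_nth (tay f0 b) n \<noteq> 0)"

lemma ord_f0: "\<exists>b. fps_nth (tay f0 b) ord_f0 \<noteq> 0" "n < ord_f0 \<Longrightarrow> fps_nth (tay f0 b) n = 0"
proof -
  have "\<exists>n b. fps_nth (tay f0 b) n \<noteq> 0"
  proof (rule ccontr)
    assume "\<not> ?thesis"
    then have "tay f0 b = 0" for b by (simp add: fps_eq_iff)
    then show False using f0_nonzero tay_eq_0D[OF hol_f0] by blast
  qed
  then show "\<exists>b. fps_nth (tay f0 b) ord_f0 \<noteq> 0" unfolding ord_f0_def by (rule LeastI_ex)
  show "n < ord_f0 \<Longrightarrow> fps_nth (tay f0 b) n = 0" unfolding ord_f0_def using not_less_Least by blast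
qed

definition wronskian :: "picard_ball \<Rightarrow> complex" where
  "wronskian b = rst p0 b * rst (d2 p1) b - rst p1 b * rst (d2 p0) b"

lemma hol_wronskian [simp]: "hol wronskian"
  unfolding wronskian_def[abs_def] by (simp add: hol_d2)

lemma wronskian_nonzero: "\<not> (\<forall>b. wronskian b = 0)"
proof
  assume "\<forall>b. wronskian b = 0"
  then have W: "\<And>b. rst p0 b * rst (d2 p1) b - rst p1 b * rst (d2 p0) b = 0" by (simp add: wronskian_def)
  obtain b0 where "rst p1 b0 \<noteq> 0" using rst_independent(2)[of 0 1] by auto
  then obtain q where "\<And>b. rst p0 b = q * rst p1 b"
    using wronskian_eq_0[OF hol_p(1,2) W] by blast
  then show False using rst_independent(1)[of 1 "- q"] by simp
qed

text \<open>In terms of \<open>f0\<close> and the sum \<open>B\<close> of \<open>p1\<close> and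
  \<open>p2\<close>, each term of the Jacobian contains \<open>f0\<close> or one of its derivatives.
  Of these only \<open>d1 f0\<close> has lower order, and its cofactor \<open>X\<close> restricts to
  the Wronskian of \<open>p0\<close> and \<open>p1\<close>.\<close>

lemma tay_jac:
  assumes "n < ord_f0"
  shows "fps_nth (tay jac b) n = of_nat (Suc n) * fps_nth (tay f0 b) (Suc n) * wronskian b"
    and "n < ord_f0 - 1 \<Longrightarrow> fps_nth (tay jac b) n = 0"
proof -
  define B where "B = (\<lambda>b. p1 b + p2 b)"
  have hB [simp]: "hol B" by (simp add: B_def)
  have dB: "d1 B b = d1 p1 b + d1 p2 b" "d2 B b = d2 p1 b + d2 p2 b" for b
    using has_dD[OF has_d_add[OF hol_has_d[of p1 b] hol_has_d[of p2 b]]] by (simp_all add: B_def)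
  have df: "d1 f0 b = d1 p1 b - d1 p2 b" "d2 f0 b = d2 p1 b - d2 p2 b" for b
    using has_dD[OF has_d_diff[OF hol_has_d[of p1 b] hol_has_d[of p2 b]]] by (simp_all add: f0_def)
  define X where "X b = (p0 b * d2 B b - B b * d2 p0 b) / 2" for b
  define Y where "Y b = (p0 b * d1 B b - B b * d1 p0 b) / 2" for b
  define Z where "Z b = (d1 p0 b * d2 B b - d2 p0 b * d1 B b) / 2" for b
  have hX: "hol X" "hol Y" "hol Z"
    unfolding X_def[abs_def] Y_def[abs_def] Z_def[abs_def] divide_inverse
    by (intro hol_mult hol_diff hol_d1 hol_d2 hol_p hB hol_const)+
  have "jac = (\<lambda>b. d1 f0 b * X b - d2 f0 b * Y b - f0 b * Z b)"
    by (simp add: fun_eq_iff jac_def X_def Y_def Z_def dB df) (simp add: f0_def B_def field_simps)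
  then have tj: "tay jac b = fps_deriv (tay f0 b) * tay X b - tay (d2 f0) b * tay Y b - tay f0 b * tay Z b"
    using hX by (simp add: tay_diff tay_mult tay_d1 hol_d1 hol_d2)
  have z1: "fps_nth (tay f0 b) i = 0" if "i < ord_f0" for i b using ord_f0(2)[OF that] .
  have z2: "fps_nth (tay (d2 f0) b) i = 0" if "i < ord_f0" for i
  proof -
    have "fps_nth (tay (d2 f0) b) i = d2 (\<lambda>b. 0) b" using z1[OF that] by (simp add: tay_d2)
    also have "\<dots> = 0" by (rule has_dD(2)[OF has_d_const])
    finally show ?thesis .
  qed
  have z3: "fps_nth (fps_deriv (tay f0 b)) i = 0" if "i < ord_f0 - 1" for i
    using z1[of "Suc i"] that by simp
  have rX: "rst X b = wronskian b"
  proof -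
    have "rst (d2 f0) b = d2 (\<lambda>b. 0) b" using rst_p1_p2(2) by (simp flip: d2_rst add: ext[of "rst f0" "\<lambda>b. 0"])
    also have "\<dots> = 0" by (rule has_dD(2)[OF has_d_const])
    finally have "rst (d2 p1) b = rst (d2 p2) b" by (simp add: df rst_def)
    then show ?thesis using rst_p1_p2(1)[of b]
      by (simp add: rst_def X_def wronskian_def dB) (simp add: B_def)
  qed
  have a: "fps_nth (tay (d2 f0) b * tay Y b) n = 0" "fps_nth (tay f0 b * tay Z b) n = 0"
    using fps_mult_nth_lowest(2)[of ord_f0] z1 z2 assms by blast+
  show "n < ord_f0 - 1 \<Longrightarrow> fps_nth (tay jac b) n = 0"
    using a fps_mult_nth_lowest(2)[of "ord_f0 - 1" "fps_deriv (tay f0 b)" n "tay X b"] z3 by (simp add: tj)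
  show "fps_nth (tay jac b) n = of_nat (Suc n) * fps_nth (tay f0 b) (Suc n) * wronskian b"
    using a fps_mult_nth_lowest(1)[of n "fps_deriv (tay f0 b)" "tay X b"] z3 assms
    by (simp add: tj tay_nth_0 hX rX)
qed

lemma ord_f0_pos: "ord_f0 > 0"
  using tay_f0_odd(1) ord_f0(1) by (metis even_zero gr0I)

lemma tay_jac_leading: "fps_nth (tay jac b) (ord_f0 - 1) = of_nat ord_f0 * fps_nth (tay f0 b) ord_f0 * wronskian b"
  using tay_jac(1)[of "ord_f0 - 1" b] ord_f0_pos by simp

text \<open>The leading coefficients of \<open>f0\<close> and \<open>jac\<close> are holomorphic and
  not identically zero, so a point can be chosen where both orders are generic and \<open>h\<close>
  does not vanish.\<close>

lemma ord_f0_generic: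
  assumes "hol h" "\<not> (\<forall>b. h b = 0)"
  obtains b where "h b \<noteq> 0" "subdegree (tay f0 b) = ord_f0" "subdegree (tay jac b) = ord_f0 - 1"
    "tay f0 b \<noteq> 0" "tay jac b \<noteq> 0"
proof -
  define F where "F i b = (if i = (0::nat) then h b else if i = 1 then fps_nth (tay f0 b) ord_f0 else wronskian b)" for i b
  have "\<exists>b. \<forall>i\<in>{0, 1, 2}. F i b \<noteq> 0"
  proof (rule hol_nonzero_common)
    fix i :: nat assume "i \<in> {0, 1, 2}"
    then show "hol (F i)" "\<not> (\<forall>b. F i b = 0)"
      using assms ord_f0(1) wronskian_nonzero by (auto simp: F_def[abs_def])
  qed simp
  then obtain b where b: "h b \<noteq> 0" "fps_nth (tay f0 b) ord_f0 \<noteq> 0" "wronskian b \<noteq> 0"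
    by (auto simp: F_def)
  have 1: "subdegree (tay f0 b) = ord_f0"
    by (rule subdegreeI) (use b ord_f0(2) in auto)
  have "fps_nth (tay jac b) (ord_f0 - 1) \<noteq> 0" using b ord_f0_pos by (simp add: tay_jac_leading del: One_nat_def)
  then have 2: "subdegree (tay jac b) = ord_f0 - 1"
    using tay_jac(2) by (intro subdegreeI) auto
  show ?thesis
    by (rule that[OF b(1) 1 2]) (use b ord_f0_pos tay_jac_leading[of b] in auto)
qed

lemma jac_nonzero: "\<not> (\<forall>b. jac b = 0)"
proof
  assume z: "\<forall>b. jac b = 0"
  obtain b where b: "tay jac b \<noteq> 0" using ord_f0_generic[of "\<lambda>_. 1"] by auto
  have "jac = (\<lambda>b. 0)" using z by auto
  then show False using b tay_const[of 0 b] by simp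
qed

lemma sform_cube: "sform k (- 1) f \<Longrightarrow> sform (3 * k) 0 (\<lambda>b. f b ^ 3)"
  using sform_det_cube[of "k + k + k" "\<lambda>b. f b * f b * f b"] sform_mult[OF sform_mult, of k "-1" f k "-1" f k "-1" f]
  by (simp add: power3_eq_cube)

text \<open>A third power of the Jacobian is a polynomial in the generators, so its order along the mirror
  is a multiple of the order \<open>m\<close> of \<open>f0\<close>; but it equals \<open>3 (m - 1)\<close>.\<close>

lemma ord_f0_eq: "ord_f0 = 3"
proof -
  have nz: "\<not> (\<forall>b. jac b ^ 3 = 0)" using jac_nonzero by simp
  obtain P d where P: "\<And>b. ev b P = monom (jac b ^ 3) d"
    using ex_poly[OF sform_cube[OF sform_jac] nz] by metis
  have "P \<noteq> 0"
  proof
    assume "P = 0"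
    then show False using P nz by (metis ev_hom(1) monom_eq_0_iff)
  qed
  \<comment> \<open>All factors \<open>PZ\<close> are split off; what remains does not vanish
    identically on the mirror.\<close>
  then obtain Q where Q: "P = [:- 0, 1:] ^ order 0 P * Q" "\<not> [:- 0, 1:] dvd Q"
    using order_decomp by blast
  define e where "e = order 0 P"
  have PQ: "P = PZ ^ e * Q" using Q(1) by (simp add: PZ_def e_def)
  have "coeff Q 0 \<noteq> 0" using Q(2) dvd_linear_iff[of 0 Q] by (simp add: poly_0_coeff_0)
  then obtain b0 where b0: "ev2 (rst p0 b0) (rst p1 b0) (coeff Q 0) \<noteq> 0" using mirror_poly_eq_0 by blast
  \<comment> \<open>\<open>ev\<close> has polynomial values; evaluation at a suitable
    \<open>t\<close> turns the identity into one of functions, with \<open>Q\<close> still non-zero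
    on the mirror.\<close>
  obtain t where t: "t \<noteq> 0" "poly (ev2 (rst p0 b0) (rst p1 b0) (coeff Q 0)) t \<noteq> 0"
    using poly_eq_0_if_infinite[OF infinite_nonzero_complex] b0 by blast
  define R where "R b = poly (ev b Q) t" for b
  have hR: "hol R" by (simp add: R_def[abs_def])
  have "rst R b0 = poly (ev2 (rst p0 b0) (rst p1 b0) (coeff Q 0)) t"
    using zero_in_slice[of b0] by (simp add: rst_def R_def slice_def ev_mirror)
  with t(2) have "\<not> (\<forall>b. rst R b = 0)" by metis
  then obtain b where b: "rst R b \<noteq> 0" "subdegree (tay f0 b) = ord_f0" "subdegree (tay jac b) = ord_f0 - 1"
    "tay f0 b \<noteq> 0" "tay jac b \<noteq> 0"
    using ord_f0_generic hol_rst[OF hR] by blast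
  have "t ^ d * jac b ^ 3 = t ^ e * (f0 b ^ e * R b)" for b
  proof -
    have "poly (ev b P) t = poly (monom (jac b ^ 3) d) t" by (simp only: P)
    then show ?thesis by (simp add: PQ ev_hom ev_gens R_def poly_monom poly_power power_mult_distrib mult_ac)
  qed
  then have "(\<lambda>b. t ^ d * jac b ^ 3) = (\<lambda>b. t ^ e * (f0 b ^ e * R b))" by blast
  then have "tay (\<lambda>b. t ^ d * jac b ^ 3) b = tay (\<lambda>b. t ^ e * (f0 b ^ e * R b)) b" by simp
  then have eq: "fps_const (t ^ d) * tay jac b ^ 3 = fps_const (t ^ e) * (tay f0 b ^ e * tay R b)"
    by (simp add: tay_mult tay_power tay_const hR)
  have R: "subdegree (tay R b) = 0" "tay R b \<noteq> 0"
    using b(1) tay_nth_0[OF hR, of b] by (auto simp: subdegree_eq_0_iff)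
  have "subdegree (fps_const (t ^ d) * tay jac b ^ 3) = 3 * (ord_f0 - 1)"
    using t(1) b by simp
  moreover have "subdegree (fps_const (t ^ e) * (tay f0 b ^ e * tay R b)) = e * ord_f0"
    using t(1) b R by simp
  ultimately have m: "3 * (ord_f0 - 1) = e * ord_f0" using eq by simp
  have m3: "3 dvd ord_f0" using tay_f0_odd(2) ord_f0(1) by blast
  \<comment> \<open>The order divides \<open>3 * ord_f0\<close> and \<open>3 * ord_f0 - 3\<close>,
    hence their difference 3.\<close>
  have "ord_f0 dvd 3 * ord_f0 - 3" using m by (simp add: diff_mult_distrib2)
  from dvd_diff_nat[OF dvd_triv_right[of ord_f0 3] this]
  have "ord_f0 dvd 3 * ord_f0 - (3 * ord_f0 - 3)" .
  moreover have "3 * ord_f0 - (3 * ord_f0 - 3) = 3" using ord_f0_pos by simp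
  ultimately have "ord_f0 dvd 3" by simp
  with m3 show ?thesis by (rule dvd_antisym[rotated])
qed

end

section \<open>Divisibility by the Jacobian\<close>

lemma fps_mult_nth_low:
  fixes f g :: "'a::comm_ring_1 fps"
  assumes "\<And>i. i < m \<Longrightarrow> fps_nth f i = 0" "\<And>i. i < n \<Longrightarrow> fps_nth g i = 0" "k < m + n"
  shows "fps_nth (f * g) k = 0"
  unfolding fps_mult_nth
proof (rule sum.neutral, rule ballI)
  fix i assume "i \<in> {0..k}"
  then have "i < m \<or> k - i < n" using assms(3) by auto
  then show "fps_nth f i * fps_nth g (k - i) = 0" using assms(1,2) by auto
qed

context picard_generators
begin

text \<open>Quantifying over all triples makes the property invariant under \<open>Gam\<close>. The
  quotient is only asked to be holomorphic, since its transformation law follows by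
  cancellation.\<close>

definition sq_divides :: "(picard_ball \<Rightarrow> complex) \<Rightarrow> bool" where
  "sq_divides l \<longleftrightarrow> (\<forall>k1 k2 k3 G1 G2 G3.
     sform k1 (- 1) G1 \<longrightarrow> sform k2 (- 1) G2 \<longrightarrow> sform k3 (- 1) G3 \<longrightarrow>
     (\<exists>T. hol T \<and> (\<forall>b. G1 b * G2 b * G3 b = l b ^ 2 * T b)))"

lemma sform_triple:
  "sform k1 (- 1) G1 \<Longrightarrow> sform k2 (- 1) G2 \<Longrightarrow> sform k3 (- 1) G3 \<Longrightarrow>
    sform (k1 + k2 + k3) 0 (\<lambda>b. G1 b * G2 b * G3 b)"
  using sform_det_cube[of "k1 + k2 + k3" "\<lambda>b. G1 b * G2 b * G3 b"]
    sform_mult[OF sform_mult, of k1 "-1" G1 k2 "-1" G2 k3 "-1" G3] by simp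

text \<open>Each \<open>Gi\<close> vanishes to second order along the mirror, hence the product to sixth order, while
  \<open>f0\<close> vanishes exactly to third order.\<close>

lemma sq_divides_f0: "sq_divides f0"
  unfolding sq_divides_def
proof (intro allI impI)
  fix k1 k2 k3 G1 G2 G3
  assume G: "sform k1 (- 1) G1" "sform k2 (- 1) G2" "sform k3 (- 1) G3"
  define S where "S b = G1 b * G2 b * G3 b" for b
  have hG: "hol G1" "hol G2" "hol G3" using G by (simp_all add: sform_def)
  then have hS: "hol S" by (simp add: S_def[abs_def])
  have S: "sform (k1 + k2 + k3) 0 S" unfolding S_def[abs_def] by (rule sform_triple[OF G])
  have tS: "fps_nth (tay S b) n = 0" if "n < 6" for n b
  proof -
    have 1: "fps_nth (tay G1 b * tay G2 b) i = 0" if "i < 4" for i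
      by (rule fps_mult_nth_low[where m = 2 and n = 2]) (use that sform_minus1_tay G in auto)
    have "fps_nth (tay G1 b * tay G2 b * tay G3 b) n = 0"
      by (rule fps_mult_nth_low[where m = 4 and n = 2]) (use that 1 sform_minus1_tay G in auto)
    then show ?thesis using hG by (simp add: S_def[abs_def] tay_mult)
  qed
  show "\<exists>T. hol T \<and> (\<forall>b. G1 b * G2 b * G3 b = f0 b ^ 2 * T b)"
  proof (cases "\<forall>b. S b = 0")
    case True
    then show ?thesis by (intro exI[of _ "\<lambda>b. 0"]) (auto simp: S_def)
  next
    case False
    obtain P d where P: "\<And>b. ev b P = monom (S b) d" using ex_poly[OF S False] by metis
    \<comment> \<open>With \<open>P = a + PZ * (c + PZ * P2)\<close>, divisibility by
      \<open>PZ ^ 2\<close> amounts to the vanishing of \<open>a\<close> and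
      \<open>c\<close>.\<close>
    obtain a P1 where P1: "P = pCons a P1" by (cases P)
    obtain c P2 where P2: "P1 = pCons c P2" by (cases P1)
    have m: "(0, snd (coords b)) \<in> ball_coords" for b
      using zero_in_slice[of b] by (simp add: slice_def)
    have "ev2 (rst p0 b) (rst p1 b) a = 0" for b
    proof -
      have "ev (pt 0 (snd (coords b))) P = monom (rst S b) d" by (simp add: P rst_def)
      also have "rst S b = 0" using tS[of 0 b] hS by (simp add: tay_nth_0)
      finally show ?thesis using ev_mirror[OF m, of b P] by (simp add: P1 rst_def)
    qed
    then have a: "a = 0" by (rule mirror_poly_eq_0)
    have evP: "ev b P = [:0, f0 b:] * (ev2 (p0 b) (p1 b) c + [:0, f0 b:] * ev b P2)" for b
      by (simp only: P1 P2 a ev_def ev_pCons ev_0 add_0)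
    have "ev2 (rst p0 b) (rst p1 b) c = 0" for b
    proof (rule poly_eq_0_if_infinite[OF infinite_nonzero_complex])
      fix t :: complex assume "t \<in> - {0}"
      then have t: "t \<noteq> 0" by simp
      define C where "C b = poly (ev2 (p0 b) (p1 b) c) t" for b
      define R where "R b = poly (ev b P2) t" for b
      have hC: "hol C" "hol R"
        unfolding C_def[abs_def] R_def[abs_def] by (rule hol_poly_ev2[OF sform_p(1,2) sform_f0], rule hol_poly_ev)
      define H where "H b = C b + t * (f0 b * R b)" for b
      have hH: "hol H" using hC by (simp add: H_def[abs_def])
      have "t ^ d * S b = t * (f0 b * H b)" for b
      proof -
        have "poly (monom (S b) d) t = poly ([:0, f0 b:] * (ev2 (p0 b) (p1 b) c + [:0, f0 b:] * ev b P2)) t"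
          by (simp only: P[symmetric] evP)
        then show ?thesis by (simp add: poly_monom C_def R_def H_def algebra_simps del: mult_pCons_left)
      qed
      then have "(\<lambda>b. t ^ d * S b) = (\<lambda>b. t * (f0 b * H b))" by blast
      then have "tay (\<lambda>b. t ^ d * S b) b = tay (\<lambda>b. t * (f0 b * H b)) b" for b by simp
      then have eq: "fps_const (t ^ d) * tay S b = fps_const t * (tay f0 b * tay H b)" for b
        by (simp add: tay_mult tay_const hS hH)
      \<comment> \<open>The coefficient of \<open>u ^ 3\<close> in \<open>f0 * H\<close> is the
        leading coefficient of \<open>f0\<close> times the restriction of \<open>C\<close>, while
        \<open>S\<close> vanishes to sixth order.\<close>
      have "fps_nth (tay f0 b) 3 * rst C b = 0" for b
      proof -
        have "rst H b = rst C b" using rst_p1_p2(2)[of b] by (simp add: H_def rst_def)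
        moreover have "fps_nth (tay f0 b * tay H b) 3 = fps_nth (tay f0 b) 3 * fps_nth (tay H b) 0"
          by (rule fps_mult_nth_lowest(1)) (use ord_f0(2) ord_f0_eq in auto)
        moreover have "fps_nth (fps_const (t ^ d) * tay S b) 3 = 0" using tS[of 3 b] by simp
        ultimately show ?thesis using t hH by (simp add: eq tay_nth_0)
      qed
      moreover have "\<not> (\<forall>b. fps_nth (tay f0 b) 3 = 0)" using ord_f0(1) ord_f0_eq by simp
      ultimately have "rst C b = 0"
        using hol_mult_eq_0[of "\<lambda>b. fps_nth (tay f0 b) 3" "rst C"] hC by auto
      then show "poly (ev2 (rst p0 b) (rst p1 b) c) t = 0" by (simp add: C_def rst_def)
    qed
    then have c: "c = 0" by (rule mirror_poly_eq_0)
    have "S b = f0 b ^ 2 * poly (ev b P2) 1" for b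
    proof -
      have "poly (monom (S b) d) 1 = poly ([:0, f0 b:] * (ev2 (p0 b) (p1 b) c + [:0, f0 b:] * ev b P2)) 1"
        by (simp only: P[symmetric] evP)
      then show ?thesis by (simp add: poly_monom c power2_eq_square del: mult_pCons_left)
    qed
    then show ?thesis by (intro exI[of _ "\<lambda>b. poly (ev b P2) 1"]) (simp add: S_def)
  qed
qed

text \<open>The hypothesis is applied to the translates of the \<open>G_i\<close> by the inverse of
  \<open>g\<close>, which have the same character, and the resulting identity is moved back by
  \<open>g\<close>.\<close>

lemma sq_divides_sl:
  assumes g: "g \<in> Gam" and l: "sq_divides l"
  shows "sq_divides (sl 3 g l)"
  unfolding sq_divides_def
proof (intro allI impI)
  fix k1 k2 k3 G1 G2 G3
  assume G: "sform k1 (- 1) G1" "sform k2 (- 1) G2" "sform k3 (- 1) G3"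
  obtain g' where g': "g' \<in> Gam" "g' ** g = mat 1" using Gam_inverse[OF g] by metis
  obtain T where T: "hol T" "\<And>b. sl k1 g' G1 b * sl k2 g' G2 b * sl k3 g' G3 b = l b ^ 2 * T b"
    using l[unfolded sq_divides_def, rule_format, OF sform_sl[OF g'(1) G(1)] sform_sl[OF g'(1) G(2)] sform_sl[OF g'(1) G(3)]]
    by blast
  let ?K = "k1 + k2 + k3"
  \<comment> \<open>The quotient carries the weight of the product minus 6, the weight of the square
    of \<open>l\<close>.\<close>
  have "G1 b * G2 b * G3 b = sl 3 g l b ^ 2 * (j1 g b powi (6 - ?K) * T (act g b))" for b
  proof -
    have j: "j1 g b \<noteq> 0" using g by simp
    have "j1 g' (act g b) * j1 g b = 1" "act g' (act g b) = b"
      using j1_act_mult[OF g'(1) g, of b] g'(2) by simp_all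
    then have e: "j1 g' (act g b) = inverse (j1 g b)" "act g' (act g b) = b"
      using j by (simp_all add: field_simps)
    have e': "sl k g' G (act g b) = j1 g b powi k * G b" for k G
      by (simp add: sl_def e power_int_inverse power_int_minus)
    have K: "j1 g b powi ?K = j1 g b powi k1 * j1 g b powi k2 * j1 g b powi k3"
      using j by (simp only: power_int_add simp_thms)
    have "(j1 g b powi k1 * G1 b) * (j1 g b powi k2 * G2 b) * (j1 g b powi k3 * G3 b)
      = l (act g b) ^ 2 * T (act g b)"
      using T(2)[of "act g b"] by (simp only: e')
    then have "j1 g b powi ?K * (G1 b * G2 b * G3 b) = l (act g b) ^ 2 * T (act g b)"
      unfolding K by (simp only: mult_ac)
    then have "G1 b * G2 b * G3 b = j1 g b powi (- ?K) * (l (act g b) ^ 2 * T (act g b))"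
      unfolding power_int_minus using j by (simp add: field_simps)
    also have "j1 g b powi (- ?K) = (j1 g b powi (- 3)) ^ 2 * j1 g b powi (6 - ?K)"
    proof -
      have "- ?K = - 3 + - 3 + (6 - ?K)" by simp
      then have "j1 g b powi (- ?K) = j1 g b powi (- 3 + - 3 + (6 - ?K))" by (rule arg_cong)
      also have "\<dots> = (j1 g b powi (- 3)) ^ 2 * j1 g b powi (6 - ?K)"
        using j by (simp only: power_int_add power2_eq_square simp_thms)
      finally show ?thesis .
    qed
    finally show ?thesis by (simp add: sl_def power_mult_distrib mult_ac)
  qed
  moreover have "hol (\<lambda>b. j1 g b powi (6 - ?K) * T (act g b))"
    using T(1) g by (intro hol_mult hol_powi hol_compose_act) auto
  ultimately show "\<exists>T. hol T \<and> (\<forall>b. G1 b * G2 b * G3 b = sl 3 g l b ^ 2 * T b)" by blast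
qed

lemma sq_divides_scale:
  assumes "sq_divides (\<lambda>b. c * l b)"
  shows "sq_divides l"
  unfolding sq_divides_def
proof (intro allI impI)
  fix k1 k2 k3 G1 G2 G3
  assume "sform k1 (- 1) G1" "sform k2 (- 1) G2" "sform k3 (- 1) G3"
  then obtain T where "hol T" "\<And>b. G1 b * G2 b * G3 b = (c * l b) ^ 2 * T b"
    using assms unfolding sq_divides_def by blast
  then show "\<exists>T. hol T \<and> (\<forall>b. G1 b * G2 b * G3 b = l b ^ 2 * T b)"
    by (intro exI[of _ "\<lambda>b. c ^ 2 * T b"]) (simp add: power_mult_distrib mult_ac)
qed

section \<open>Transport of the divisibility to all six lines\<close>

definition xdiff :: "nat \<Rightarrow> nat \<Rightarrow> picard_ball \<Rightarrow> complex" where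
  "xdiff i j b = xform p0 p1 p2 i b - xform p0 p1 p2 j b"

lemma sq_divides_xdiff_perm:
  assumes "g \<in> Gam" "det g = 1" "induces_perm s g \<sigma>" "i \<in> {1..4}" "j \<in> {1..4}" "sq_divides (xdiff i j)"
  shows "sq_divides (xdiff (\<sigma> i) (\<sigma> j))"
proof -
  have "sl 3 (matrix_inv g) (xdiff i j) b = of_int (sign \<sigma>) * xdiff (\<sigma> i) (\<sigma> j) b" for b
    using xform[OF assms(1-3), of i b] xform[OF assms(1-3), of j b] assms(4,5)
    by (simp add: sl_def xdiff_def right_diff_distrib)
  then have "sl 3 (matrix_inv g) (xdiff i j) = (\<lambda>b. of_int (sign \<sigma>) * xdiff (\<sigma> i) (\<sigma> j) b)" by blast
  then show ?thesis
    using sq_divides_sl[OF Gam_matrix_inv(1)[OF assms(1)] assms(6)] sq_divides_scale by metis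
qed

definition line :: "nat \<Rightarrow> picard_ball \<Rightarrow> complex" where
  "line i b = [p0 b, p1 b, p1 b - p0 b, f0 b, f0 b - p1 b, f0 b - p1 b + p0 b] ! i"

lemma line_simps: "line 0 b = p0 b" "line 1 b = p1 b" "line 2 b = p1 b - p0 b" "line 3 b = f0 b"
  "line 4 b = f0 b - p1 b" "line 5 b = f0 b - p1 b + p0 b"
  by (simp_all add: line_def)

lemma ev_line: "i < 6 \<Longrightarrow> ev b (line_poly i) = [:0, line i b:]"
  by (drule less_6_cases) (elim disjE; simp only: ev_def ev3_line_poly line_simps)

text \<open>Starting from the pair 34 of the mirror, the cycle leads to 42 and 23, the swap from 23
  to 13, and the cycle again to 14 and 12. These are all pairs, and constant factors do not
  matter.\<close>

lemma sq_divides_line: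
  assumes "i < 6"
  shows "sq_divides (line i)"
proof -
  note cyc = sq_divides_xdiff_perm[OF heis_rho_Gam[OF s] heis_rho_perm[OF s]]
  note swap = sq_divides_xdiff_perm[OF swap12_Gam(1,3) swap12_perm]
  have "f0 = (\<lambda>b. (- 1 / 4) * xdiff 3 4 b)"
    by (simp add: fun_eq_iff xdiff_def xform_simps f0_def field_simps)
  then have 34: "sq_divides (xdiff 3 4)" using sq_divides_f0 sq_divides_scale by metis
  have 42: "sq_divides (xdiff 4 2)" using cyc[OF _ _ 34] by simp
  have 23: "sq_divides (xdiff 2 3)" using cyc[OF _ _ 42] by simp
  have 13: "sq_divides (xdiff 1 3)" using swap[OF _ _ 23] by (simp add: Transposition.transpose_def)
  have 14: "sq_divides (xdiff 1 4)" using cyc[OF _ _ 13] by simp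
  have 12: "sq_divides (xdiff 1 2)" using cyc[OF _ _ 14] by simp
  have eq: "xdiff 1 2 = (\<lambda>b. 4 * line 0 b)" "xdiff 1 3 = (\<lambda>b. 4 * line 1 b)" "xdiff 2 3 = (\<lambda>b. 4 * line 2 b)"
    "xdiff 3 4 = (\<lambda>b. - 4 * line 3 b)" "xdiff 1 4 = (\<lambda>b. - 4 * line 4 b)" "xdiff 4 2 = (\<lambda>b. 4 * line 5 b)"
    by (simp_all only: fun_eq_iff xdiff_def xform_simps line_simps f0_def) simp_all
  have "sq_divides (line 0)" "sq_divides (line 1)" "sq_divides (line 2)" "sq_divides (line 3)"
    "sq_divides (line 4)" "sq_divides (line 5)"
    using 12 13 23 34 14 42 unfolding eq by (blast intro: sq_divides_scale)+
  then show ?thesis using less_6_cases[OF assms] by (elim disjE) simp_all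
qed

lemma line_nonzero: "i < 6 \<Longrightarrow> \<not> (\<forall>b. line i b = 0)"
proof
  assume i: "i < 6" "\<forall>b. line i b = 0"
  then have "line_poly i = 0" by (intro ev_eq_0) (simp add: ev_line)
  then show False using line_poly_prime[OF i(1)] by simp
qed

lemma sform_line: "i < 6 \<Longrightarrow> sform 3 0 (line i)"
  using sform_coeff_ev[of 1 "line_poly i"] by (simp add: ev_line)

text \<open>The holomorphic quotient is a form of weight reduced by 6, hence a polynomial; algebraic
  independence turns the identity of functions into divisibility of polynomials.\<close>

lemma line_sq_dvd:
  assumes G: "sform k1 (- 1) G1" "sform k2 (- 1) G2" "sform k3 (- 1) G3"
    and P: "k1 + k2 + k3 = 3 * int d" "\<And>b. ev b P = monom (G1 b * G2 b * G3 b) d" and i: "i < 6"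
  shows "(line_poly i)\<^sup>2 dvd P"
proof -
  obtain T where T: "hol T" "\<And>b. G1 b * G2 b * G3 b = line i b ^ 2 * T b"
    using sq_divides_line[OF i] G unfolding sq_divides_def by blast
  show ?thesis
  proof (cases "\<forall>b. T b = 0")
    case True
    then have "P = 0" by (intro ev_eq_0) (simp add: P(2) T(2))
    then show ?thesis by simp
  next
    case False
    have l2: "sform 6 0 (\<lambda>b. line i b ^ 2)"
      using sform_mult[OF sform_line[OF i] sform_line[OF i]] by (simp add: power2_eq_square)
    have "sform (k1 + k2 + k3 - 6) 0 T"
    proof (rule sform_quotient[OF l2 _ T(1)])
      show "\<not> (\<forall>b. line i b ^ 2 = 0)" using line_nonzero[OF i] by simp
      show "sform (6 + (k1 + k2 + k3 - 6)) (0 + 0) (\<lambda>b. line i b ^ 2 * T b)"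
        using sform_triple[OF G] by (simp add: T(2) del: add.assoc group_cancel.add1 add_diff_eq) (simp add: algebra_simps)
    qed
    then obtain Q e where Q: "k1 + k2 + k3 - 6 = 3 * int e" "\<And>b. ev b Q = monom (T b) e"
      using ex_poly[OF _ False] by metis
    have d: "d = 2 + e" using P(1) Q(1) by simp
    have "ev b (P - (line_poly i)\<^sup>2 * Q) = 0" for b
    proof -
      have "[:0, line i b:] = monom (line i b) 1" by (simp add: monom_altdef)
      then show ?thesis
        by (simp add: ev_hom ev_line[OF i] P(2) Q(2) T(2) d mult_monom power2_eq_square del: One_nat_def)
    qed
    then have "P = (line_poly i)\<^sup>2 * Q" using ev_eq_0 by fastforce
    then show ?thesis by simp
  qed
qed

definition lines :: "picard_ball \<Rightarrow> complex" where "lines b = (\<Prod>i<6. line i b)"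

lemma ev_lines: "ev b ((\<Prod>i<6. line_poly i)\<^sup>2 * Q) = monom (lines b ^ 2) 12 * ev b Q"
proof -
  have "ev b (\<Prod>i<n. line_poly i) = monom (\<Prod>i<n. line i b) n" if "n \<le> 6" for n
    using that
  proof (induction n)
    case 0
    show ?case by (simp add: ev_def ev3_hom)
  next
    case (Suc n)
    then have "ev b (\<Prod>i<Suc n. line_poly i) = monom (\<Prod>i<n. line i b) n * monom (line n b) 1"
      by (simp add: ev_hom ev_line monom_altdef)
    then show ?case by (simp add: mult_monom)
  qed
  from this[of 6] have "ev b (\<Prod>i<6. line_poly i) = monom (lines b) 6" by (simp add: lines_def)
  then show ?thesis by (simp add: ev_hom mult_monom power2_eq_square)
qed

text \<open>The six squares of distinct primes divide the polynomial of the product together. Their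
  product has degree 12, so the coefficient in degree \<open>d\<close> is read off from the cofactor
  in degree \<open>d - 12\<close>, with value 0 for \<open>d < 12\<close>.\<close>

lemma triple_factor:
  assumes G: "sform k1 (- 1) G1" "sform k2 (- 1) G2" "sform k3 (- 1) G3" "\<not> (\<forall>b. G1 b * G2 b * G3 b = 0)"
  obtains d Q where "k1 + k2 + k3 = 3 * int d" "\<And>b. G1 b * G2 b * G3 b = (if 12 \<le> d then lines b ^ 2 * coeff (ev b Q) (d - 12) else 0)"
proof -
  obtain P d where P: "k1 + k2 + k3 = 3 * int d" "\<And>b. ev b P = monom (G1 b * G2 b * G3 b) d"
    using ex_poly[OF sform_triple[OF G(1-3)] G(4)] by metis
  have "(\<Prod>i<6. line_poly i)\<^sup>2 dvd P"
    by (rule prime_square_dvd_prod) (use line_poly_prime line_poly_not_dvd line_sq_dvd[OF G(1-3) P] in auto)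
  then obtain Q where Q: "P = (\<Prod>i<6. line_poly i)\<^sup>2 * Q" by blast
  have "G1 b * G2 b * G3 b = (if 12 \<le> d then lines b ^ 2 * coeff (ev b Q) (d - 12) else 0)" for b
  proof -
    have "G1 b * G2 b * G3 b = coeff (ev b P) d" by (simp add: P(2))
    also have "\<dots> = (if 12 \<le> d then lines b ^ 2 * coeff (ev b Q) (d - 12) else 0)"
      by (simp add: Q ev_lines coeff_monom_mult)
    finally show ?thesis .
  qed
  with P(1) show ?thesis by (rule that)
qed

text \<open>In weight 36 the polynomial has degree 12, the degree of the squared product of the
  lines, so the cofactor contributes only its constant term.\<close>

lemma jac_cube: obtains c where "c \<noteq> 0" "\<And>b. jac b ^ 3 = c * lines b ^ 2"
proof -
  have nz: "\<not> (\<forall>b. jac b * jac b * jac b = 0)" using jac_nonzero by simp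
  obtain d Q where dQ: "12 + 12 + 12 = 3 * int d"
    "\<And>b. jac b * jac b * jac b = (if 12 \<le> d then lines b ^ 2 * coeff (ev b Q) (d - 12) else 0)"
    using triple_factor[OF sform_jac sform_jac sform_jac nz] by metis
  then have "d = 12" by simp
  define c where "c = coeff (coeff (coeff Q 0) 0) 0"
  have J: "jac b ^ 3 = c * lines b ^ 2" for b
    using dQ(2)[of b] \<open>d = 12\<close> by (simp add: power3_eq_cube ev_def coeff_0_ev c_def)
  moreover have "c \<noteq> 0" using J jac_nonzero by force
  ultimately show ?thesis using that by blast
qed

lemma jac_divides:
  assumes G: "sform k (- 1) G"
  obtains T where "sform (k - 12) 0 T" "\<And>b. G b = jac b * T b"
proof (cases "\<forall>b. G b = 0")
  case True
  then show ?thesis using that[of "\<lambda>b. 0"] sform_zero by auto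
next
  case False
  have hG: "hol G" using G by (simp add: sform_def)
  have nz: "\<not> (\<forall>b. G b * jac b * jac b = 0)"
    using hol_mult_eq_0[OF hG, of "\<lambda>b. jac b * jac b"] False jac_nonzero by (auto simp: mult.assoc)
  obtain d Q where dQ: "\<And>b. G b * jac b * jac b = (if 12 \<le> d then lines b ^ 2 * coeff (ev b Q) (d - 12) else 0)"
    using triple_factor[OF G sform_jac sform_jac nz] by metis
  obtain c where c: "c \<noteq> 0" "\<And>b. jac b ^ 3 = c * lines b ^ 2" using jac_cube by blast
  \<comment> \<open>The division by \<open>c\<close> accounts for the constant between
    \<open>jac ^ 3\<close> and \<open>lines ^ 2\<close>; the square of \<open>jac\<close> is
    cancelled afterwards.\<close>
  define T where "T b = (if 12 \<le> d then coeff (ev b Q) (d - 12) else 0) / c" for b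
  have hT: "hol T"
    using sform_coeff_ev[of "d - 12" Q] unfolding T_def[abs_def] divide_inverse
    by (cases "12 \<le> d") (simp_all add: sform_def)
  have GT: "G b = jac b * T b" for b
  proof (rule hol_cancel[OF _ hG _ _ , of "\<lambda>b. jac b ^ 2" "\<lambda>b. jac b * T b"])
    fix b
    have "c * (jac b ^ 2 * G b) = c * (lines b ^ 2 * (c * T b))"
      using dQ[of b] c(1) by (simp add: T_def power2_eq_square mult_ac)
    also have "\<dots> = jac b ^ 3 * (c * T b)" by (simp add: c(2))
    also have "\<dots> = c * (jac b ^ 2 * (jac b * T b))" by (simp add: power2_eq_square power3_eq_cube)
    finally show "jac b ^ 2 * G b = jac b ^ 2 * (jac b * T b)" using c(1) by simp
  qed (use hT jac_nonzero in simp_all)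
  have "sform (k - 12) 0 T"
  proof (rule sform_quotient[OF sform_jac jac_nonzero hT])
    have "(\<lambda>b. jac b * T b) = G" using GT by auto
    then show "sform (12 + (k - 12)) (- 1 + 0) (\<lambda>b. jac b * T b)" using G by simp
  qed
  then show ?thesis using that GT by blast
qed

end

section \<open>Fourier-Jacobi expansions of the brackets\<close>

definition kap :: complex where "kap = of_real (2 * pi) / of_real (sqrt 3)"

definition fj :: "(picard_ball \<Rightarrow> complex) \<Rightarrow> (nat \<Rightarrow> complex \<Rightarrow> complex) \<Rightarrow> bool" where
  "fj f a \<longleftrightarrow> (\<forall>u v. (u, v) \<in> ball_coords \<longrightarrow> (\<lambda>n. a n u * exp (kap * v) ^ n) sums f (pt u v))"

lemma fjD: "fj f a \<Longrightarrow> (u, v) \<in> ball_coords \<Longrightarrow> (\<lambda>n. a n u * exp (kap * v) ^ n) sums f (pt u v)"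
  by (simp add: fj_def)

lemma FJ_expansion_iff: "FJ_expansion F c \<longleftrightarrow> (\<forall>i. fj (\<lambda>b. coeff (F b) i) (\<lambda>n u. coeff (c n u) i))"
proof -
  have "FJ_expansion F c \<longleftrightarrow> (\<forall>i u v. (u, v) \<in> ball_coords \<longrightarrow>
      (\<lambda>n. coeff (c n u) i * exp (of_real (2 * pi) * v / of_real (sqrt 3)) ^ n) sums coeff (F (pt u v)) i)"
    unfolding FJ_expansion_def
  proof (intro iffI allI impI)
    fix i u v
    assume F: "\<forall>b i. case coords b of (u, v) \<Rightarrow>
      (\<lambda>n. coeff (c n u) i * exp (of_real (2 * pi) * v / of_real (sqrt 3)) ^ n) sums coeff (F b) i"
      and uv: "(u, v) \<in> ball_coords"
    show "(\<lambda>n. coeff (c n u) i * exp (of_real (2 * pi) * v / of_real (sqrt 3)) ^ n) sums coeff (F (pt u v)) i"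
      using spec[OF spec[OF F, of "pt u v"], of i] uv by simp
  next
    fix b i
    assume F: "\<forall>i u v. (u, v) \<in> ball_coords \<longrightarrow>
      (\<lambda>n. coeff (c n u) i * exp (of_real (2 * pi) * v / of_real (sqrt 3)) ^ n) sums coeff (F (pt u v)) i"
    show "case coords b of (u, v) \<Rightarrow>
      (\<lambda>n. coeff (c n u) i * exp (of_real (2 * pi) * v / of_real (sqrt 3)) ^ n) sums coeff (F b) i"
      using F[rule_format, of "fst (coords b)" "snd (coords b)" i] by (simp add: split_beta)
  qed
  then show ?thesis by (simp add: fj_def kap_def)
qed

lemma norm_exp_kap: "norm (exp (kap * v)) = exp (2 * pi / sqrt 3 * Re v)"
  by (simp add: kap_def norm_exp_eq_Re flip: of_real_divide of_real_mult)

lemma norm_exp_kap_less: "Re v < Re v' \<Longrightarrow> norm (exp (kap * v)) < norm (exp (kap * v'))"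
  unfolding norm_exp_kap exp_less_cancel_iff by (rule mult_strict_left_mono) simp_all

text \<open>For fixed \<open>u\<close> there is room for a point of larger real part, where
  \<open>w\<close> has larger modulus; convergence there gives absolute convergence and termwise
  differentiation at the given point.\<close>

lemma smaller_radius:
  assumes "(u, v) \<in> ball_coords"
  obtains \<beta> :: real where "Re v < \<beta>" "(u, complex_of_real \<beta>) \<in> ball_coords"
proof -
  have "2 * Re v + (cmod u)\<^sup>2 < 0" using assms by (simp add: ball_coords_def)
  then obtain \<beta> where "Re v < \<beta>" "\<beta> < - (cmod u)\<^sup>2 / 2"
    using dense[of "Re v" "- (cmod u)\<^sup>2 / 2"] by auto
  then show ?thesis using that by (simp add: ball_coords_def)
qed

lemma fj_abs_summable:
  assumes "fj f a" "(u, v) \<in> ball_coords"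
  shows "summable (\<lambda>n. norm (a n u * exp (kap * v) ^ n))"
proof -
  obtain \<beta> where b: "Re v < \<beta>" "(u, complex_of_real \<beta>) \<in> ball_coords"
    using smaller_radius[OF assms(2)] .
  show ?thesis
    by (rule powser_insidea[where x = "exp (kap * of_real \<beta>)"])
      (use fjD[OF assms(1) b(2)] norm_exp_kap_less[of v \<beta>] b(1) in \<open>simp_all add: sums_iff\<close>)
qed

lemma fj_mult:
  assumes "fj f a" "fj g c"
  shows "fj (\<lambda>b. f b * g b) (\<lambda>n u. \<Sum>i\<le>n. a i u * c (n - i) u)"
  unfolding fj_def
proof (intro allI impI)
  fix u v assume uv: "(u, v) \<in> ball_coords"
  let ?w = "exp (kap * v)"
  have "(\<lambda>n. \<Sum>i\<le>n. a i u * ?w ^ i * (c (n - i) u * ?w ^ (n - i))) sums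
    (suminf (\<lambda>n. a n u * ?w ^ n) * suminf (\<lambda>n. c n u * ?w ^ n))"
    by (rule Cauchy_product_sums; rule fj_abs_summable[OF _ uv]; fact)
  moreover have "suminf (\<lambda>n. a n u * ?w ^ n) = f (pt u v)" "suminf (\<lambda>n. c n u * ?w ^ n) = g (pt u v)"
    using fjD[OF assms(1) uv] fjD[OF assms(2) uv] by (simp_all add: sums_iff)
  moreover have "(\<Sum>i\<le>n. a i u * ?w ^ i * (c (n - i) u * ?w ^ (n - i))) = (\<Sum>i\<le>n. a i u * c (n - i) u) * ?w ^ n" for n
  proof -
    have "a i u * ?w ^ i * (c (n - i) u * ?w ^ (n - i)) = a i u * c (n - i) u * ?w ^ n" if "i \<in> {..n}" for i
    proof -
      have "?w ^ n = ?w ^ i * ?w ^ (n - i)" using that by (simp flip: power_add)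
      then show ?thesis by (simp only: mult_ac)
    qed
    then show ?thesis unfolding sum_distrib_right by (rule sum.cong[OF refl])
  qed
  ultimately show "(\<lambda>n. (\<Sum>i\<le>n. a i u * c (n - i) u) * ?w ^ n) sums (f (pt u v) * g (pt u v))" by simp
qed

lemma fj_diff: "fj f a \<Longrightarrow> fj g c \<Longrightarrow> fj (\<lambda>b. f b - g b) (\<lambda>n u. a n u - c n u)"
  unfolding fj_def by (auto simp: left_diff_distrib intro!: sums_diff)

lemma fj_add: "fj f a \<Longrightarrow> fj g c \<Longrightarrow> fj (\<lambda>b. f b + g b) (\<lambda>n u. a n u + c n u)"
  unfolding fj_def by (auto simp: distrib_right intro!: sums_add)

lemma fj_cmult: "fj f a \<Longrightarrow> fj (\<lambda>b. z * f b) (\<lambda>n u. z * a n u)"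
  unfolding fj_def by (auto simp: mult.assoc intro!: sums_mult)

text \<open>On the series \<open>d2\<close> acts as \<open>kap\<close> times \<open>w d/dw\<close>,
  so the constant term drops out.\<close>

lemma fj_d2:
  assumes f: "hol f" and a: "fj f a"
  shows "fj (d2 f) (\<lambda>n u. kap * (of_nat n * a n u))"
  unfolding fj_def
proof (intro allI impI)
  fix u v assume uv: "(u, v) \<in> ball_coords"
  let ?w = "\<lambda>v. exp (kap * v)"
  obtain \<beta> where b: "Re v < \<beta>" "(u, complex_of_real \<beta>) \<in> ball_coords"
    using smaller_radius[OF uv] .
  have K: "summable (\<lambda>n. a n u * ?w \<beta> ^ n)" using fjD[OF a b(2)] by (simp add: sums_iff)
  have w: "norm (?w v) < norm (?w \<beta>)" using norm_exp_kap_less[of v \<beta>] b(1) by simp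
  have "((\<lambda>z. suminf (\<lambda>n. a n u * ?w z ^ n)) has_field_derivative suminf (\<lambda>n. diffs (\<lambda>n. a n u) n * ?w v ^ n) * (kap * ?w v)) (at v)"
    by (rule DERIV_chain2[where f = "\<lambda>x. suminf (\<lambda>n. a n u * x ^ n)" and g = ?w, OF termdiffs_strong[OF K w]])
      (auto intro!: derivative_eq_intros)
  moreover have "open {z. (u, z) \<in> ball_coords}"
    using open_vimage[OF open_ball_coords continuous_on_Pair[OF continuous_on_const continuous_on_id], of u]
    by (simp add: vimage_def)
  ultimately have "((\<lambda>z. f (pt u z)) has_field_derivative suminf (\<lambda>n. diffs (\<lambda>n. a n u) n * ?w v ^ n) * (kap * ?w v)) (at v)"
    by (rule has_field_derivative_transform_within_open) (use uv fjD[OF a] in \<open>auto simp: sums_iff\<close>)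
  then have d: "d2 f (pt u v) = suminf (\<lambda>n. diffs (\<lambda>n. a n u) n * ?w v ^ n) * (kap * ?w v)"
    using DERIV_unique has_d_partials(2)[OF f uv] by blast
  have "summable (\<lambda>n. diffs (\<lambda>n. a n u) n * ?w v ^ n)"
    by (rule termdiff_converges[OF w]) (rule powser_inside[OF K], simp)
  then have "(\<lambda>n. diffs (\<lambda>n. a n u) n * ?w v ^ n * (kap * ?w v)) sums d2 f (pt u v)"
    unfolding d by (intro sums_mult2 summable_sums)
  moreover have "diffs (\<lambda>n. a n u) n * ?w v ^ n * (kap * ?w v) = kap * (of_nat (Suc n) * a (Suc n) u) * ?w v ^ Suc n" for n
    by (simp add: diffs_def mult_ac del: of_nat_Suc)
  ultimately have "(\<lambda>n. kap * (of_nat (Suc n) * a (Suc n) u) * ?w v ^ Suc n) sums d2 f (pt u v)" by simp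
  then show "(\<lambda>n. kap * (of_nat n * a n u) * ?w v ^ n) sums d2 f (pt u v)"
    by (subst (asm) sums_Suc_iff) simp
qed

text \<open>One period of \<open>v\<close>, a vertical segment of length \<open>sqrt 3\<close>, runs
  once around a circle in the variable \<open>w\<close>.\<close>

lemma kap_circle: "exp (kap * (of_real \<beta> + \<i> * of_real (sqrt 3) * of_real t)) = circlepath 0 (exp (2 * pi / sqrt 3 * \<beta>)) t"
proof -
  have "kap * (of_real \<beta> + \<i> * of_real (sqrt 3) * of_real t) = of_real (2 * pi / sqrt 3 * \<beta>) + 2 * of_real pi * \<i> * of_real t"
    by (simp add: kap_def field_simps)
  then show ?thesis by (simp only: circlepath exp_add exp_of_real add_0)
qed

text \<open>In \<open>fj\<close> the coefficients are arbitrary functions of \<open>u\<close>.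
  Cauchy's formula in the variable \<open>w\<close> expresses them by \<open>f\<close>, which makes
  their holomorphy and uniform bounds accessible.\<close>

lemma fj_coeff_integral:
  assumes f: "hol f" and a: "fj f a" and ub: "(u, complex_of_real \<beta>) \<in> ball_coords"
  shows "a n u = integral (cbox 0 1) (\<lambda>t. f (pt u (of_real \<beta> + \<i> * of_real (sqrt 3) * of_real t))
    / circlepath 0 (exp (2 * pi / sqrt 3 * \<beta>)) t ^ n)"
proof -
  let ?r = "exp (2 * pi / sqrt 3 * \<beta>)"
  let ?F = "Abs_fps (\<lambda>n. a n u)"
  obtain \<gamma> where g: "\<beta> < \<gamma>" "(u, complex_of_real \<gamma>) \<in> ball_coords"
    using smaller_radius[OF ub] by auto
  have "summable (\<lambda>n. a n u * exp (kap * of_real \<gamma>) ^ n)" using fjD[OF a g(2)] by (simp add: sums_iff)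
  then have "fps_conv_radius ?F \<ge> norm (exp (kap * of_real \<gamma>))"
    unfolding fps_conv_radius_def by (intro conv_radius_geI) simp
  moreover have "?r < norm (exp (kap * of_real \<gamma>))"
    using norm_exp_kap_less[of \<beta> \<gamma>] norm_exp_kap[of \<beta>] g(1) by (simp only: Re_complex_of_real)
  ultimately have R: "ereal ?r < fps_conv_radius ?F"
    by (meson ereal_less_eq(3) less_ereal.simps(1) less_le_trans)
  have h: "eval_fps ?F holomorphic_on eball 0 (fps_conv_radius ?F)" by (intro holomorphic_on_eval_fps) auto
  have sub: "cball (0::complex) ?r \<subseteq> eball 0 (fps_conv_radius ?F)"
  proof
    fix z :: complex assume "z \<in> cball 0 ?r"
    then have "ereal (norm z) \<le> ereal ?r" by simp
    from le_less_trans[OF this R] show "z \<in> eball 0 (fps_conv_radius ?F)" by (simp add: in_eball_iff)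
  qed
  have hc: "continuous_on (cball 0 ?r) (eval_fps ?F)"
    using holomorphic_on_imp_continuous_on[OF holomorphic_on_subset[OF h sub]] .
  have hb: "eval_fps ?F holomorphic_on ball 0 ?r"
    using holomorphic_on_subset[OF h] sub ball_subset_cball by blast
  have "eval_fps ?F has_fps_expansion ?F"
  proof (rule eval_fps_has_fps_expansion)
    have "ereal 0 < ereal ?r" by simp
    then show "0 < fps_conv_radius ?F" using R by (metis less_trans zero_ereal_def)
  qed
  then have an: "a n u = (deriv ^^ n) (eval_fps ?F) 0 / fact n"
    using fps_nth_fps_expansion by force
  have "((\<lambda>w. eval_fps ?F w / (w - 0) ^ Suc n) has_contour_integral
      (2 * pi * \<i>) / fact n * (deriv ^^ n) (eval_fps ?F) 0) (circlepath 0 ?r)"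
    by (rule Cauchy_has_contour_integral_higher_derivative_circlepath[OF hc hb]) simp
  then have "2 * pi * \<i> * a n u = contour_integral (circlepath 0 ?r) (\<lambda>w. eval_fps ?F w / w ^ Suc n)"
    by (simp add: contour_integral_unique an)
  also have "\<dots> = integral {0..1} (\<lambda>t. eval_fps ?F (circlepath 0 ?r t) / circlepath 0 ?r t ^ Suc n * (2 * pi * \<i> * ?r * exp (2 * pi * \<i> * t)))"
    by (rule circlepath_integrand) simp
  also have "\<dots> = integral {0..1} (\<lambda>t. 2 * pi * \<i> * (f (pt u (of_real \<beta> + \<i> * of_real (sqrt 3) * of_real t)) / circlepath 0 ?r t ^ n))"
  proof (rule integral_cong)
    fix t :: real
    let ?v = "of_real \<beta> + \<i> * of_real (sqrt 3) * of_real t"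
    have c: "circlepath 0 ?r t = ?r * exp (2 * pi * \<i> * t)" "circlepath 0 ?r t \<noteq> 0" by (simp_all add: circlepath)
    have "(u, ?v) \<in> ball_coords" using ub by (simp add: ball_coords_def)
    from fjD[OF a this] have "(\<lambda>n. a n u * circlepath 0 ?r t ^ n) sums f (pt u ?v)"
      by (simp only: kap_circle)
    then have "eval_fps ?F (circlepath 0 ?r t) = f (pt u ?v)"
      by (simp add: eval_fps_def sums_iff)
    then have "eval_fps ?F (circlepath 0 ?r t) / circlepath 0 ?r t ^ Suc n * (2 * pi * \<i> * circlepath 0 ?r t)
       = 2 * pi * \<i> * (f (pt u ?v) / circlepath 0 ?r t ^ n)"
      using c(2) by (simp add: field_simps)
    then show "eval_fps ?F (circlepath 0 ?r t) / circlepath 0 ?r t ^ Suc n * (2 * pi * \<i> * ?r * exp (2 * pi * \<i> * t))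
       = 2 * pi * \<i> * (f (pt u ?v) / circlepath 0 ?r t ^ n)"
      unfolding c(1) by (simp add: mult_ac)
  qed
  also have "\<dots> = 2 * pi * \<i> * integral {0..1} (\<lambda>t. f (pt u (of_real \<beta> + \<i> * of_real (sqrt 3) * of_real t)) / circlepath 0 ?r t ^ n)"
    by (rule integral_mult_right)
  finally show ?thesis by simp
qed

lemma continuous_on_fj_integrand:
  assumes f: "hol f" and U: "\<And>x. x \<in> U \<Longrightarrow> (x, complex_of_real \<beta>) \<in> ball_coords"
  shows "continuous_on (U \<times> cbox 0 1) (\<lambda>(x, t). f (pt x (of_real \<beta> + \<i> * of_real (sqrt 3) * of_real t))
    / circlepath 0 (exp (2 * pi / sqrt 3 * \<beta>)) t ^ n)"
proof -
  have "continuous_on (U \<times> cbox 0 1) (\<lambda>p. f (of_coords (fst p, of_real \<beta> + \<i> * of_real (sqrt 3) * of_real (snd p))))"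
    by (rule continuous_on_compose2[OF hol_continuous[OF f]])
      (use U in \<open>auto intro!: continuous_intros simp: ball_coords_def\<close>)
  moreover have "circlepath 0 (exp (2 * pi / sqrt 3 * \<beta>)) t \<noteq> 0" for t by (simp add: circlepath)
  ultimately show ?thesis unfolding split_beta pt_def
    by (intro continuous_intros continuous_on_circlepath) auto
qed

lemma continuous_on_fj_integrand_slice:
  assumes f: "hol f" and x: "(x, complex_of_real \<beta>) \<in> ball_coords"
  shows "continuous_on (cbox 0 1) (\<lambda>t. f (pt x (of_real \<beta> + \<i> * of_real (sqrt 3) * of_real t))
    / circlepath 0 (exp (2 * pi / sqrt 3 * \<beta>)) t ^ n)"
proof -
  have "continuous_on (cbox 0 1) (\<lambda>t. f (of_coords (x, of_real \<beta> + \<i> * of_real (sqrt 3) * of_real t)))"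
    by (rule continuous_on_compose2[OF hol_continuous[OF f]])
      (use x in \<open>auto intro!: continuous_intros simp: ball_coords_def\<close>)
  moreover have "circlepath 0 (exp (2 * pi / sqrt 3 * \<beta>)) t \<noteq> 0" for t by (simp add: circlepath)
  ultimately show ?thesis unfolding pt_def
    by (intro continuous_intros continuous_on_circlepath) auto
qed

lemma fj_coeff_holomorphic:
  assumes f: "hol f" and a: "fj f a" and U: "\<And>x. x \<in> ball u r \<Longrightarrow> (x, complex_of_real \<beta>) \<in> ball_coords"
  shows "a n holomorphic_on ball u r"
proof -
  let ?v = "\<lambda>t. of_real \<beta> + \<i> * of_real (sqrt 3) * of_real t"
  let ?c = "circlepath 0 (exp (2 * pi / sqrt 3 * \<beta>))"
  have in_ball: "(x, ?v t) \<in> ball_coords" if "x \<in> ball u r" for x t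
    using U[OF that] by (simp add: ball_coords_def)
  have "(\<lambda>x. integral (cbox 0 1) (\<lambda>t. f (pt x (?v t)) / ?c t ^ n)) holomorphic_on ball u r"
  proof (rule leibniz_rule_holomorphic)
    show "((\<lambda>x. f (pt x (?v t)) / ?c t ^ n) has_field_derivative d1 f (pt x (?v t)) / ?c t ^ n) (at x within ball u r)"
      if "x \<in> ball u r" for x t
      by (intro DERIV_cdivide has_field_derivative_at_within[OF has_d_partials(1)] f in_ball that)
    show "(\<lambda>t. f (pt x (?v t)) / ?c t ^ n) integrable_on cbox 0 1" if x: "x \<in> ball u r" for x
      by (rule integrable_continuous[OF continuous_on_fj_integrand_slice[OF f U[OF x]]])
    show "continuous_on (ball u r \<times> cbox 0 1) (\<lambda>(x, t). d1 f (pt x (?v t)) / ?c t ^ n)"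
      by (rule continuous_on_fj_integrand[OF hol_d1[OF f] U])
  qed simp
  then show ?thesis
    by (rule holomorphic_transform) (rule fj_coeff_integral[OF f a U, symmetric])
qed

text \<open>Termwise differentiation in \<open>u\<close> needs a bound on the coefficients that is
  uniform near \<open>u\<close>; the integral formula gives one from a bound of \<open>f\<close> on
  a compact set.\<close>

lemma fj_d1:
  assumes f: "hol f" and a: "fj f a"
  shows "fj (d1 f) (\<lambda>n. deriv (a n))"
  unfolding fj_def
proof (intro allI impI)
  fix u v assume uv: "(u, v) \<in> ball_coords"
  obtain \<beta> where b: "Re v < \<beta>" "(u, complex_of_real \<beta>) \<in> ball_coords"
    using smaller_radius[OF uv] .
  obtain r where r: "r > 0" "cball u r \<times> cball (of_real \<beta>) r \<subseteq> ball_coords"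
    using bicylinder_subset[OF open_ball_coords b(2)] by auto
  have U: "(x, complex_of_real \<beta>) \<in> ball_coords" if "x \<in> cball u r" for x
    using r that by (auto simp: subset_iff)
  let ?S = "ball u r"
  let ?v = "\<lambda>t. of_real \<beta> + \<i> * of_real (sqrt 3) * of_real t"
  let ?\<rho> = "exp (2 * pi / sqrt 3 * \<beta>)"
  let ?w = "exp (kap * v)"
  have hol: "a n holomorphic_on ?S" for n
    by (rule fj_coeff_holomorphic[OF f a U]) (use ball_subset_cball in blast)
  have "continuous_on (cball u r \<times> cbox 0 1) (\<lambda>(x, t). f (pt x (?v t)) / circlepath 0 ?\<rho> t ^ 0)"
    by (rule continuous_on_fj_integrand[OF f U])
  then have "bounded ((\<lambda>(x, t). f (pt x (?v t)) / circlepath 0 ?\<rho> t ^ 0) ` (cball u r \<times> cbox 0 1))"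
    by (intro compact_imp_bounded compact_continuous_image compact_Times) auto
  then obtain M where M': "\<And>y. y \<in> (\<lambda>(x, t). f (pt x (?v t)) / circlepath 0 ?\<rho> t ^ 0) ` (cball u r \<times> cbox 0 1) \<Longrightarrow> norm y \<le> M"
    unfolding bounded_iff by blast
  have M: "norm (f (pt x (?v t))) \<le> M" if "x \<in> cball u r" "t \<in> cbox 0 1" for x t
    using M'[OF imageI[of "(x, t)"]] that by simp
  have "norm (f (pt u (?v 0))) \<le> M" by (rule M) (use r(1) in simp_all)
  then have M0: "M \<ge> 0" by (rule order_trans[OF norm_ge_zero])
  have bound: "norm (a n x) \<le> M / ?\<rho> ^ n" if x: "x \<in> ?S" for x n
  proof -
    have x': "x \<in> cball u r" using x by simp
    have c: "norm (circlepath 0 ?\<rho> t) = ?\<rho>" for t by (simp add: circlepath norm_mult)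
    have "continuous_on (cbox 0 1) (\<lambda>t. f (pt x (?v t)) / circlepath 0 ?\<rho> t ^ n)"
      by (rule continuous_on_fj_integrand_slice[OF f U[OF x']])
    then have "((\<lambda>t. f (pt x (?v t)) / circlepath 0 ?\<rho> t ^ n) has_integral a n x) (cbox 0 1)"
      unfolding fj_coeff_integral[OF f a U[OF x']] by (intro integrable_integral integrable_continuous)
    then have "norm (a n x) \<le> M / ?\<rho> ^ n * measure lborel (cbox 0 (1::real))"
    proof (rule has_integral_bound[rotated])
      show "norm (f (pt x (?v t)) / circlepath 0 ?\<rho> t ^ n) \<le> M / ?\<rho> ^ n" if "t \<in> cbox 0 1" for t
        unfolding norm_divide norm_power c by (rule divide_right_mono[OF M[OF x' that]]) simp
    qed (use M0 in simp)
    then show ?thesis by simp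
  qed
  \<comment> \<open>The bounds come from a circle whose radius exceeds the modulus of
    \<open>w\<close>, so the terms decay geometrically with this ratio.\<close>
  define \<theta> where "\<theta> = norm ?w / ?\<rho>"
  have \<theta>: "0 \<le> \<theta>" "\<theta> < 1" using b(1)
    using norm_exp_kap_less[of v \<beta>] norm_exp_kap[of \<beta>] by (simp_all only: \<theta>_def Re_complex_of_real) simp_all
  have "\<exists>g g'. \<forall>x\<in>?S. (\<lambda>n. a n x * ?w ^ n) sums g x \<and> (\<lambda>n. deriv (a n) x * ?w ^ n) sums g' x \<and>
      (g has_field_derivative g' x) (at x)"
  proof (rule series_and_derivative_comparison_complex)
    show "((\<lambda>x. a n x * ?w ^ n) has_field_derivative deriv (a n) x * ?w ^ n) (at x)" if "x \<in> ?S" for n x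
      by (intro DERIV_cmult_right holomorphic_derivI[OF hol open_ball that])
    fix x assume "x \<in> ?S"
    have "cmod (a n y * ?w ^ n) \<le> cmod (complex_of_real (M * \<theta> ^ n))" if "y \<in> ?S" for y n
    proof -
      have "cmod (a n y * ?w ^ n) \<le> M / ?\<rho> ^ n * norm ?w ^ n"
        unfolding norm_mult norm_power by (intro mult_right_mono bound that) simp
      also have "\<dots> = M * \<theta> ^ n" by (simp add: \<theta>_def power_divide)
      also have "\<dots> = cmod (complex_of_real (M * \<theta> ^ n))" using M0 \<theta> by (simp add: norm_mult norm_power)
      finally show ?thesis .
    qed
    moreover have "summable (\<lambda>n. complex_of_real (M * \<theta> ^ n))"
      using \<theta> by (intro summable_of_real summable_mult summable_geometric) simp
    moreover have "range (\<lambda>n. complex_of_real (M * \<theta> ^ n)) \<subseteq> \<real>\<^sub>\<ge>\<^sub>0"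
      using M0 \<theta> by (auto simp del: of_real_mult of_real_power)
    ultimately show "\<exists>d h. 0 < d \<and> summable h \<and> range h \<subseteq> \<real>\<^sub>\<ge>\<^sub>0 \<and>
        (\<forall>\<^sub>F n in sequentially. \<forall>y\<in>ball x d \<inter> ?S. cmod (a n y * ?w ^ n) \<le> cmod (h n))"
      by (intro exI[of _ 1] exI[of _ "\<lambda>n. complex_of_real (M * \<theta> ^ n)"]) (auto intro: always_eventually)
  qed simp
  then obtain g g' where g: "\<And>x. x \<in> ?S \<Longrightarrow> (\<lambda>n. a n x * ?w ^ n) sums g x"
    "\<And>x. x \<in> ?S \<Longrightarrow> (\<lambda>n. deriv (a n) x * ?w ^ n) sums g' x"
    "\<And>x. x \<in> ?S \<Longrightarrow> (g has_field_derivative g' x) (at x)" by blast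
  have u: "u \<in> ?S" using r by simp
  have "g x = f (pt x v)" if "x \<in> ?S" for x
  proof -
    have "(x, v) \<in> ball_coords" using U[of x] that b(1) by (simp add: ball_coords_def)
    from sums_unique2[OF g(1)[OF that] fjD[OF a this]] show ?thesis .
  qed
  then have "((\<lambda>x. f (pt x v)) has_field_derivative g' u) (at u)"
    by (intro has_field_derivative_transform_within_open[OF g(3)[OF u] open_ball u])
  then have "d1 f (pt u v) = g' u"
    using DERIV_unique has_d_partials(1)[OF f uv] by blast
  then show "(\<lambda>n. deriv (a n) u * ?w ^ n) sums d1 f (pt u v)" using g(2)[OF u] by simp
qed

text \<open>In the first component the constant term is \<open>a_0 c_0' - c_0 a_0'\<close>, which
  vanishes as both constant terms are independent of \<open>u\<close>; in the second it is killed by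
  the factor \<open>n\<close> that \<open>d2\<close> produces.\<close>

lemma FJ_bracket:
  assumes f: "hol f" "fj f a" "a 0 = (\<lambda>u. \<alpha>)" and h: "hol h" "fj h c" "c 0 = (\<lambda>u. \<gamma>)"
  shows "FJ_constant_term (\<lambda>b. [:bracket1 f h b, bracket2 f h b:]) (\<lambda>u. 0)"
proof -
  define e1 where "e1 n u = (\<Sum>i\<le>n. a i u * deriv (c (n - i)) u) - (\<Sum>i\<le>n. c i u * deriv (a (n - i)) u)" for n u
  define e2 where "e2 n u = (\<Sum>i\<le>n. a i u * (kap * (of_nat (n - i) * c (n - i) u)))
     - (\<Sum>i\<le>n. c i u * (kap * (of_nat (n - i) * a (n - i) u)))" for n u
  have 1: "fj (bracket1 f h) e1"
    unfolding bracket1_def[abs_def] e1_def[abs_def]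
    by (intro fj_diff fj_mult f h fj_d1)
  have 2: "fj (bracket2 f h) e2"
    unfolding bracket2_def[abs_def] e2_def[abs_def]
    by (intro fj_diff fj_mult f h fj_d2)
  have 3: "fj (\<lambda>b. 0) (\<lambda>n u. 0)" by (simp add: fj_def)
  define e where "e n u = [:e1 n u, e2 n u:]" for n u
  have "FJ_expansion (\<lambda>b. [:bracket1 f h b, bracket2 f h b:]) e"
    unfolding FJ_expansion_iff
  proof
    fix i :: nat
    consider "i = 0" | "i = 1" | "i \<ge> 2" by linarith
    then show "fj (\<lambda>b. coeff [:bracket1 f h b, bracket2 f h b:] i) (\<lambda>n u. coeff (e n u) i)"
    proof cases
      case 3
      then obtain j where "i = Suc (Suc j)" by (metis add_2_eq_Suc le_Suc_ex)
      then show ?thesis using \<open>fj (\<lambda>b. 0) (\<lambda>n u. 0)\<close> by (simp add: e_def)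
    qed (use 1 2 in \<open>simp_all add: e_def\<close>)
  qed
  moreover have "e 0 = (\<lambda>u. 0)"
    by (simp add: fun_eq_iff e_def e1_def e2_def f(3) h(3))
  ultimately show ?thesis unfolding FJ_constant_term_def by blast
qed

section \<open>Generators and relations\<close>

text \<open>In degree one only the linear monomials contribute, so this describes the forms of
  weight 3.\<close>

lemma coeff_1_ev3:
  "\<exists>\<alpha> \<beta> \<gamma>. \<forall>x y z. coeff (ev3 x y z r) 1 = \<alpha> * x + \<beta> * y + \<gamma> * z"
proof -
  obtain q r1 where r: "r = pCons q r1" by (cases r)
  obtain p q1 where q: "q = pCons p q1" by (cases q)
  obtain c p1 where p: "p = pCons c p1" by (cases p)
  have "coeff (ev3 x y z r) 1 = coeff p1 0 * x + coeff (coeff q1 0) 0 * y + coeff (coeff (coeff r1 0) 0) 0 * z" for x y z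
    by (simp add: r q p ev_pCons coeff_0_ev)
  then show ?thesis by blast
qed

lemma vform_smult:
  assumes a: "sform k 0 a" and f: "vform l f1 f2"
  shows "vform (k + l) (\<lambda>b. a b * f1 b) (\<lambda>b. a b * f2 b)"
  unfolding vform_def
proof (intro conjI ballI allI)
  show "hol (\<lambda>b. a b * f1 b)" "hol (\<lambda>b. a b * f2 b)" using a f by (simp_all add: sform_def vform_def)
  fix g b assume g: "g \<in> Gam_sqrt_m3"
  have j: "j1 g b \<noteq> 0" using g by (simp add: Gam_sqrt_m3_subset)
  have e: "j1 g b powi (k + l - 1) = j1 g b powi k * j1 g b powi (l - 1)"
    using j power_int_add[of "j1 g b" k "l - 1"] by (simp add: algebra_simps)
  have "pull1 g (\<lambda>b. a b * f1 b) (\<lambda>b. a b * f2 b) b = a (act g b) * pull1 g f1 f2 b"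
    "pull2 g (\<lambda>b. a b * f1 b) (\<lambda>b. a b * f2 b) b = a (act g b) * pull2 g f1 f2 b"
    by (simp_all add: pull1_def pull2_def algebra_simps)
  moreover have "a (act g b) = j1 g b powi k * a b" using a g by (simp add: sform_def)
  ultimately show "pull1 g (\<lambda>b. a b * f1 b) (\<lambda>b. a b * f2 b) b = j1 g b powi (k + l - 1) * (a b * f1 b)"
    "pull2 g (\<lambda>b. a b * f1 b) (\<lambda>b. a b * f2 b) b = j1 g b powi (k + l - 1) * (a b * f2 b)"
    using f g by (simp_all add: vform_def e)
qed

lemma vform_add:
  "vform k f1 f2 \<Longrightarrow> vform k g1 g2 \<Longrightarrow> vform k (\<lambda>b. f1 b + g1 b) (\<lambda>b. f2 b + g2 b)"
  by (simp add: vform_def pull1_def pull2_def algebra_simps)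

lemma M_forms_add: "F \<in> M_forms 0 k \<Longrightarrow> G \<in> M_forms 0 k \<Longrightarrow> F + G \<in> M_forms 0 k"
  "F \<in> M_forms 1 k \<Longrightarrow> G \<in> M_forms 1 k \<Longrightarrow> F + G \<in> M_forms 1 k"
proof -
  show "F + G \<in> M_forms 0 k" if "F \<in> M_forms 0 k" "G \<in> M_forms 0 k"
    using that unfolding M_forms_0_iff by (auto simp: plus_fun_def intro: sform_add)
  show "F + G \<in> M_forms 1 k" if FG: "F \<in> M_forms 1 k" "G \<in> M_forms 1 k"
  proof -
    obtain f1 f2 g1 g2 where "F = (\<lambda>b. [:f1 b, f2 b:])" "G = (\<lambda>b. [:g1 b, g2 b:])" "vform k f1 f2" "vform k g1 g2"
      using FG unfolding M_forms_1_iff by blast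
    then show ?thesis
      unfolding M_forms_1_iff using vform_add[of k f1 f2 g1 g2]
      by - (rule exI[of _ "\<lambda>b. f1 b + g1 b"], rule exI[of _ "\<lambda>b. f2 b + g2 b"], simp add: plus_fun_def)
  qed
qed

lemma M_forms_zero: "0 \<in> M_forms 0 k" "0 \<in> M_forms 1 k"
proof -
  show "0 \<in> M_forms 0 k"
    unfolding M_forms_0_iff by (intro exI[of _ "\<lambda>b. 0"]) (simp add: zero_fun_def sform_zero)
  show "0 \<in> M_forms 1 k"
    unfolding M_forms_1_iff
    by (intro exI[of _ "\<lambda>b. 0"]) (simp add: zero_fun_def vform_def pull1_def pull2_def)
qed

lemma M_forms_mult: "F \<in> M_forms 0 k \<Longrightarrow> G \<in> M_forms 0 l \<Longrightarrow> F * G \<in> M_forms 0 (k + l)"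
  "F \<in> M_forms 0 k \<Longrightarrow> G \<in> M_forms 1 l \<Longrightarrow> F * G \<in> M_forms 1 (k + l)"
proof -
  show "F * G \<in> M_forms 0 (k + l)" if FG: "F \<in> M_forms 0 k" "G \<in> M_forms 0 l"
  proof -
    obtain f g where "F = (\<lambda>b. [:f b:])" "G = (\<lambda>b. [:g b:])" "sform k 0 f" "sform l 0 g"
      using FG unfolding M_forms_0_iff by blast
    then show ?thesis
      unfolding M_forms_0_iff using sform_mult[of k 0 f l 0 g]
      by (intro exI[of _ "\<lambda>b. f b * g b"]) (simp add: times_fun_def mult.commute)
  qed
  show "F * G \<in> M_forms 1 (k + l)" if FG: "F \<in> M_forms 0 k" "G \<in> M_forms 1 l"
  proof -
    obtain f g1 g2 where "F = (\<lambda>b. [:f b:])" "G = (\<lambda>b. [:g1 b, g2 b:])" "sform k 0 f" "vform l g1 g2"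
      using FG unfolding M_forms_0_iff M_forms_1_iff by blast
    then show ?thesis
      unfolding M_forms_1_iff using vform_smult[of k f l g1 g2]
      by - (rule exI[of _ "\<lambda>b. f b * g1 b"], rule exI[of _ "\<lambda>b. f b * g2 b"], simp add: times_fun_def mult.commute)
  qed
qed

section \<open>Homogeneous components\<close>

lemma graded_forms_sum:
  assumes "j \<in> {0, 1}" "\<And>i. i \<in> I \<Longrightarrow> F i \<in> M_forms j (w i)"
  shows "(\<Sum>i\<in>I. homog (w i) (F i)) \<in> graded_forms j"
  using assms(2)
proof (induction I rule: infinite_finite_induct)
  case (insert i I)
  have "Poly_Mapping.lookup (homog (w i) (F i)) k + Poly_Mapping.lookup (\<Sum>i\<in>I. homog (w i) (F i)) k \<in> M_forms j k" for k
    using insert assms(1) M_forms_add M_forms_zero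
    by (auto simp: graded_forms_def lookup_single when_def)
  then show ?case using insert(1,2) by (simp add: graded_forms_def lookup_add)
qed (use assms(1) M_forms_zero in \<open>auto simp: graded_forms_def\<close>)

lemma homog_sum: "finite K \<Longrightarrow> Poly_Mapping.keys F \<subseteq> K \<Longrightarrow> (\<Sum>k\<in>K. homog k (Poly_Mapping.lookup F k)) = F"
  by (rule poly_mapping_eqI)
    (auto simp: lookup_sum lookup_single when_def in_keys_iff)

lemma lookup_mult_homog:
  "Poly_Mapping.lookup (F * homog m G) k = Poly_Mapping.lookup F (k - m) * (G :: ball_fun)"
proof -
  have "F * homog m G = (\<Sum>i\<in>Poly_Mapping.keys F. homog i (Poly_Mapping.lookup F i)) * homog m G"
    by (simp add: homog_sum)
  also have "\<dots> = (\<Sum>i\<in>Poly_Mapping.keys F. homog (i + m) (Poly_Mapping.lookup F i * G))"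
    by (simp add: sum_distrib_right mult_single)
  also have "Poly_Mapping.lookup \<dots> k = (\<Sum>i\<in>Poly_Mapping.keys F. if i = k - m then Poly_Mapping.lookup F i * G else 0)"
    unfolding lookup_sum by (rule sum.cong) (auto simp: lookup_single when_def)
  also have "\<dots> = Poly_Mapping.lookup F (k - m) * G"
    by (auto simp: in_keys_iff)
  finally show ?thesis .
qed

context picard_generators
begin

text \<open>The indices are taken in cyclic order, so that the relation with the \<open>p_i\<close>
  holds without signs.\<close>

definition Phi :: "nat \<Rightarrow> ball_fun" where
  "Phi i = (if i = 0 then (\<lambda>b. [:bracket1 p1 p2 b, bracket2 p1 p2 b:])
    else if i = 1 then (\<lambda>b. [:bracket1 p2 p0 b, bracket2 p2 p0 b:])
    else (\<lambda>b. [:bracket1 p0 p1 b, bracket2 p0 p1 b:]))"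

text \<open>The zero form fits any degree; fixing \<open>nat (k div 3)\<close> lets forms of equal
  weight, some of them possibly zero, share one degree.\<close>

lemma ex_poly_total:
  assumes "sform k 0 f"
  obtains P where "\<And>b. ev b P = monom (f b) (nat (k div 3))"
proof (cases "\<forall>b. f b = 0")
  case True
  then show ?thesis using that[of 0] by (simp add: ev_hom)
next
  case False
  obtain P d where P: "k = 3 * int d" "\<And>b. ev b P = monom (f b) d" using ex_poly[OF assms False] by blast
  then have "nat (k div 3) = d" by simp
  then show ?thesis using that P(2) by blast
qed

text \<open>The brackets of \<open>(p2, p0)\<close> and \<open>(p0, p1)\<close> have wedge
  \<open>p0 * jac\<close>, so they are independent at generic points, and Cramer's rule
  applies.\<close>

lemma wedge_eq_0:
  assumes F: "hol F1" "hol F2"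
    and 1: "\<And>b. F1 b * bracket2 p2 p0 b - F2 b * bracket1 p2 p0 b = 0"
    and 2: "\<And>b. F1 b * bracket2 p0 p1 b - F2 b * bracket1 p0 p1 b = 0"
  shows "F1 b = 0" "F2 b = 0"
proof -
  have J: "p0 b * jac b = bracket1 p2 p0 b * bracket2 p0 p1 b - bracket2 p2 p0 b * bracket1 p0 p1 b" for b
    by (simp add: jac_def bracket1_def bracket2_def algebra_simps)
  have nz: "\<not> (\<forall>b. p0 b * jac b = 0)"
    using hol_mult_eq_0[of p0 jac] p0_nonzero jac_nonzero by auto
  have "p0 b * jac b * F1 b = 0" for b
  proof -
    have "p0 b * jac b * F1 b = (F1 b * bracket2 p0 p1 b - F2 b * bracket1 p0 p1 b) * bracket1 p2 p0 b
      - (F1 b * bracket2 p2 p0 b - F2 b * bracket1 p2 p0 b) * bracket1 p0 p1 b"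
      unfolding J by (simp add: algebra_simps)
    then show ?thesis by (simp only: 1 2) simp
  qed
  then show "F1 b = 0"
    using hol_mult_eq_0[of "\<lambda>b. p0 b * jac b" F1] nz F by auto
  have "p0 b * jac b * F2 b = 0" for b
  proof -
    have "p0 b * jac b * F2 b = (F1 b * bracket2 p0 p1 b - F2 b * bracket1 p0 p1 b) * bracket2 p2 p0 b
      - (F1 b * bracket2 p2 p0 b - F2 b * bracket1 p2 p0 b) * bracket2 p0 p1 b"
      unfolding J by (simp add: algebra_simps)
    then show ?thesis by (simp only: 1 2) simp
  qed
  then show "F2 b = 0"
    using hol_mult_eq_0[of "\<lambda>b. p0 b * jac b" F2] nz F by auto
qed

text \<open>The relation says that \<open>T\<close> is orthogonal to \<open>p\<close>, and the
  Koszul solution is a cross product with \<open>p\<close>; the coefficients are taken in degree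
  \<open>d - 1\<close>.\<close>

lemma cross_product_decomposition:
  assumes T: "sform k 0 T0" "sform k 0 T1" "sform k 0 T2"
    and rel: "\<And>b. p0 b * T0 b + p1 b * T1 b + p2 b * T2 b = 0"
  obtains a0 a1 a2 where "sform (k - 3) 0 a0" "sform (k - 3) 0 a1" "sform (k - 3) 0 a2"
    "\<And>b. T0 b = a2 b * p1 b - a1 b * p2 b" "\<And>b. T1 b = a0 b * p2 b - a2 b * p0 b"
    "\<And>b. T2 b = a1 b * p0 b - a0 b * p1 b"
proof (cases "(\<forall>b. T0 b = 0) \<and> (\<forall>b. T1 b = 0) \<and> (\<forall>b. T2 b = 0)")
  case True
  then show ?thesis using that[of "\<lambda>b. 0" "\<lambda>b. 0" "\<lambda>b. 0"] sform_zero by simp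
next
  case False
  then have "\<exists>d. k = 3 * int d" using ex_poly T by metis
  then obtain d where k: "k = 3 * int d" by blast
  then have d: "nat (k div 3) = d" by simp
  obtain P0 P1 P2 where P: "\<And>b. ev b P0 = monom (T0 b) d" "\<And>b. ev b P1 = monom (T1 b) d" "\<And>b. ev b P2 = monom (T2 b) d"
    using ex_poly_total[OF T(1)] ex_poly_total[OF T(2)] ex_poly_total[OF T(3)] unfolding d by metis
  have m: "[:0, x:] = monom x 1" for x :: complex by (simp add: monom_altdef)
  have f0: "f0 b = p1 b - p2 b" for b by (simp add: f0_def)
  \<comment> \<open>In the coordinates of \<open>ev\<close> one has \<open>p2 = p1 - f0\<close>, so
    \<open>p1 T1 + p2 T2 = p1 (T1 + T2) - f0 T2\<close>.\<close>
  have "PX * P0 + PY * (P1 + P2) + PZ * (- P2) = 0"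
  proof (rule ev_eq_0)
    fix b
    have "ev b (PX * P0 + PY * (P1 + P2) + PZ * (- P2)) =
      monom (p0 b * T0 b + p1 b * (T1 b + T2 b) - f0 b * T2 b) (1 + d)"
      unfolding ev_hom ev_gens P m by (simp only: mult_monom add_monom minus_monom distrib_left mult_minus_right diff_conv_add_uminus)
    also have "p0 b * T0 b + p1 b * (T1 b + T2 b) - f0 b * T2 b = 0"
      using rel[of b] by (simp add: f0 algebra_simps)
    finally show "ev b (PX * P0 + PY * (P1 + P2) + PZ * (- P2)) = 0" by simp
  qed
  then obtain A0 A1 A2 where A: "P0 = PY * A2 - PZ * A1" "P1 + P2 = PZ * A0 - PX * A2" "- P2 = PX * A1 - PY * A0"
    by (rule koszul)
  have evA: "monom (T0 b) d = monom (p1 b) 1 * ev b A2 - monom (f0 b) 1 * ev b A1"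
    "monom (T1 b) d + monom (T2 b) d = monom (f0 b) 1 * ev b A0 - monom (p0 b) 1 * ev b A2"
    "- monom (T2 b) d = monom (p0 b) 1 * ev b A1 - monom (p1 b) 1 * ev b A0" for b
    using arg_cong[OF A(1), of "ev b"] arg_cong[OF A(2), of "ev b"] arg_cong[OF A(3), of "ev b"]
    by (simp_all only: ev_hom ev_gens P m)
  \<comment> \<open>A combination of \<open>PX\<close>, \<open>PY\<close> and \<open>PZ\<close> has
    no constant term, so in degree 0 all \<open>T_i\<close> would vanish.\<close>
  have "d \<noteq> 0"
  proof
    assume d0: "d = 0"
    have "T0 b = 0" "T1 b + T2 b = 0" "- T2 b = 0" for b
      using arg_cong[OF evA(1)[of b], of "\<lambda>p. coeff p 0"] arg_cong[OF evA(2)[of b], of "\<lambda>p. coeff p 0"]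
        arg_cong[OF evA(3)[of b], of "\<lambda>p. coeff p 0"]
      by (simp_all add: d0 coeff_monom_mult)
    then show False using False by auto
  qed
  then obtain e where e: "d = Suc e" by (cases d) auto
  define a where "a A b = coeff (ev b A) e" for A b
  have sa: "sform (k - 3) 0 (a A)" for A
    using sform_coeff_ev[of e A] unfolding a_def[abs_def] k e by (simp add: algebra_simps)
  have cf: "T0 b = p1 b * a A2 b - f0 b * a A1 b" "T1 b + T2 b = f0 b * a A0 b - p0 b * a A2 b"
    "- T2 b = p0 b * a A1 b - p1 b * a A0 b" for b
    using arg_cong[OF evA(1)[of b], of "\<lambda>p. coeff p d"] arg_cong[OF evA(2)[of b], of "\<lambda>p. coeff p d"]
      arg_cong[OF evA(3)[of b], of "\<lambda>p. coeff p d"]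
    by (simp_all add: e coeff_monom_mult a_def)
  show ?thesis
  proof (rule that[of "\<lambda>b. - a A0 b" "\<lambda>b. - a A1 b" "\<lambda>b. a A2 b - a A1 b"])
    show "sform (k - 3) 0 (\<lambda>b. - a A0 b)" "sform (k - 3) 0 (\<lambda>b. - a A1 b)"
      using sform_cmult[OF sa, of "-1"] by simp_all
    show "sform (k - 3) 0 (\<lambda>b. a A2 b - a A1 b)"
      using sform_add[OF sa[of A2] sform_cmult[OF sa[of A1], of "-1"]] by simp
    fix b
    show "T0 b = (a A2 b - a A1 b) * p1 b - - a A1 b * p2 b" using cf(1)[of b] by (simp add: f0 algebra_simps)
    show T2: "T2 b = - a A1 b * p0 b - - a A0 b * p1 b" using cf(3)[of b] by (simp add: algebra_simps minus_equation_iff)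
    have "T1 b = (f0 b * a A0 b - p0 b * a A2 b) - T2 b" unfolding cf(2)[symmetric] by simp
    then show "T1 b = - a A0 b * p2 b - (a A2 b - a A1 b) * p0 b"
      by (simp add: T2 f0 algebra_simps)
  qed
qed

text \<open>The combination of the brackets built from the \<open>T_i\<close> has the same wedge
  products with two of the generators as \<open>F\<close>, and these determine a pair of functions
  by \<open>wedge_eq_0\<close>.\<close>

lemma vform_generated:
  assumes F: "vform k F1 F2"
  obtains a0 a1 a2 where "sform (k - 7) 0 a0" "sform (k - 7) 0 a1" "sform (k - 7) 0 a2"
    "\<And>b. F1 b = a0 b * bracket1 p1 p2 b + a1 b * bracket1 p2 p0 b + a2 b * bracket1 p0 p1 b"
    "\<And>b. F2 b = a0 b * bracket2 p1 p2 b + a1 b * bracket2 p2 p0 b + a2 b * bracket2 p0 p1 b"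
proof -
  have hF: "hol F1" "hol F2" using F by (simp_all add: vform_def)
  \<comment> \<open>The weight is \<open>k + 7 + 1\<close>; division by \<open>jac\<close> will
    lower it by 12, and the Koszul step by 3, which leaves \<open>k - 7\<close>.\<close>
  have W: "sform (k + 8) (- 1) (\<lambda>b. F1 b * bracket2 f h b - F2 b * bracket1 f h b)"
    if "sform 3 0 f" "sform 3 0 h" for f h
    using sform_wedge[OF F vform_bracket[OF that]] by (simp add: algebra_simps)
  obtain T0 where T0: "sform (k + 8 - 12) 0 T0" "\<And>b. F1 b * bracket2 p1 p2 b - F2 b * bracket1 p1 p2 b = jac b * T0 b"
    using jac_divides[OF W[OF sform_p(2,3)]] by blast
  obtain T1 where T1: "sform (k + 8 - 12) 0 T1" "\<And>b. F1 b * bracket2 p2 p0 b - F2 b * bracket1 p2 p0 b = jac b * T1 b"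
    using jac_divides[OF W[OF sform_p(3,1)]] by blast
  obtain T2 where T2: "sform (k + 8 - 12) 0 T2" "\<And>b. F1 b * bracket2 p0 p1 b - F2 b * bracket1 p0 p1 b = jac b * T2 b"
    using jac_divides[OF W[OF sform_p(1,2)]] by blast
  have hT: "hol T0" "hol T1" "hol T2" using T0 T1 T2 by (simp_all add: sform_def)
  have "p0 b * T0 b + p1 b * T1 b + p2 b * T2 b = 0" for b
  proof -
    have "jac b * (p0 b * T0 b + p1 b * T1 b + p2 b * T2 b) = 0" for b
    proof -
      have "jac b * (p0 b * T0 b + p1 b * T1 b + p2 b * T2 b)
        = p0 b * (jac b * T0 b) + p1 b * (jac b * T1 b) + p2 b * (jac b * T2 b)" by (simp add: algebra_simps)
      also have "\<dots> = 0"
        unfolding T0(2)[symmetric] T1(2)[symmetric] T2(2)[symmetric]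
        by (simp add: bracket1_def bracket2_def algebra_simps)
      finally show ?thesis .
    qed
    then show ?thesis
      using hol_mult_eq_0[OF hol_jac, of "\<lambda>b. p0 b * T0 b + p1 b * T1 b + p2 b * T2 b"] jac_nonzero hT by auto
  qed
  from cross_product_decomposition[OF T0(1) T1(1) T2(1) this]
  obtain a0 a1 a2 where a: "sform (k + 8 - 12 - 3) 0 a0" "sform (k + 8 - 12 - 3) 0 a1" "sform (k + 8 - 12 - 3) 0 a2"
    "\<And>b. T0 b = a2 b * p1 b - a1 b * p2 b" "\<And>b. T1 b = a0 b * p2 b - a2 b * p0 b"
    "\<And>b. T2 b = a1 b * p0 b - a0 b * p1 b" by blast
  have ha: "hol a0" "hol a1" "hol a2" using a by (simp_all add: sform_def)
  define D1 where "D1 b = F1 b - (a0 b * bracket1 p1 p2 b + a1 b * bracket1 p2 p0 b + a2 b * bracket1 p0 p1 b)" for b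
  define D2 where "D2 b = F2 b - (a0 b * bracket2 p1 p2 b + a1 b * bracket2 p2 p0 b + a2 b * bracket2 p0 p1 b)" for b
  \<comment> \<open>The wedge of two generators is \<open>jac\<close> times the \<open>p_i\<close>
    of the remaining index.\<close>
  have J: "bracket1 p1 p2 b * bracket2 p2 p0 b - bracket2 p1 p2 b * bracket1 p2 p0 b = p2 b * jac b"
    "bracket1 p2 p0 b * bracket2 p0 p1 b - bracket2 p2 p0 b * bracket1 p0 p1 b = p0 b * jac b"
    "bracket1 p0 p1 b * bracket2 p1 p2 b - bracket2 p0 p1 b * bracket1 p1 p2 b = p1 b * jac b" for b
    by (simp_all add: jac_def bracket1_def bracket2_def algebra_simps)
  have 1: "D1 b * bracket2 p2 p0 b - D2 b * bracket1 p2 p0 b = 0" for b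
  proof -
    have "D1 b * bracket2 p2 p0 b - D2 b * bracket1 p2 p0 b =
      (F1 b * bracket2 p2 p0 b - F2 b * bracket1 p2 p0 b)
      - a0 b * (bracket1 p1 p2 b * bracket2 p2 p0 b - bracket2 p1 p2 b * bracket1 p2 p0 b)
      + a2 b * (bracket1 p2 p0 b * bracket2 p0 p1 b - bracket2 p2 p0 b * bracket1 p0 p1 b)"
      by (simp add: D1_def D2_def algebra_simps)
    then show ?thesis unfolding J T1(2) a(5) by (simp add: algebra_simps)
  qed
  have 2: "D1 b * bracket2 p0 p1 b - D2 b * bracket1 p0 p1 b = 0" for b
  proof -
    have "D1 b * bracket2 p0 p1 b - D2 b * bracket1 p0 p1 b =
      (F1 b * bracket2 p0 p1 b - F2 b * bracket1 p0 p1 b)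
      + a0 b * (bracket1 p0 p1 b * bracket2 p1 p2 b - bracket2 p0 p1 b * bracket1 p1 p2 b)
      - a1 b * (bracket1 p2 p0 b * bracket2 p0 p1 b - bracket2 p2 p0 b * bracket1 p0 p1 b)"
      by (simp add: D1_def D2_def algebra_simps)
    then show ?thesis unfolding J T2(2) a(6) by (simp add: algebra_simps)
  qed
  have "hol D1" "hol D2" using hF ha by (simp_all add: D1_def[abs_def] D2_def[abs_def])
  from wedge_eq_0[OF this 1 2] have D: "D1 b = 0" "D2 b = 0" for b by blast+
  show ?thesis
    by (rule that[of a0 a1 a2]) (use a(1-3) D in \<open>simp_all add: D1_def D2_def\<close>)
qed

text \<open>Wedging the relation with two of the generators gives
  \<open>jac * (a0 p1 - a1 p0) = 0\<close> and \<open>jac * (a0 p2 - a2 p0) = 0\<close>, so the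
  coefficients are proportional to the \<open>p_i\<close>. As \<open>PX\<close> is prime and does
  not divide \<open>PY\<close>, the form \<open>p0\<close> divides \<open>a0\<close>.\<close>

lemma relation_multiple:
  assumes a: "sform k 0 a0" "sform k 0 a1" "sform k 0 a2"
    and r1: "\<And>b. a0 b * bracket1 p1 p2 b + a1 b * bracket1 p2 p0 b + a2 b * bracket1 p0 p1 b = 0"
    and r2: "\<And>b. a0 b * bracket2 p1 p2 b + a1 b * bracket2 p2 p0 b + a2 b * bracket2 p0 p1 b = 0"
  obtains c where "sform (k - 3) 0 c" "\<And>b. a0 b = c b * p0 b" "\<And>b. a1 b = c b * p1 b" "\<And>b. a2 b = c b * p2 b"
proof -
  have ha: "hol a0" "hol a1" "hol a2" using a by (simp_all add: sform_def)
  have "jac b * (a0 b * p1 b - a1 b * p0 b) = 0" "jac b * (a0 b * p2 b - a2 b * p0 b) = 0" for b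
  proof -
    let ?R1 = "a0 b * bracket1 p1 p2 b + a1 b * bracket1 p2 p0 b + a2 b * bracket1 p0 p1 b"
    let ?R2 = "a0 b * bracket2 p1 p2 b + a1 b * bracket2 p2 p0 b + a2 b * bracket2 p0 p1 b"
    have "jac b * (a0 b * p1 b - a1 b * p0 b) = - (?R1 * bracket2 p0 p1 b - ?R2 * bracket1 p0 p1 b)"
      "jac b * (a0 b * p2 b - a2 b * p0 b) = ?R1 * bracket2 p2 p0 b - ?R2 * bracket1 p2 p0 b"
      by (simp_all add: jac_def bracket1_def bracket2_def algebra_simps)
    then show "jac b * (a0 b * p1 b - a1 b * p0 b) = 0" "jac b * (a0 b * p2 b - a2 b * p0 b) = 0"
      by (simp_all only: r1 r2) simp_all
  qed
  then have "\<forall>b. a0 b * p1 b - a1 b * p0 b = 0" "\<forall>b. a0 b * p2 b - a2 b * p0 b = 0"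
    using hol_mult_eq_0[OF hol_jac, of "\<lambda>b. a0 b * p1 b - a1 b * p0 b"]
      hol_mult_eq_0[OF hol_jac, of "\<lambda>b. a0 b * p2 b - a2 b * p0 b"] jac_nonzero ha by auto
  then have x: "a0 b * p1 b = a1 b * p0 b" "a0 b * p2 b = a2 b * p0 b" for b by simp_all
  define d where "d = nat (k div 3)"
  obtain P0 P1 where P: "\<And>b. ev b P0 = monom (a0 b) d" "\<And>b. ev b P1 = monom (a1 b) d"
    using ex_poly_total[OF a(1)] ex_poly_total[OF a(2)] unfolding d_def by metis
  have m: "[:0, x:] = monom x 1" for x :: complex by (simp add: monom_altdef)
  have "ev b (P0 * PY - P1 * PX) = 0" for b
    unfolding ev_hom ev_gens P m by (simp only: mult_monom x diff_self)
  then have "P0 * PY - P1 * PX = 0" by (rule ev_eq_0)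
  then have "PX dvd P0 * PY" by simp
  moreover have "prime_elem PX" "\<not> PX dvd PY"
    using line_poly_prime[of 0, unfolded line_poly_simps] line_poly_not_dvd[of 0 1, unfolded line_poly_simps]
    by simp_all
  ultimately have "PX dvd P0" by (simp add: prime_elem_dvd_mult_iff)
  then obtain C where C: "P0 = PX * C" by blast
  have "\<exists>c. hol c \<and> (\<forall>b. a0 b = p0 b * c b)"
  proof (cases d)
    case 0
    have "a0 b = 0" for b
      using arg_cong[OF P(1)[of b], of "\<lambda>p. coeff p 0"] by (simp add: C ev_hom ev_gens m coeff_monom_mult 0 del: mult_pCons_left)
    then show ?thesis by (intro exI[of _ "\<lambda>b. 0"]) simp
  next
    case (Suc e)
    have "a0 b = p0 b * coeff (ev b C) e" for b
      using arg_cong[OF P(1)[of b], of "\<lambda>p. coeff p d"] by (simp add: C ev_hom ev_gens m coeff_monom_mult Suc)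
    then show ?thesis using sform_coeff_ev[of e C] by (intro exI[of _ "\<lambda>b. coeff (ev b C) e"]) (simp add: sform_def)
  qed
  then obtain c where c: "hol c" "\<And>b. a0 b = p0 b * c b" by blast
  have "sform (k - 3) 0 c"
  proof (rule sform_quotient[OF sform_p(1) p0_nonzero c(1)])
    have "(\<lambda>b. p0 b * c b) = a0" using c(2) by auto
    then show "sform (3 + (k - 3)) (0 + 0) (\<lambda>b. p0 b * c b)" using a(1) by simp
  qed
  moreover have "a b = c b * p b" if "hol a" "hol p" "\<And>b. a0 b * p b = a b * p0 b" for a p b
  proof (rule hol_cancel[OF hol_p(1) that(1) hol_mult[OF c(1) that(2)] _ p0_nonzero])
    fix b
    have "p0 b * a b = a0 b * p b" by (simp only: that(3) mult.commute)
    also have "\<dots> = p0 b * (c b * p b)" by (simp only: c(2) mult.assoc)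
    finally show "p0 b * a b = p0 b * (c b * p b)" .
  qed
  from this[OF ha(2) hol_p(2) x(1)] this[OF ha(3) hol_p(3) x(2)]
  have "\<And>b. a1 b = c b * p1 b" "\<And>b. a2 b = c b * p2 b" .
  ultimately show ?thesis using that c(2) by (simp add: mult.commute)
qed

lemma ex_fj_p:
  assumes "FJ_constant_term (\<lambda>b. [:f b:]) (\<lambda>u. 1)"
  shows "\<exists>a. fj f a \<and> a 0 = (\<lambda>u. 1)"
proof -
  obtain c where c: "FJ_expansion (\<lambda>b. [:f b:]) c" "c 0 = (\<lambda>u. 1)"
    using assms unfolding FJ_constant_term_def by blast
  have "fj (\<lambda>b. coeff [:f b:] 0) (\<lambda>n u. coeff (c n u) 0)" using c(1) unfolding FJ_expansion_iff by blast
  then show ?thesis using c(2) by (intro exI[of _ "\<lambda>n u. coeff (c n u) 0"]) simp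
qed

text \<open>A form of weight 3 is a linear combination of the generators, whose constant terms do
  not depend on \<open>u\<close>. This serves for the translates of the generators under
  \<open>Gam\<close>.\<close>

lemma fj_weight_3:
  assumes "sform 3 0 f"
  obtains a \<alpha> where "fj f a" "a 0 = (\<lambda>u. \<alpha>)"
proof -
  obtain P where P: "\<And>b. ev b P = monom (f b) (nat (3 div 3))"
    using ex_poly_total[OF assms] by blast
  obtain \<alpha> \<beta> \<gamma> where l: "\<And>x y z. coeff (ev3 x y z P) 1 = \<alpha> * x + \<beta> * y + \<gamma> * z"
    using coeff_1_ev3 by blast
  have f: "f b = \<alpha> * p0 b + \<beta> * p1 b + \<gamma> * (p1 b - p2 b)" for b
    using l[of "p0 b" "p1 b" "f0 b"] P[of b] by (simp add: ev_def f0_def)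
  obtain a0 where a0: "fj p0 a0" "a0 0 = (\<lambda>u. 1)" using ex_fj_p[OF FJ(1)] by blast
  obtain a1 where a1: "fj p1 a1" "a1 0 = (\<lambda>u. 1)" using ex_fj_p[OF FJ(2)] by blast
  obtain a2 where a2: "fj p2 a2" "a2 0 = (\<lambda>u. 1)" using ex_fj_p[OF FJ(3)] by blast
  note a = a0 a1 a2
  have "fj (\<lambda>b. \<alpha> * p0 b + \<beta> * p1 b + \<gamma> * (p1 b - p2 b)) (\<lambda>n u. \<alpha> * a0 n u + \<beta> * a1 n u + \<gamma> * (a1 n u - a2 n u))"
    by (intro fj_add fj_diff fj_cmult a)
  moreover have "f = (\<lambda>b. \<alpha> * p0 b + \<beta> * p1 b + \<gamma> * (p1 b - p2 b))" using f by blast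
  ultimately show ?thesis
    by (intro that[of "\<lambda>n u. \<alpha> * a0 n u + \<beta> * a1 n u + \<gamma> * (a1 n u - a2 n u)" "\<alpha> + \<beta>"]) (simp_all add: a)
qed

text \<open>The slash of a bracket in weight 7 is the bracket of the translates in weight 3, so
  vanishing at every cusp reduces to \<open>FJ_bracket\<close>.\<close>

lemma bracket_S_forms:
  assumes f: "sform 3 0 f" and h: "sform 3 0 h"
  shows "(\<lambda>b. [:bracket1 f h b, bracket2 f h b:]) \<in> S_forms 1 7"
  unfolding S_forms_def
proof (intro CollectI conjI ballI)
  show "(\<lambda>b. [:bracket1 f h b, bracket2 f h b:]) \<in> M_forms 1 7"
    unfolding M_forms_1_iff using vform_bracket[OF f h] by auto
  fix g assume g: "g \<in> Gam"
  let ?f = "sl 3 g f" and ?h = "sl 3 g h"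
  have hol: "hol f" "hol h" using f h by (simp_all add: sform_def)
  have j: "j1 g b \<noteq> 0" for b using g by simp
  have "f (act g b) = j1 g b powi 3 * ?f b" "h (act g b) = j1 g b powi 3 * ?h b" for b
    using j by (simp_all add: sl_def power_int_minus)
  note pb = pull_bracket[OF g hol hol_sl[OF g hol(1)] hol_sl[OF g hol(2)] this]
  have "j1 g b powi (1 - 7) * (j1 g b powi (2 * 3) * x) = x" for b x
    using j[of b] by (simp add: power_int_minus)
  then have "slash 1 7 (\<lambda>b. [:bracket1 f h b, bracket2 f h b:]) g = (\<lambda>b. [:bracket1 ?f ?h b, bracket2 ?f ?h b:])"
    using pb unfolding slash_1[OF g] by (simp add: fun_eq_iff pull1_def pull2_def coeff_pCons_1 del: One_nat_def)
  moreover obtain a \<alpha> where "fj ?f a" "a 0 = (\<lambda>u. \<alpha>)" using fj_weight_3[OF sform_sl[OF g f]] .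
  moreover obtain c \<gamma> where "fj ?h c" "c 0 = (\<lambda>u. \<gamma>)" using fj_weight_3[OF sform_sl[OF g h]] .
  ultimately show "FJ_constant_term (slash 1 7 (\<lambda>b. [:bracket1 f h b, bracket2 f h b:]) g) (\<lambda>u. 0)"
    using FJ_bracket[OF hol_sl[OF g hol(1)] _ _ hol_sl[OF g hol(2)]] by simp
qed

lemma Phi_S_forms: "Phi i \<in> S_forms 1 7"
  unfolding Phi_def using bracket_S_forms sform_p by simp

lemma Phi_relation: "(\<lambda>b. [:p0 b:]) * Phi 0 + (\<lambda>b. [:p1 b:]) * Phi 1 + (\<lambda>b. [:p2 b:]) * Phi 2 = 0"
  by (simp add: Phi_def fun_eq_iff bracket1_def bracket2_def algebra_simps)

lemma M_forms_1_generated: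
  assumes "F \<in> M_forms 1 k"
  shows "\<exists>A. (\<forall>i. A i \<in> M_forms 0 (k - 7)) \<and> F = A 0 * Phi 0 + A 1 * Phi 1 + A (2::nat) * Phi 2"
proof -
  obtain F1 F2 where F: "F = (\<lambda>b. [:F1 b, F2 b:])" "vform k F1 F2" using assms unfolding M_forms_1_iff by blast
  obtain a0 a1 a2 where a: "sform (k - 7) 0 a0" "sform (k - 7) 0 a1" "sform (k - 7) 0 a2"
    "\<And>b. F1 b = a0 b * bracket1 p1 p2 b + a1 b * bracket1 p2 p0 b + a2 b * bracket1 p0 p1 b"
    "\<And>b. F2 b = a0 b * bracket2 p1 p2 b + a1 b * bracket2 p2 p0 b + a2 b * bracket2 p0 p1 b"
    using vform_generated[OF F(2)] by blast
  define A where "A i b = [:(if i = (0::nat) then a0 b else if i = 1 then a1 b else a2 b):]" for i b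
  have "A i \<in> M_forms 0 (k - 7)" for i
    unfolding M_forms_0_iff using a(1-3)
    by (intro exI[of _ "\<lambda>b. if i = (0::nat) then a0 b else if i = 1 then a1 b else a2 b"]) (cases "i = 0"; cases "i = 1"; simp add: A_def[abs_def])
  moreover have "F = A 0 * Phi 0 + A 1 * Phi 1 + A 2 * Phi 2"
    by (simp add: fun_eq_iff A_def Phi_def F(1) a(4,5))
  ultimately show ?thesis by blast
qed

lemma M_forms_relation:
  assumes A: "A0 \<in> M_forms 0 k" "A1 \<in> M_forms 0 k" "A2 \<in> M_forms 0 k"
    and rel: "A0 * Phi 0 + A1 * Phi 1 + A2 * Phi 2 = 0"
  shows "\<exists>C. C \<in> M_forms 0 (k - 3) \<and> A0 = C * (\<lambda>b. [:p0 b:]) \<and> A1 = C * (\<lambda>b. [:p1 b:]) \<and> A2 = C * (\<lambda>b. [:p2 b:])"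
proof -
  obtain a0 a1 a2 where a: "A0 = (\<lambda>b. [:a0 b:])" "A1 = (\<lambda>b. [:a1 b:])" "A2 = (\<lambda>b. [:a2 b:])"
    "sform k 0 a0" "sform k 0 a1" "sform k 0 a2"
    using A unfolding M_forms_0_iff by blast
  have "a0 b * bracket1 p1 p2 b + a1 b * bracket1 p2 p0 b + a2 b * bracket1 p0 p1 b = 0"
    "a0 b * bracket2 p1 p2 b + a1 b * bracket2 p2 p0 b + a2 b * bracket2 p0 p1 b = 0" for b
    using fun_cong[OF rel, of b] by (simp_all add: a Phi_def mult.commute)
  then obtain c where c: "sform (k - 3) 0 c" "\<And>b. a0 b = c b * p0 b" "\<And>b. a1 b = c b * p1 b" "\<And>b. a2 b = c b * p2 b"
    using relation_multiple[OF a(4-6)] by blast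
  have "(\<lambda>b. [:c b:]) \<in> M_forms 0 (k - 3)" unfolding M_forms_0_iff using c(1) by blast
  then show ?thesis
    by (intro exI[of _ "\<lambda>b. [:c b:]"]) (simp add: a c fun_eq_iff mult.commute)
qed

end

section \<open>From graded forms to functions on the ball\<close>

lemma homog_power: "homog k f ^ n = homog (int n * k) (f ^ n)"
proof (induction n)
  case (Suc n)
  have "k + int n * k = int (Suc n) * k" by (simp add: algebra_simps)
  then show ?case by (simp only: power_Suc Suc.IH mult_single)
qed (simp add: single_one[symmetric] one_fun_def del: single_one)

lemma homog_monomial:
  "graded_const c * homog 3 (\<lambda>b. [:f b:]) ^ l * homog 3 (\<lambda>b. [:g b:]) ^ m * homog 3 (\<lambda>b. [:h b:]) ^ n
    = homog (3 * int (l + m + n)) (\<lambda>b. [:c * f b ^ l * g b ^ m * h b ^ n:])"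
proof -
  have power: "(\<lambda>b. [:f b:]) ^ n = (\<lambda>b. [:f b ^ n:])" for f :: "picard_ball \<Rightarrow> complex" and n
    by (induction n) (simp_all add: fun_eq_iff one_fun_def one_pCons mult.commute)
  show ?thesis
    by (simp add: graded_const_def homog_power mult_single power times_fun_def algebra_simps)
qed

lemma eval3_surj:
  assumes P: "homog k (\<lambda>b. [:f b:]) = eval3 P (homog 3 (\<lambda>b. [:p0 b:])) (homog 3 (\<lambda>b. [:p1 b:])) (homog 3 (\<lambda>b. [:p2 b:]))"
    and nz: "\<not> (\<forall>b. f b = 0)"
  shows "\<exists>Q d. k = 3 * int d \<and> (\<forall>b. ev3 (p0 b) (p1 b) (p1 b - p2 b) Q = monom (f b) d)"
proof -
  let ?c = "Poly_Mapping.lookup P"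
  define T where "T x b = (case x of (l, m, n) \<Rightarrow> ?c x * p0 b ^ l * p1 b ^ m * p2 b ^ n)" for x b
  define w where "w x = (case x of (l, m, n) \<Rightarrow> (l + m + n :: nat))" for x :: "nat \<times> nat \<times> nat"
  have "homog k (\<lambda>b. [:f b:]) = (\<Sum>x\<in>Poly_Mapping.keys P. homog (3 * int (w x)) (\<lambda>b. [:T x b:]))"
    unfolding P eval3_def by (rule sum.cong) (auto simp: homog_monomial T_def w_def simp del: of_nat_add)
  then have "Poly_Mapping.lookup (homog k (\<lambda>b. [:f b:])) k =
     Poly_Mapping.lookup (\<Sum>x\<in>Poly_Mapping.keys P. homog (3 * int (w x)) (\<lambda>b. [:T x b:])) k" by simp
  then have eq: "(\<lambda>b. [:f b:]) = (\<Sum>x\<in>Poly_Mapping.keys P. if 3 * int (w x) = k then (\<lambda>b. [:T x b:]) else 0)"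
    by (simp add: lookup_sum lookup_single when_def)
  have f: "f b = (\<Sum>x\<in>Poly_Mapping.keys P. if 3 * int (w x) = k then T x b else 0)" for b
  proof -
    have sum_app: "(\<Sum>x\<in>A. g x) b = (\<Sum>x\<in>A. g x b)" for A and g :: "_ \<Rightarrow> ball_fun"
      by (induction A rule: infinite_finite_induct) auto
    have "[:f b:] = (\<Sum>x\<in>Poly_Mapping.keys P. (if 3 * int (w x) = k then (\<lambda>b. [:T x b:]) else 0) b)"
      using fun_cong[OF eq, of b] by (simp only: sum_app)
    then have "coeff [:f b:] 0 = coeff (\<Sum>x\<in>Poly_Mapping.keys P. (if 3 * int (w x) = k then (\<lambda>b. [:T x b:]) else 0) b) 0"
      by simp
    then show ?thesis by (simp add: coeff_sum if_distrib[of "\<lambda>h. coeff (h b) 0"] cong: if_cong)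
  qed
  obtain b0 where "f b0 \<noteq> 0" using nz by blast
  \<comment> \<open>If no monomial had weight \<open>k\<close> the sum would be zero; hence
    \<open>k\<close> is a multiple of 3.\<close>
  then have "\<exists>x0. 3 * int (w x0) = k"
    unfolding f by (rule contrapos_np) (auto intro: sum.neutral)
  then obtain x0 where x0: "3 * int (w x0) = k" ..
  define d where "d = w x0"
  have k: "k = 3 * int d" using x0 by (simp add: d_def)
  \<comment> \<open>Monomials of other weights are dropped, and \<open>p2\<close> is rewritten as
    \<open>PY - PZ\<close>.\<close>
  define Q where "Q = (\<Sum>x\<in>Poly_Mapping.keys P. if w x = d then
     (case x of (l, m, n) \<Rightarrow> PC (?c x) * PX ^ l * PY ^ m * (PY - PZ) ^ n) else 0)"
  have "ev3 (p0 b) (p1 b) (p1 b - p2 b) Q = monom (f b) d" for b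
  proof -
    let ?e = "ev3 (p0 b) (p1 b) (p1 b - p2 b)"
    have sum_e: "?e (\<Sum>x\<in>A. g x) = (\<Sum>x\<in>A. ?e (g x))" for A and g :: "_ \<Rightarrow> complex poly poly poly"
      by (induction A rule: infinite_finite_induct) (simp_all add: ev3_hom)
    have m: "[:0, z:] ^ n = monom (z ^ n) n" for z :: complex and n
    proof -
      have "[:0, z:] = monom z 1" by (simp add: monom_altdef)
      then show ?thesis by (simp add: monom_power)
    qed
    have m0: "[:z:] = monom z 0" for z :: complex by (simp add: monom_0)
    have "?e (PC (?c x) * PX ^ l * PY ^ m * (PY - PZ) ^ n) = monom (T x b) (w x)" if "x = (l, m, n)" for x l m n
      unfolding ev3_hom ev3_gens that T_def w_def
      by (simp add: m) (simp add: m0 mult_monom smult_monom)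
    then have "?e (if w x = d then (case x of (l, m, n) \<Rightarrow> PC (?c x) * PX ^ l * PY ^ m * (PY - PZ) ^ n) else 0)
        = monom (if 3 * int (w x) = k then T x b else 0) d" for x
      by (cases x) (simp add: k ev3_hom)
    then show ?thesis unfolding Q_def sum_e f by (simp add: monom_sum)
  qed
  with k show ?thesis by blast
qed

lemma homog_in_graded_forms: "f \<in> M_forms 0 k \<Longrightarrow> homog k f \<in> graded_forms 0"
  by (auto simp: graded_forms_def lookup_single when_def M_forms_zero)

lemma x_form_eq: "x_form (\<lambda>b. [:p0 b:]) (\<lambda>b. [:p1 b:]) (\<lambda>b. [:p2 b:]) i = (\<lambda>b. [:xform p0 p1 p2 i b:])"
  by (auto simp: fun_eq_iff x_form_def xform_def numeral_poly)

lemma normalized_generators_locale: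
  assumes s: "s \<in> {1, - 1}" and N: "normalized_generators s \<phi>0 \<phi>1 \<phi>2"
  obtains p0 p1 p2 where "picard_generators s p0 p1 p2"
    "\<phi>0 = (\<lambda>b. [:p0 b:])" "\<phi>1 = (\<lambda>b. [:p1 b:])" "\<phi>2 = (\<lambda>b. [:p2 b:])"
proof -
  have R: "polynomial_ring_of_forms \<phi>0 \<phi>1 \<phi>2" using N by (simp add: normalized_generators_def)
  then have M: "\<phi>0 \<in> M_forms 0 3" "\<phi>1 \<in> M_forms 0 3" "\<phi>2 \<in> M_forms 0 3"
    and U: "\<And>F. F \<in> graded_forms 0 \<Longrightarrow> \<exists>!P. F = eval3 P (homog 3 \<phi>0) (homog 3 \<phi>1) (homog 3 \<phi>2)"
    by (auto simp: polynomial_ring_of_forms_def)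
  obtain p0 p1 p2 where p: "\<phi>0 = (\<lambda>b. [:p0 b:])" "\<phi>1 = (\<lambda>b. [:p1 b:])" "\<phi>2 = (\<lambda>b. [:p2 b:])"
    "sform 3 0 p0" "sform 3 0 p1" "sform 3 0 p2"
    using M unfolding M_forms_0_iff by blast
  have "picard_generators s p0 p1 p2"
  proof
    show "s \<in> {1, - 1}" "sform 3 0 p0" "sform 3 0 p1" "sform 3 0 p2" using s p by auto
    show "FJ_constant_term (\<lambda>b. [:p0 b:]) (\<lambda>u. 1)" "FJ_constant_term (\<lambda>b. [:p1 b:]) (\<lambda>u. 1)"
      "FJ_constant_term (\<lambda>b. [:p2 b:]) (\<lambda>u. 1)"
      using N p(1-3) by (simp_all add: normalized_generators_def)
    show "\<exists>P d. k = 3 * int d \<and> (\<forall>b. ev3 (p0 b) (p1 b) (p1 b - p2 b) P = monom (f b) d)"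
      if f: "sform k 0 f" "\<not> (\<forall>b. f b = 0)" for k f
    proof -
      have "(\<lambda>b. [:f b:]) \<in> M_forms 0 k" unfolding M_forms_0_iff using f(1) by blast
      then obtain P where "homog k (\<lambda>b. [:f b:]) = eval3 P (homog 3 \<phi>0) (homog 3 \<phi>1) (homog 3 \<phi>2)"
        using U homog_in_graded_forms by blast
      then show ?thesis unfolding p(1-3) using f(2) by (rule eval3_surj)
    qed
    show "\<not> (\<forall>b. p1 b = p2 b)"
    proof
      assume "\<forall>b. p1 b = p2 b"
      then have e: "\<phi>1 = \<phi>2" using p by simp
      have c1: "graded_const 1 = 1"
        unfolding graded_const_def by (simp add: one_pCons[symmetric] one_fun_def[symmetric])
      \<comment> \<open>Equal generators would be represented by two different monomials, against
        uniqueness.\<close>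
      have "homog 3 \<phi>1 = eval3 (Poly_Mapping.single (0, 1, 0) 1) (homog 3 \<phi>0) (homog 3 \<phi>1) (homog 3 \<phi>2)"
        "homog 3 \<phi>1 = eval3 (Poly_Mapping.single (0, 0, 1) 1) (homog 3 \<phi>0) (homog 3 \<phi>1) (homog 3 \<phi>2)"
        by (simp_all add: eval3_def c1 e)
      then have "Poly_Mapping.single (0, 1, 0) (1::complex) = Poly_Mapping.single (0::nat, 0::nat, 1::nat) 1"
        using U[OF homog_in_graded_forms[OF M(2)]] by blast
      moreover have "Poly_Mapping.lookup (Poly_Mapping.single (0, 1, 0) (1::complex)) (0::nat, 1::nat, 0::nat) = 1"
        "Poly_Mapping.lookup (Poly_Mapping.single (0, 0, 1) (1::complex)) (0::nat, 1::nat, 0::nat) = 0"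
        by (simp_all add: lookup_single_not_eq)
      ultimately show False by (metis zero_neq_one)
    qed
    show "sl 3 (matrix_inv g) (xform p0 p1 p2 i) b = of_int (sign \<sigma>) * xform p0 p1 p2 (\<sigma> i) b"
      if "g \<in> Gam" "det g = 1" "induces_perm s g \<sigma>" "i \<in> {1..4}" for g \<sigma> i b
    proof -
      have "slash 0 3 (x_form \<phi>0 \<phi>1 \<phi>2 i) (matrix_inv g) = of_int (sign \<sigma>) * x_form \<phi>0 \<phi>1 \<phi>2 (\<sigma> i)"
        using N that by (simp add: normalized_generators_def)
      from fun_cong[OF this, of b]
      have "[:sl 3 (matrix_inv g) (xform p0 p1 p2 i) b:] = of_int (sign \<sigma>) b * [:xform p0 p1 p2 (\<sigma> i) b:]"
        unfolding p(1-3) x_form_eq slash_0 by (simp add: sl_def times_fun_def)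
      moreover have "(of_int (sign \<sigma>) :: ball_fun) b = [:of_int (sign \<sigma>):]"
      proof -
        have "sign \<sigma> = 1 \<or> sign \<sigma> = - 1" by (cases \<sigma> rule: sign_cases) simp_all
        then show ?thesis by (elim disjE) (simp_all add: one_pCons one_fun_def)
      qed
      ultimately show ?thesis by simp
    qed
  qed
  then show ?thesis using that p by blast
qed

theorem theorem1p1:
  fixes s :: complex and \<phi>0 \<phi>1 \<phi>2 :: "picard_ball \<Rightarrow> complex poly"
  assumes "s \<in> {1, - 1}"
    and "normalized_generators s \<phi>0 \<phi>1 \<phi>2"
  shows "\<exists>\<Phi>0 \<Phi>1 \<Phi>2.
    \<Phi>0 \<in> S_forms 1 7 \<and> \<Phi>1 \<in> S_forms 1 7 \<and> \<Phi>2 \<in> S_forms 1 7 \<and>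
    graded_forms 1 =
      {a0 * homog 7 \<Phi>0 + a1 * homog 7 \<Phi>1 + a2 * homog 7 \<Phi>2 | a0 a1 a2.
        a0 \<in> graded_forms 0 \<and> a1 \<in> graded_forms 0 \<and> a2 \<in> graded_forms 0} \<and>
    \<phi>0 * \<Phi>0 + \<phi>1 * \<Phi>1 + \<phi>2 * \<Phi>2 = 0 \<and>
    {(a0, a1, a2). a0 \<in> graded_forms 0 \<and> a1 \<in> graded_forms 0 \<and> a2 \<in> graded_forms 0 \<and>
        a0 * homog 7 \<Phi>0 + a1 * homog 7 \<Phi>1 + a2 * homog 7 \<Phi>2 = 0} =
      {(c * homog 3 \<phi>0, c * homog 3 \<phi>1, c * homog 3 \<phi>2) | c. c \<in> graded_forms 0}"
proof -
  obtain p0 p1 p2 where gens: "picard_generators s p0 p1 p2"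
    and \<phi>: "\<phi>0 = (\<lambda>b. [:p0 b:])" "\<phi>1 = (\<lambda>b. [:p1 b:])" "\<phi>2 = (\<lambda>b. [:p2 b:])"
    using normalized_generators_locale[OF assms] .
  interpret picard_generators s p0 p1 p2 by (rule gens)
  have M\<phi>: "\<phi>0 \<in> M_forms 0 3" "\<phi>1 \<in> M_forms 0 3" "\<phi>2 \<in> M_forms 0 3"
    unfolding \<phi> M_forms_0_iff using sform_p by blast+
  have MPhi: "Phi i \<in> M_forms 1 7" for i using Phi_S_forms[of i] by (simp add: S_forms_def)
  have rel: "\<phi>0 * Phi 0 + \<phi>1 * Phi 1 + \<phi>2 * Phi 2 = 0" unfolding \<phi> by (rule Phi_relation)
  have prod_in: "F * homog m G \<in> graded_forms j"
    if "F \<in> graded_forms 0" "G \<in> M_forms j m" "j \<in> {0, 1}" for F m G j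
    unfolding graded_forms_def
  proof (intro CollectI allI)
    fix k
    have "Poly_Mapping.lookup F (k - m) \<in> M_forms 0 (k - m)" using that(1) by (simp add: graded_forms_def)
    then show "Poly_Mapping.lookup (F * homog m G) k \<in> M_forms j k"
      unfolding lookup_mult_homog using M_forms_mult(1)[of _ "k - m" G m] M_forms_mult(2)[of _ "k - m" G m] that(2,3) by auto
  qed
  have gen: "graded_forms 1 = {a0 * homog 7 (Phi 0) + a1 * homog 7 (Phi 1) + a2 * homog 7 (Phi 2) | a0 a1 a2.
        a0 \<in> graded_forms 0 \<and> a1 \<in> graded_forms 0 \<and> a2 \<in> graded_forms 0}" (is "_ = ?R")
  proof
    show "?R \<subseteq> graded_forms 1"
    proof
      fix x assume "x \<in> ?R"
      then obtain a0 a1 a2 where "a0 \<in> graded_forms 0" "a1 \<in> graded_forms 0" "a2 \<in> graded_forms 0"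
        and x: "x = a0 * homog 7 (Phi 0) + a1 * homog 7 (Phi 1) + a2 * homog 7 (Phi 2)" by blast
      then have "a0 * homog 7 (Phi 0) \<in> graded_forms 1" "a1 * homog 7 (Phi 1) \<in> graded_forms 1"
        "a2 * homog 7 (Phi 2) \<in> graded_forms 1"
        using prod_in[OF _ MPhi] by simp_all
      then show "x \<in> graded_forms 1"
        unfolding graded_forms_def x by (simp add: lookup_add M_forms_add(2) del: One_nat_def)
    qed
    show "graded_forms 1 \<subseteq> ?R"
    proof
      fix F assume F: "F \<in> graded_forms 1"
      let ?K = "Poly_Mapping.keys F"
      have "\<forall>k. \<exists>A. (\<forall>i. A i \<in> M_forms 0 (k - 7)) \<and> Poly_Mapping.lookup F k = A 0 * Phi 0 + A 1 * Phi 1 + A (2::nat) * Phi 2"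
        using F M_forms_1_generated by (simp add: graded_forms_def)
      then obtain A where A: "\<And>k i. A k i \<in> M_forms 0 (k - 7)"
        "\<And>k. Poly_Mapping.lookup F k = A k 0 * Phi 0 + A k 1 * Phi 1 + A k (2::nat) * Phi 2" by metis
      define a where "a i = (\<Sum>k\<in>?K. homog (k - 7) (A k i))" for i
      have "a i \<in> graded_forms 0" for i unfolding a_def by (rule graded_forms_sum) (use A in auto)
      moreover have "F = a 0 * homog 7 (Phi 0) + a 1 * homog 7 (Phi 1) + a 2 * homog 7 (Phi 2)"
      proof -
        have "F = (\<Sum>k\<in>?K. homog k (Poly_Mapping.lookup F k))" by (simp add: homog_sum)
        also have "\<dots> = a 0 * homog 7 (Phi 0) + a 1 * homog 7 (Phi 1) + a 2 * homog 7 (Phi 2)"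
          by (simp add: A(2) a_def sum_distrib_right mult_single single_add sum.distrib)
        finally show ?thesis .
      qed
      ultimately show "F \<in> ?R" by blast
    qed
  qed
  have syz: "{(a0, a1, a2). a0 \<in> graded_forms 0 \<and> a1 \<in> graded_forms 0 \<and> a2 \<in> graded_forms 0 \<and>
        a0 * homog 7 (Phi 0) + a1 * homog 7 (Phi 1) + a2 * homog 7 (Phi 2) = 0} =
      {(c * homog 3 \<phi>0, c * homog 3 \<phi>1, c * homog 3 \<phi>2) | c. c \<in> graded_forms 0}" (is "?L = ?R")
  proof
    show "?R \<subseteq> ?L"
    proof
      fix x assume "x \<in> ?R"
      then obtain c where c: "c \<in> graded_forms 0" "x = (c * homog 3 \<phi>0, c * homog 3 \<phi>1, c * homog 3 \<phi>2)" by blast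
      have "c * homog 3 \<phi>0 * homog 7 (Phi 0) + c * homog 3 \<phi>1 * homog 7 (Phi 1) + c * homog 3 \<phi>2 * homog 7 (Phi 2)
        = c * (homog 3 \<phi>0 * homog 7 (Phi 0) + homog 3 \<phi>1 * homog 7 (Phi 1) + homog 3 \<phi>2 * homog 7 (Phi 2))"
        by (simp add: algebra_simps)
      also have "\<dots> = c * homog 10 (\<phi>0 * Phi 0 + \<phi>1 * Phi 1 + \<phi>2 * Phi 2)"
        by (simp add: mult_single single_add)
      also have "\<dots> = 0" unfolding rel by simp
      finally show "x \<in> ?L"
        using prod_in[OF c(1)] M\<phi> by (simp add: c(2))
    qed
    show "?L \<subseteq> ?R"
    proof clarify
      fix a0 a1 a2
      assume a: "a0 \<in> graded_forms 0" "a1 \<in> graded_forms 0" "a2 \<in> graded_forms 0"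
        and r: "a0 * homog 7 (Phi 0) + a1 * homog 7 (Phi 1) + a2 * homog 7 (Phi 2) = 0"
      let ?l = Poly_Mapping.lookup
      have "\<exists>C. C \<in> M_forms 0 (k - 3) \<and> ?l a0 k = C * \<phi>0 \<and> ?l a1 k = C * \<phi>1 \<and> ?l a2 k = C * \<phi>2" for k
        unfolding \<phi>
      proof (rule M_forms_relation)
        show "?l a0 k \<in> M_forms 0 k" "?l a1 k \<in> M_forms 0 k" "?l a2 k \<in> M_forms 0 k"
          using a by (simp_all add: graded_forms_def)
        \<comment> \<open>The generators have weight 7, so the components of weight \<open>k\<close>
          of the coefficients meet in weight \<open>k + 7\<close>.\<close>
        have "?l (a0 * homog 7 (Phi 0) + a1 * homog 7 (Phi 1) + a2 * homog 7 (Phi 2)) (k + 7) = 0"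
          unfolding r by simp
        then show "?l a0 k * Phi 0 + ?l a1 k * Phi 1 + ?l a2 k * Phi 2 = 0"
          by (simp add: lookup_add lookup_mult_homog)
      qed
      then obtain C where C: "\<And>k. C k \<in> M_forms 0 (k - 3)" "\<And>k. ?l a0 k = C k * \<phi>0" "\<And>k. ?l a1 k = C k * \<phi>1"
        "\<And>k. ?l a2 k = C k * \<phi>2" by metis
      \<comment> \<open>A common finite support, so that one \<open>c\<close> serves all three
        coefficients.\<close>
      define K where "K = Poly_Mapping.keys a0 \<union> Poly_Mapping.keys a1 \<union> Poly_Mapping.keys a2"
      have K: "finite K" by (simp add: K_def)
      define c where "c = (\<Sum>k\<in>K. homog (k - 3) (C k))"
      have "c \<in> graded_forms 0" unfolding c_def by (rule graded_forms_sum) (use C in auto)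
      moreover have "a = c * homog 3 f" if "\<And>k. ?l a k = C k * f" "Poly_Mapping.keys a \<subseteq> K" for a f
      proof -
        have "a = (\<Sum>k\<in>K. homog k (?l a k))" by (rule homog_sum[symmetric, OF K that(2)])
        also have "\<dots> = c * homog 3 f" by (simp add: c_def that(1) sum_distrib_right mult_single)
        finally show ?thesis .
      qed
      from this[OF C(2)] this[OF C(3)] this[OF C(4)]
      have "a0 = c * homog 3 \<phi>0" "a1 = c * homog 3 \<phi>1" "a2 = c * homog 3 \<phi>2"
        by (auto simp: K_def)
      ultimately show "\<exists>c. (a0, a1, a2) = (c * homog 3 \<phi>0, c * homog 3 \<phi>1, c * homog 3 \<phi>2) \<and> c \<in> graded_forms 0"
        by blast
    qed
  qed
  show ?thesis
    by (intro exI[of _ "Phi 0"] exI[of _ "Phi 1"] exI[of _ "Phi 2"] conjI Phi_S_forms gen rel syz)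
qed

end
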